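(* Let $S$ be a stationary, stochastically continuous, union-i.d. random set in $\mathbb R^d$ with $\mathbb P[t\in S]<1$ for all $t\in\mathbb R^d$. Then there is a $\sigma$-finite Borel space $(\Omega,\mathcal B,\mu)$, a measurable, measure-preserving $\mathbb R^d$-action $\{T_t\}_{t\in\mathbb R^d}$ on $(\Omega,\mathcal B,\mu)$, and a set $A\in\mathcal B$ with $\mu(A)<\infty$ such that $$S\stackrel{d}{=}\{t\in\mathbb R^d:\Pi_\mu(T_t^{-1}(A))\ne0\},$$ where $\Pi_\mu$ is a Poisson random measure on $(\Omega,\mathcal B)$ with intensity measure $\mu$.
   Context: A random set $S\subset\mathbb R^d$ is identified with a measurable process $\{X(t),t\in\mathbb R^d\}$ taking only the values $0,1$, via $S=\{t:X(t)=1\}$, i.e. $X(t)=\mathbf 1_{t\in S}$ (no closedness is required). Equality in distribution $\stackrel{d}{=}$ of random sets means equality of the finite-dimensional distributions of the indicator processes; stationarity means that the indicator process is stationary. $S$ is union-i.d. if for every $n\in\mathbb N$ there are i.i.d. random sets $C_1,\dots,C_n$ such that $S$ has the same finite-dimensional distributions as $C_1\cup\dots\cup C_n$. $S$ is stochastically continuous if for every $t\in\mathbb R^d$, $\lim_{s\to t}\mathbb P[t\in S,s\notin S]=\lim_{s\to t}\mathbb P[t\notin S,s\in S]=0$. A $\sigma$-finite Borel space is a measurable space isomorphic to a complete separable metric space with its Borel $\sigma$-algebra, endowed with a $\sigma$-finite measure. A measure space isomorphism (modulo null sets) is a bijection between complements of null sets, measurable with measurable inverse, preserving measure. A measure-preserving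 $\mathbb R^d$-action on $(\Omega,\mathcal B,\mu)$ is a family $\{T_t\}_{t\in\mathbb R^d}$ of measure space isomorphisms $T_t:\Omega\to\Omega$ such that $T_0=\mathrm{id}$ $\mu$-a.e. and $T_t\circ T_s=T_{t+s}$ $\mu$-a.e. for all $t,s$; it is measurable if $(t,\omega)\mapsto T_t(\omega)$ is measurable from $\mathbb R^d\times\Omega$ (product $\sigma$-algebra) to $\Omega$. *)

theory Defs
  imports "HOL-Probability.Probability"
begin

section \<open>Random sets\<close>

definition ind_process :: "('a \<Rightarrow> 't set) \<Rightarrow> 't \<Rightarrow> 'a \<Rightarrow> real"
  where "ind_process S t \<omega> = indicator (S \<omega>) t"

text \<open>A measurable process is one that is jointly measurable in time and chance.\<close>

definition random_set :: "'a measure \<Rightarrow> ('a \<Rightarrow> 't::topological_space set) \<Rightarrow> bool"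
  where "random_set M S \<longleftrightarrow> prob_space M \<and>
    (\<lambda>(t, \<omega>). ind_process S t \<omega>) \<in> borel_measurable (borel \<Otimes>\<^sub>M M)"

definition fin_dim_distr :: "'a measure \<Rightarrow> ('t \<Rightarrow> 'a \<Rightarrow> real) \<Rightarrow> 't set \<Rightarrow> ('t \<Rightarrow> real) measure"
  where "fin_dim_distr M X J = distr M (PiM J (\<lambda>_. borel)) (\<lambda>\<omega>. \<lambda>t\<in>J. X t \<omega>)"

definition eq_fin_dim_distr ::
    "'a measure \<Rightarrow> ('t \<Rightarrow> 'a \<Rightarrow> real) \<Rightarrow> 'b measure \<Rightarrow> ('t \<Rightarrow> 'b \<Rightarrow> real) \<Rightarrow> bool"
  where "eq_fin_dim_distr M X N Y \<longleftrightarrow>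
    (\<forall>J. finite J \<longrightarrow> fin_dim_distr M X J = fin_dim_distr N Y J)"

definition eq_distr_sets ::
    "'a measure \<Rightarrow> ('a \<Rightarrow> 't set) \<Rightarrow> 'b measure \<Rightarrow> ('b \<Rightarrow> 't set) \<Rightarrow> bool"
  where "eq_distr_sets M S N R \<longleftrightarrow> eq_fin_dim_distr M (ind_process S) N (ind_process R)"

definition stationary_process :: "'a measure \<Rightarrow> ('t::plus \<Rightarrow> 'a \<Rightarrow> real) \<Rightarrow> bool"
  where "stationary_process M X \<longleftrightarrow> (\<forall>h. eq_fin_dim_distr M (\<lambda>t. X (t + h)) M X)"

definition stationary_set :: "'a measure \<Rightarrow> ('a \<Rightarrow> 't::plus set) \<Rightarrow> bool"
  where "stationary_set M S \<longleftrightarrow> stationary_process M (ind_process S)"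

definition stochastically_continuous_set ::
    "'a measure \<Rightarrow> ('a \<Rightarrow> 't::topological_space set) \<Rightarrow> bool"
  where "stochastically_continuous_set M S \<longleftrightarrow> (\<forall>t.
    ((\<lambda>s. measure M {\<omega> \<in> space M. t \<in> S \<omega> \<and> s \<notin> S \<omega>}) \<longlongrightarrow> 0) (at t) \<and>
    ((\<lambda>s. measure M {\<omega> \<in> space M. t \<notin> S \<omega> \<and> s \<in> S \<omega>}) \<longlongrightarrow> 0) (at t))"

text \<open>Independence of random sets is independence of their indicator processes, as random
  elements of the product space over all times.\<close>

definition iid_random_sets ::
    "'b measure \<Rightarrow> nat \<Rightarrow> (nat \<Rightarrow> 'b \<Rightarrow> 't::topological_space set) \<Rightarrow> bool"
  where "iid_random_sets N n C \<longleftrightarrow> prob_space N \<and>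
    (\<forall>i<n. random_set N (C i)) \<and>
    prob_space.indep_vars N (\<lambda>_. PiM UNIV (\<lambda>_. borel))
      (\<lambda>i \<omega> t. ind_process (C i) t \<omega>) {..<n} \<and>
    (\<forall>i<n. \<forall>j<n. eq_distr_sets N (C i) N (C j))"

text \<open>The type argument is the type of sample points of the spaces carrying the \<open>C\<^sub>i\<close>; HOL
  cannot quantify existentially over it.  A theorem assuming \<open>union_id TYPE('b) M S\<close> for a
  type variable \<open>'b\<close> therefore covers every choice of those spaces.\<close>

definition union_id ::
    "'b itself \<Rightarrow> 'a measure \<Rightarrow> ('a \<Rightarrow> 't::topological_space set) \<Rightarrow> bool"
  where "union_id (_ :: 'b itself) M S \<longleftrightarrow> (\<forall>n\<ge>1. \<exists>(N :: 'b measure) C.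
    iid_random_sets N n C \<and> eq_distr_sets M S N (\<lambda>\<omega>. \<Union>i<n. C i \<omega>))"

section \<open>Borel spaces and measure preserving actions\<close>

definition borel_algebra_of :: "'a topology \<Rightarrow> 'a measure"
  where "borel_algebra_of X = sigma (topspace X) {U. openin X U}"

text \<open>Taking the metric space to live on the type \<open>'a\<close> of \<open>M\<close> is no restriction, since a
  metric can be transported along the isomorphism.\<close>

definition borel_space :: "'a measure \<Rightarrow> bool"
  where "borel_space M \<longleftrightarrow> (\<exists>(m :: 'a metric) f.
    mcomplete_of m \<and> separable_space (mtopology_of m) \<and>
    bij_betw f (space M) (mspace m) \<and>
    f \<in> M \<rightarrow>\<^sub>M borel_algebra_of (mtopology_of m) \<and>
    the_inv_into (space M) f \<in> borel_algebra_of (mtopology_of m) \<rightarrow>\<^sub>M M)"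

definition sigma_finite_borel_space :: "'a measure \<Rightarrow> bool"
  where "sigma_finite_borel_space M \<longleftrightarrow> borel_space M \<and> sigma_finite_measure M"

definition measure_iso_mod_null :: "'a measure \<Rightarrow> 'b measure \<Rightarrow> ('a \<Rightarrow> 'b) \<Rightarrow> bool"
  where "measure_iso_mod_null M N f \<longleftrightarrow> (\<exists>Z\<in>null_sets M. \<exists>W\<in>null_sets N.
    bij_betw f (space M - Z) (space N - W) \<and>
    f \<in> restrict_space M (space M - Z) \<rightarrow>\<^sub>M restrict_space N (space N - W) \<and>
    the_inv_into (space M - Z) f
      \<in> restrict_space N (space N - W) \<rightarrow>\<^sub>M restrict_space M (space M - Z) \<and>
    (\<forall>B\<in>sets N. B \<subseteq> space N - W \<longrightarrow>
      emeasure M (f -` B \<inter> (space M - Z)) = emeasure N B))"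

definition mp_action :: "'w measure \<Rightarrow> ('t::monoid_add \<Rightarrow> 'w \<Rightarrow> 'w) \<Rightarrow> bool"
  where "mp_action \<mu> T \<longleftrightarrow>
    (\<forall>t. T t \<in> space \<mu> \<rightarrow> space \<mu> \<and> measure_iso_mod_null \<mu> \<mu> (T t)) \<and>
    (AE w in \<mu>. T 0 w = w) \<and>
    (\<forall>t s. AE w in \<mu>. T t (T s w) = T (t + s) w)"

definition measurable_mp_action ::
    "'w measure \<Rightarrow> ('t::{monoid_add,topological_space} \<Rightarrow> 'w \<Rightarrow> 'w) \<Rightarrow> bool"
  where "measurable_mp_action \<mu> T \<longleftrightarrow> mp_action \<mu> T \<and>
    (\<lambda>(t, w). T t w) \<in> borel \<Otimes>\<^sub>M \<mu> \<rightarrow>\<^sub>M \<mu>"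

section \<open>Poisson random measures\<close>

text \<open>The law of the count is written out instead of using \<^const>\<open>poisson_pmf\<close>, which
  requires a positive rate; the formula includes rate 0 since \<open>0 ^ 0 = 1\<close>.\<close>

definition poisson_random_measure ::
    "'p measure \<Rightarrow> ('p \<Rightarrow> 'w measure) \<Rightarrow> 'w measure \<Rightarrow> bool"
  where "poisson_random_measure P \<Phi> \<mu> \<longleftrightarrow> prob_space P \<and>
    (\<forall>p\<in>space P. sets (\<Phi> p) = sets \<mu>) \<and>
    (\<forall>B\<in>sets \<mu>. (\<lambda>p. emeasure (\<Phi> p) B) \<in> borel_measurable P) \<and>
    (\<forall>B\<in>sets \<mu>. emeasure \<mu> B < \<infinity> \<longrightarrow> (\<forall>k::nat.
      measure P {p \<in> space P. emeasure (\<Phi> p) B = of_nat k}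
        = measure \<mu> B ^ k / fact k * exp (- measure \<mu> B))) \<and>
    (\<forall>B\<in>sets \<mu>. emeasure \<mu> B = \<infinity> \<longrightarrow> (AE p in P. emeasure (\<Phi> p) B = \<infinity>)) \<and>
    (\<forall>(n::nat) B. (\<forall>i<n. B i \<in> sets \<mu>) \<and> disjoint_family_on B {..<n} \<longrightarrow>
      prob_space.indep_vars P (\<lambda>_. borel) (\<lambda>i p. emeasure (\<Phi> p) (B i)) {..<n})"

definition hitting_set ::
    "'w measure \<Rightarrow> ('t \<Rightarrow> 'w \<Rightarrow> 'w) \<Rightarrow> 'w set \<Rightarrow> ('p \<Rightarrow> 'w measure) \<Rightarrow> 'p \<Rightarrow> 't set"
  where "hitting_set \<mu> T A \<Phi> p = {t. emeasure (\<Phi> p) (T t -` A \<inter> space \<mu>) \<noteq> 0}"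

text \<open>Sample types used for existential statements: every standard Borel space, and hence
  also every standard Borel probability space, is isomorphic to one carried by a closed subset of
  \<open>nat \<Rightarrow> real\<close>, because every Polish space embeds as a closed subspace of a countable power
  of the real line.\<close>

type_synonym real_seq = "nat \<Rightarrow> real"

end

theory Submission
  imports Defs
begin

text \<open>
  Let \<open>Q J\<close> be the probability that the set misses the finite set \<open>J\<close>.  Union infinite divisibility
  says that \<open>Q\<close> is, for every \<open>n\<close>, the \<open>n\<close>-th power of the corresponding function of a random set
  \<open>C\<^sub>n\<close>.  As \<open>n\<close> grows, \<open>n * (1 - Q J powr (1 / n))\<close> tends to \<open>\<Psi> J = - ln (Q J)\<close>, so \<open>n\<close> times the law
  of \<open>C\<^sub>n\<close>, restricted to the event that \<open>C\<^sub>n\<close> contains a given point \<open>t\<close>, converges on every finite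
  set of coordinates.  Kolmogorov's extension theorem turns the limits into a finite measure \<open>K t\<close> on
  all subsets of the space (\<open>conditioned_limit\<close>).  On the subsets that contain both \<open>s\<close> and \<open>t\<close> the
  measures \<open>K s\<close> and \<open>K t\<close> agree (\<open>K_swap\<close>), so all of them are restrictions of a single measure
  \<open>levy\<close>, which is \<open>\<sigma>\<close>-finite and translation invariant and gives mass \<open>\<Psi> J\<close> to the subsets that meet
  \<open>J\<close>.  The union of a Poisson process of subsets with this intensity misses \<open>J\<close> with probability
  \<open>exp (- \<Psi> J) = Q J\<close>, and void probabilities determine finite-dimensional distributions
  (\<open>measure_eqI_void\<close>).

  The space of all subsets is too large to be a Borel space, and translation is not jointly measurable
  on it.  Stochastic continuity repairs both.  By stationarity the measure of the subsets that
  distinguish \<open>s\<close> from \<open>t\<close> depends on \<open>t - s\<close> only, and it tends to \<open>0\<close> with \<open>t - s\<close>.  Hence there is a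
  jointly measurable version of the indicator process, and its averages over small balls converge to
  it almost everywhere, at a speed that does not depend on the location.  Suitably scaled, these
  averages are 1-Lipschitz functions of the location.  A subset is thereby encoded by a sequence of
  1-Lipschitz functions, and these by their values on a dense sequence, that is, by an element of
  \<open>nat \<Rightarrow> real\<close>.  On the closed set of all such codes translation is a jointly measurable action, and
  as each code has only one Lipschitz extension the group law holds everywhere, not just almost
  everywhere.  Encoding commutes with translation almost everywhere (\<open>AE_encode_shift\<close>), so
  the image of \<open>levy\<close> is invariant, and the averages at \<open>0\<close> decide whether \<open>0\<close> belongs to the subset
  (\<open>AE_smooth_decides\<close>), which yields the set \<open>A\<close>.

  It remains to construct a Poisson random measure.  A \<open>\<sigma>\<close>-finite intensity is cut into pieces of
  finite mass; each piece receives a Poisson number of independent points.  That the superposition has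
  independent Poisson counts on disjoint sets is read off from joint probability generating functions,
  which are easy to compute and, being power series, determine the counts
  (\<open>poisson_random_measure_of_pgf\<close>).
\<close>

section \<open>Laws of random sets and their void probabilities\<close>

text \<open>
  A subset of \<open>'t\<close> is coded by its indicator function; measurable events are those that depend on
  countably many points.
\<close>
abbreviation cyl :: "('t \<Rightarrow> bool) measure"
  where "cyl \<equiv> PiM UNIV (\<lambda>_. count_space UNIV)"

definition void :: "'t set \<Rightarrow> ('t \<Rightarrow> bool) set"
  where "void J = {x. \<forall>s\<in>J. \<not> x s}"

lemma space_cyl [simp]: "space (cyl :: ('t \<Rightarrow> bool) measure) = UNIV"
  by (simp add: space_PiM)

lemma pred_coordinate [measurable]: "Measurable.pred cyl (\<lambda>x. x s)"
  using measurable_component_singleton[of s UNIV "\<lambda>_. count_space (UNIV :: bool set)"] by simp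

lemma Collect_in_sets_cyl: "Measurable.pred cyl P \<Longrightarrow> {x. P x} \<in> sets cyl"
  by (simp add: pred_def)

lemma void_in_sets [measurable]: "finite J \<Longrightarrow> void J \<in> sets cyl"
  unfolding void_def by (intro Collect_in_sets_cyl pred_intros_finite) auto

text \<open>
  Missing a point has hitting it as complement, so void events alone generate all coordinates.
\<close>
lemma sets_cyl_eq_sigma_void:
  "sets (cyl :: ('t \<Rightarrow> bool) measure) = sigma_sets UNIV {void J |J. finite J}" (is "_ = ?S")
proof
  have "sets (cyl :: ('t \<Rightarrow> bool) measure)
    = sigma_sets UNIV {{f. f i \<in> A} |i A. A \<in> (UNIV :: bool set set)}"
    by (simp add: sets_PiM_single PiE_def extensional_def)
  also have "\<dots> \<subseteq> ?S"
  proof (rule sigma_sets_mono, safe)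
    fix i :: 't and A :: "bool set"
    have v: "{f. \<not> f i} \<in> ?S"
      by (rule sigma_sets.Basic) (auto simp: void_def intro!: exI[of _ "{i}"])
    from sigma_sets.Compl[OF v] have c: "{f. f i} \<in> ?S"
      by (simp add: Compl_eq_Diff_UNIV[symmetric] Collect_neg_eq[symmetric])
    have "{f. f i \<in> A} = (if True \<in> A then {f. f i} else {}) \<union> (if False \<in> A then {f. \<not> f i} else {})"
      (is "?L = ?R")
    proof (rule set_eqI)
      show "f \<in> ?L \<longleftrightarrow> f \<in> ?R" for f by (cases "f i") simp_all
    qed
    also have "\<dots> \<in> ?S"
      using v c by (intro sigma_sets_Un) (auto intro: sigma_sets.Empty)
    finally show "{f. f i \<in> A} \<in> ?S" .
  qed
  finally show "sets (cyl :: ('t \<Rightarrow> bool) measure) \<subseteq> ?S" .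
next
  show "?S \<subseteq> sets (cyl :: ('t \<Rightarrow> bool) measure)"
    using sets.sigma_sets_subset[of "{void J |J. finite J}" "cyl :: ('t \<Rightarrow> bool) measure"]
    by (auto intro: void_in_sets)
qed

text \<open>
  Missing \<open>J\<close> and missing \<open>K\<close> means missing \<open>J \<union> K\<close>: the void events form a generator that is closed
  under intersection, which is why void probabilities determine a law.
\<close>
lemma measure_eqI_void:
  fixes M N :: "('t \<Rightarrow> bool) measure"
  assumes "sets M = sets cyl" "sets N = sets cyl"
    and fin: "emeasure M UNIV \<noteq> \<infinity>"
    and eq: "\<And>J. finite J \<Longrightarrow> emeasure M (void J) = emeasure N (void J)"
  shows "M = N"
proof (rule measure_eqI_generator_eq[where E = "{void J |J. finite J}" and \<Omega> = UNIV and A = "\<lambda>_. UNIV"])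
  show "Int_stable {void J |J :: 't set. finite J}"
  proof (rule Int_stableI, safe)
    fix J K :: "'t set" assume "finite J" "finite K"
    then show "\<exists>L. void J \<inter> void K = void L \<and> finite L"
      by (intro exI[of _ "J \<union> K"]) (auto simp: void_def)
  qed
  show "range (\<lambda>_. UNIV) \<subseteq> {void J |J :: 't set. finite J}" by (auto simp: void_def intro!: exI[of _ "{}"])
qed (use assms in \<open>auto simp: sets_cyl_eq_sigma_void\<close>)

text \<open>
  Induction on \<open>K\<close>: hitting one more point \<open>t\<close> is the difference of imposing nothing on \<open>t\<close> and missing
  \<open>t\<close>.
\<close>
lemma convergent_void_hit:
  fixes R :: "nat \<Rightarrow> ('t \<Rightarrow> bool) measure"
  assumes prob: "\<And>n. prob_space (R n)" and sets [measurable_cong]: "\<And>n. sets (R n) = sets cyl"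
    and conv: "\<And>J. finite J \<Longrightarrow> convergent (\<lambda>n. measure (R n) (void J))"
    and "finite J" "finite K"
  shows "convergent (\<lambda>n. measure (R n) {x. (\<forall>s\<in>J. \<not> x s) \<and> (\<forall>s\<in>K. x s)})"
  using \<open>finite K\<close> \<open>finite J\<close>
proof (induction K arbitrary: J)
  case empty
  then show ?case using conv[of J] by (simp add: void_def)
next
  case (insert t K)
  have "measure (R n) {x. (\<forall>s\<in>J. \<not> x s) \<and> (\<forall>s\<in>insert t K. x s)}
     = measure (R n) {x. (\<forall>s\<in>J. \<not> x s) \<and> (\<forall>s\<in>K. x s)}
       - measure (R n) {x. (\<forall>s\<in>insert t J. \<not> x s) \<and> (\<forall>s\<in>K. x s)}" for n
  proof -
    interpret prob_space "R n" by (rule prob)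
    have [simp]: "space (R n) = UNIV" using sets_eq_imp_space_eq[OF sets[of n]] by simp
    have m: "{x. (\<forall>s\<in>I. \<not> x s) \<and> (\<forall>s\<in>L. x s)} \<in> sets (R n)" if "finite I" "finite L" for I L :: "'t set"
      unfolding sets by (intro Collect_in_sets_cyl pred_intros_logic pred_intros_finite that) auto
    have "{x. (\<forall>s\<in>J. \<not> x s) \<and> (\<forall>s\<in>insert t K. x s)}
       = {x. (\<forall>s\<in>J. \<not> x s) \<and> (\<forall>s\<in>K. x s)} - {x. (\<forall>s\<in>insert t J. \<not> x s) \<and> (\<forall>s\<in>K. x s)}"
      by blast
    also have "measure (R n) \<dots> = measure (R n) {x. (\<forall>s\<in>J. \<not> x s) \<and> (\<forall>s\<in>K. x s)}
       - measure (R n) {x. (\<forall>s\<in>insert t J. \<not> x s) \<and> (\<forall>s\<in>K. x s)}"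
      using insert.hyps(1) insert.prems by (intro finite_measure_Diff m) auto
    finally show ?thesis .
  qed
  moreover have "convergent (\<lambda>n. measure (R n) {x. (\<forall>s\<in>J. \<not> x s) \<and> (\<forall>s\<in>K. x s)}
       - measure (R n) {x. (\<forall>s\<in>insert t J. \<not> x s) \<and> (\<forall>s\<in>K. x s)})"
    using insert.prems by (intro convergent_diff insert.IH) auto
  ultimately show ?case by (simp only:)
qed

text \<open>
  Compactness of the laws of random subsets.  Over a finite set \<open>J\<close> there are only finitely many
  configurations, so the limits of their probabilities form a measure without any tightness condition,
  and these measures inherit consistency.  Kolmogorov's theorem needs Polish coordinate spaces, so the
  coordinates are taken to be real numbers that are \<open>0\<close> or \<open>1\<close>.
\<close>
lemma prob_space_limit_of_void:
  fixes R :: "nat \<Rightarrow> ('t \<Rightarrow> bool) measure"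
  assumes prob: "\<And>n. prob_space (R n)" and sets [measurable_cong]: "\<And>n. sets (R n) = sets cyl"
    and conv: "\<And>J. finite J \<Longrightarrow> convergent (\<lambda>n. measure (R n) (void J))"
  shows "\<exists>R'. prob_space R' \<and> sets R' = sets cyl \<and>
    (\<forall>J. finite J \<longrightarrow> (\<lambda>n. measure (R n) (void J)) \<longlonglongrightarrow> measure R' (void J))"
proof -
  \<comment> \<open>The measure \<open>P J\<close> has an atom of mass \<open>l J v\<close> at each 0-1 vector \<open>v\<close>.\<close>
  define V where "V J = (\<Pi>\<^sub>E s\<in>J. {0, 1 :: real})" for J :: "'t set"
  define c where "c J v = {x. \<forall>s\<in>J. of_bool (x s) = (v s :: real)}" for J :: "'t set" and v
  define l where "l J v = lim (\<lambda>n. measure (R n) (c J v))" for J v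
  define P where "P J = distr (point_measure (V J) (\<lambda>v. ennreal (l J v))) (PiM J (\<lambda>_. borel)) (\<lambda>v. v)" for J
  define f where "f J x = (\<lambda>s\<in>J. of_bool (x s) :: real)" for J :: "'t set" and x
  have space [simp]: "space (R n) = UNIV" for n using sets_eq_imp_space_eq[OF sets[of n]] by simp
  have finV: "finite (V J)" if "finite J" for J using that by (auto simp: V_def intro!: finite_PiE)
  have fV: "f J x \<in> V J" for J x by (auto simp: f_def V_def)
  have f_eq: "f J x = v \<longleftrightarrow> x \<in> c J v" if "v \<in> V J" for J x v
    using that by (auto simp: f_def c_def V_def fun_eq_iff PiE_def extensional_def)
  have fm: "f J \<in> R n \<rightarrow>\<^sub>M PiM J (\<lambda>_. borel)" for J n
    unfolding f_def by measurable
  have cm: "c J v \<in> sets (R n)" if "finite J" for J v n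
    unfolding c_def sets by (intro Collect_in_sets_cyl pred_intros_finite that) measurable
  have lim_l: "(\<lambda>n. measure (R n) (c J v)) \<longlonglongrightarrow> l J v" if "finite J" "v \<in> V J" for J v
  proof -
    have "c J v = {x. (\<forall>s\<in>{s\<in>J. v s = 0}. \<not> x s) \<and> (\<forall>s\<in>{s\<in>J. v s = 1}. x s)}"
      using that(2) by (fastforce simp: c_def V_def PiE_iff)
    then show ?thesis
      using convergent_void_hit[OF prob sets conv, of "{s\<in>J. v s = 0}" "{s\<in>J. v s = 1}"] that(1)
      by (simp add: l_def convergent_LIMSEQ_iff)
  qed
  have l0: "0 \<le> l J v" if "finite J" "v \<in> V J" for J v
    by (rule LIMSEQ_le_const[OF lim_l[OF that]]) auto
  have Vm: "(\<lambda>v. v) \<in> point_measure (V J) (\<lambda>v. ennreal (l J v)) \<rightarrow>\<^sub>M PiM J (\<lambda>_. borel)" for J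
    by (auto simp: V_def space_PiM)
  have P_eq: "emeasure (P J) B = ennreal (\<Sum>v\<in>V J \<inter> B. l J v)"
    if "finite J" "B \<in> sets (PiM J (\<lambda>_. borel))" for J B
  proof -
    have "emeasure (P J) B = emeasure (point_measure (V J) (\<lambda>v. ennreal (l J v))) (B \<inter> V J)"
      using that Vm[of J] by (simp add: P_def emeasure_distr space_point_measure)
    also have "\<dots> = (\<Sum>v\<in>B \<inter> V J. ennreal (l J v))"
      by (rule emeasure_point_measure_finite) (use finV that in auto)
    also have "\<dots> = ennreal (\<Sum>v\<in>V J \<inter> B. l J v)"
      by (subst sum_ennreal) (use l0 that in \<open>auto simp: Int_commute\<close>)
    finally show ?thesis .
  qed
  have P_lim: "(\<lambda>n. emeasure (R n) (f J -` B)) \<longlonglongrightarrow> emeasure (P J) B"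
    if J: "finite J" "B \<in> sets (PiM J (\<lambda>_. borel))" for J B
  proof -
    have "measure (R n) (f J -` B) = (\<Sum>v\<in>V J \<inter> B. measure (R n) (c J v))" for n
    proof -
      interpret prob_space "R n" by (rule prob)
      have "f J -` B = (\<Union>v\<in>V J \<inter> B. c J v)"
      proof (intro set_eqI iffI)
        fix x assume "x \<in> f J -` B"
        then show "x \<in> (\<Union>v\<in>V J \<inter> B. c J v)"
          using fV[of J x] f_eq[OF fV[of J x], of x] by auto
      next
        fix x assume "x \<in> (\<Union>v\<in>V J \<inter> B. c J v)"
        then obtain v where "v \<in> V J" "v \<in> B" "x \<in> c J v" by auto
        then show "x \<in> f J -` B" using f_eq[of v J x] by simp
      qed
      moreover have "disjoint_family_on (c J) (V J \<inter> B)"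
      proof (unfold disjoint_family_on_def, intro ballI impI equals0I)
        fix v w x assume "v \<in> V J \<inter> B" "w \<in> V J \<inter> B" "v \<noteq> w" "x \<in> c J v \<inter> c J w"
        then show False using f_eq[of v J x] f_eq[of w J x] by simp
      qed
      ultimately show ?thesis
        using finV[OF J(1)] cm[OF J(1)] by (simp add: finite_measure_finite_Union image_subset_iff)
    qed
    then have "(\<lambda>n. measure (R n) (f J -` B)) \<longlonglongrightarrow> (\<Sum>v\<in>V J \<inter> B. l J v)"
      using J by (auto intro!: tendsto_sum lim_l)
    then show ?thesis
      unfolding P_eq[OF J] using prob by (simp add: finite_measure.emeasure_eq_measure prob_space_def)
  qed
  interpret pp: polish_projective UNIV P
  proof (intro polish_projective.intro projective_family.intro)
    fix J H :: "'t set" assume JH: "J \<subseteq> H" "finite H"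
    then have J: "finite J" using finite_subset by auto
    have rm: "(\<lambda>f. restrict f J) \<in> PiM H (\<lambda>_. borel) \<rightarrow>\<^sub>M PiM J (\<lambda>_. borel :: real measure)"
      using JH by (intro measurable_restrict_subset)
    then have rm': "(\<lambda>f. restrict f J) \<in> P H \<rightarrow>\<^sub>M PiM J (\<lambda>_. borel :: real measure)"
      by (simp add: P_def)
    show "P J = distr (P H) (PiM J (\<lambda>_. borel)) (\<lambda>f. restrict f J)"
    proof (rule measure_eqI)
      show "sets (P J) = sets (distr (P H) (PiM J (\<lambda>_. borel)) (\<lambda>f. restrict f J))" by (simp add: P_def)
      fix B assume "B \<in> sets (P J)"
      then have B: "B \<in> sets (PiM J (\<lambda>_. borel))" by (simp add: P_def)
      let ?B = "(\<lambda>f. restrict f J) -` B \<inter> space (P H)"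
      have "?B \<in> sets (PiM H (\<lambda>_. borel))"
        using measurable_sets[OF rm' B] by (simp add: P_def)
      from P_lim[OF JH(2) this]
      have 1: "(\<lambda>n. emeasure (R n) (f H -` ?B)) \<longlonglongrightarrow> emeasure (P H) ?B" .
      have "f H -` ?B = f J -` B"
        using JH(1) by (auto simp: f_def P_def space_PiM Int_absorb1)
      with 1 P_lim[OF J B] have "emeasure (P J) B = emeasure (P H) ?B"
        using LIMSEQ_unique by auto
      then show "emeasure (P J) B = emeasure (distr (P H) (PiM J (\<lambda>_. borel)) (\<lambda>f. restrict f J)) B"
        by (simp add: emeasure_distr[OF rm' B])
    qed
  next
    fix J :: "'t set" assume J: "finite J"
    show "prob_space (P J)"
    proof
      have "f J -` space (P J) = UNIV" by (auto simp: P_def f_def space_PiM)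
      moreover have "(\<lambda>n. emeasure (R n) (f J -` space (P J))) \<longlonglongrightarrow> emeasure (P J) (space (P J))"
        using J by (intro P_lim) (auto simp: P_def)
      moreover have "emeasure (R n) UNIV = 1" for n using prob_space.emeasure_space_1[OF prob[of n]] by simp
      ultimately show "emeasure (P J) (space (P J)) = 1"
        using LIMSEQ_unique[OF _ tendsto_const] by fastforce
    qed
  qed
  define g where "g x s \<longleftrightarrow> x s \<noteq> (0::real)" for x and s :: 't
  have "(\<lambda>x. x s) \<in> PiM UNIV (\<lambda>_. borel :: real measure) \<rightarrow>\<^sub>M borel" for s :: 't
    by simp
  then have [measurable]: "(\<lambda>x. x s) \<in> borel_measurable pp.lim" for s
    by (simp cong: measurable_cong_sets)
  have [measurable]: "g \<in> pp.lim \<rightarrow>\<^sub>M cyl"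
    unfolding g_def by (rule measurable_PiM_single') auto
  have s: "{\<lambda>s\<in>J. 0} \<in> sets (PiM J (\<lambda>_. borel :: real measure))" if "finite J" for J :: "'t set"
  proof -
    have "{\<lambda>s\<in>J. 0 :: real} = PiE J (\<lambda>_. {0})" by (auto simp: PiE_def extensional_def fun_eq_iff)
    also have "\<dots> \<in> sets (PiM J (\<lambda>_. borel))" using that by (intro sets_PiM_I_finite) auto
    finally show ?thesis .
  qed
  let ?R = "distr pp.lim cyl g"
  have R': "emeasure ?R (void J) = emeasure (P J) {\<lambda>s\<in>J. 0}" if "finite J" for J
  proof -
    have "emeasure ?R (void J) = emeasure pp.lim (g -` void J \<inter> space pp.lim)"
      using that by (intro emeasure_distr) auto
    also have "g -` void J \<inter> space pp.lim = pp.emb UNIV J {\<lambda>s\<in>J. 0}"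
      by (auto simp: prod_emb_def g_def void_def space_PiM restrict_def fun_eq_iff) meson
    also have "emeasure pp.lim \<dots> = emeasure (P J) {\<lambda>s\<in>J. 0}"
      using that s by (intro pp.emeasure_lim_emb) auto
    finally show ?thesis .
  qed
  have "prob_space ?R" by (rule pp.P.prob_space_distr) simp
  moreover have "(\<lambda>n. measure (R n) (void J)) \<longlonglongrightarrow> measure ?R (void J)" if J: "finite J" for J
  proof -
    have zV: "(\<lambda>s\<in>J. 0) \<in> V J" by (auto simp: V_def)
    have "void J = c J (\<lambda>s\<in>J. 0)" by (auto simp: void_def c_def)
    moreover have "measure ?R (void J) = l J (\<lambda>s\<in>J. 0)"
      using R'[OF J] P_eq[OF J s[OF J]] zV l0[OF J zV] by (simp add: measure_def)
    ultimately show ?thesis using lim_l[OF J zV] by simp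
  qed
  ultimately show ?thesis by (intro exI[of _ ?R]) auto
qed

lemma ind_process_measurable:
  assumes "random_set M S"
  shows "ind_process S t \<in> borel_measurable M"
proof -
  have "(\<lambda>\<omega>. (case (t, \<omega>) of (t, \<omega>) \<Rightarrow> ind_process S t \<omega>)) \<in> borel_measurable M"
    by (rule measurable_compose[OF measurable_Pair1']) (use assms in \<open>auto simp: random_set_def\<close>)
  then show ?thesis by simp
qed

lemma pred_mem_random_set:
  assumes "random_set M S"
  shows "Measurable.pred M (\<lambda>\<omega>. t \<in> S \<omega>)"
proof -
  have "Measurable.pred M (\<lambda>\<omega>. ind_process S t \<omega> \<noteq> 0)"
    using ind_process_measurable[OF assms, of t] by measurable
  moreover have "ind_process S t \<omega> \<noteq> 0 \<longleftrightarrow> t \<in> S \<omega>" for \<omega>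
    by (simp add: ind_process_def indicator_def)
  ultimately show ?thesis by simp
qed

definition miss_prob :: "'a measure \<Rightarrow> ('a \<Rightarrow> 't set) \<Rightarrow> 't set \<Rightarrow> real"
  where "miss_prob M S J = measure M {\<omega> \<in> space M. \<forall>t\<in>J. t \<notin> S \<omega>}"

definition set_law :: "'a measure \<Rightarrow> ('a \<Rightarrow> 't set) \<Rightarrow> ('t \<Rightarrow> bool) measure"
  where "set_law M S = distr M cyl (\<lambda>\<omega> t. t \<in> S \<omega>)"

lemma set_law_measurable:
  assumes "\<And>t. Measurable.pred M (\<lambda>\<omega>. t \<in> S \<omega>)"
  shows "(\<lambda>\<omega> t. t \<in> S \<omega>) \<in> M \<rightarrow>\<^sub>M cyl"
  by (rule measurable_PiM_single') (use assms in auto)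

lemma emeasure_set_law_void:
  assumes "prob_space M" "\<And>t. Measurable.pred M (\<lambda>\<omega>. t \<in> S \<omega>)" "finite J"
  shows "emeasure (set_law M S) (void J) = ennreal (miss_prob M S J)"
proof -
  interpret prob_space M by fact
  have "(\<lambda>\<omega> t. t \<in> S \<omega>) -` void J \<inter> space M = {\<omega> \<in> space M. \<forall>t\<in>J. t \<notin> S \<omega>}"
    by (auto simp: void_def)
  then show ?thesis
    unfolding set_law_def miss_prob_def
    by (subst emeasure_distr[OF set_law_measurable[OF assms(2)] void_in_sets[OF assms(3)]])
       (simp add: emeasure_eq_measure)
qed

lemma fin_dim_distr_eq_distr_set_law:
  assumes "\<And>t. Measurable.pred M (\<lambda>\<omega>. t \<in> S \<omega>)"
  shows "fin_dim_distr M (ind_process S) J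
    = distr (set_law M S) (PiM J (\<lambda>_. borel)) (\<lambda>x. \<lambda>t\<in>J. of_bool (x t))"
proof -
  have "(\<lambda>x. \<lambda>t\<in>J. of_bool (x t) :: real) \<in> cyl \<rightarrow>\<^sub>M PiM J (\<lambda>_. borel)"
    by measurable
  then show ?thesis
    using set_law_measurable[OF assms]
    unfolding fin_dim_distr_def set_law_def
    by (subst distr_distr) (auto simp: ind_process_def comp_def indicator_def of_bool_def)
qed

text \<open>
  Finite-dimensional distributions are images of the law on \<open>cyl\<close>, which the void probabilities
  determine.
\<close>
lemma eq_distr_sets_of_miss_prob:
  assumes "prob_space M" "\<And>t. Measurable.pred M (\<lambda>\<omega>. t \<in> S \<omega>)"
    and "prob_space N" "\<And>t. Measurable.pred N (\<lambda>\<omega>. t \<in> R \<omega>)"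
    and eq: "\<And>J. finite J \<Longrightarrow> miss_prob M S J = miss_prob N R J"
  shows "eq_distr_sets M S N R"
proof -
  interpret L: prob_space "set_law M S"
    unfolding set_law_def by (rule prob_space.prob_space_distr[OF assms(1) set_law_measurable]) (rule assms(2))
  have "set_law M S = set_law N R"
  proof (rule measure_eqI_void)
    show "emeasure (set_law M S) UNIV \<noteq> \<infinity>" by (rule L.emeasure_finite[of UNIV, unfolded infinity_ennreal_def[symmetric]])
  qed (use assms in \<open>auto simp: set_law_def emeasure_set_law_void[unfolded set_law_def]\<close>)
  then show ?thesis
    using assms by (simp add: eq_distr_sets_def eq_fin_dim_distr_def fin_dim_distr_eq_distr_set_law)
qed

lemma eq_fin_dim_distr_void:
  assumes "\<And>t. X t \<in> borel_measurable M" "\<And>t. Y t \<in> borel_measurable N"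
    and eq: "eq_fin_dim_distr M X N Y" and "finite J"
  shows "measure M {\<omega> \<in> space M. \<forall>t\<in>J. X t \<omega> = 0} = measure N {\<omega> \<in> space N. \<forall>t\<in>J. Y t \<omega> = 0}"
proof -
  let ?Z = "{f \<in> space (PiM J (\<lambda>_. borel :: real measure)). \<forall>t\<in>J. f t = 0}"
  have Z: "?Z \<in> sets (PiM J (\<lambda>_. borel))"
    using \<open>finite J\<close> by measurable
  have *: "measure (fin_dim_distr L W J) ?Z = measure L {\<omega> \<in> space L. \<forall>t\<in>J. W t \<omega> = 0}"
    if W: "\<And>t. W t \<in> borel_measurable L" for L :: "'z measure" and W
  proof -
    have "(\<lambda>\<omega>. \<lambda>t\<in>J. W t \<omega>) \<in> L \<rightarrow>\<^sub>M PiM J (\<lambda>_. borel)" using W by measurable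
    moreover have "(\<lambda>\<omega>. \<lambda>t\<in>J. W t \<omega>) -` ?Z \<inter> space L = {\<omega> \<in> space L. \<forall>t\<in>J. W t \<omega> = 0}"
      by (auto simp: space_PiM)
    ultimately show ?thesis using Z by (simp add: fin_dim_distr_def measure_distr)
  qed
  have "fin_dim_distr M X J = fin_dim_distr N Y J"
    using eq \<open>finite J\<close> by (simp add: eq_fin_dim_distr_def)
  then show ?thesis
    using *[of X M, OF assms(1)] *[of Y N, OF assms(2)] by simp
qed

lemma miss_prob_eq:
  fixes S :: "'a \<Rightarrow> 't set" and R :: "'b \<Rightarrow> 't set"
  assumes "\<And>t. Measurable.pred M (\<lambda>\<omega>. t \<in> S \<omega>)" "\<And>t. Measurable.pred N (\<lambda>\<omega>. t \<in> R \<omega>)"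
    and "eq_distr_sets M S N R" and "finite J"
  shows "miss_prob M S J = miss_prob N R J"
proof -
  have m: "ind_process W t \<in> borel_measurable L" if "\<And>t. Measurable.pred L (\<lambda>\<omega>. t \<in> W \<omega>)"
    for L :: "'z measure" and W and t :: 't
  proof -
    have "ind_process W t = (\<lambda>\<omega>. of_bool (t \<in> W \<omega>))" by (auto simp: ind_process_def fun_eq_iff)
    then show ?thesis using that[of t] by simp
  qed
  show ?thesis
    using eq_fin_dim_distr_void[of "ind_process S" M "ind_process R" N J, OF m m] assms
    by (simp add: ind_process_def eq_distr_sets_def miss_prob_def indicator_eq_0_iff)
qed

lemma miss_prob_shift:
  fixes S :: "'a \<Rightarrow> ('t :: {topological_space, plus}) set"
  assumes "random_set M S" "stationary_set M S" "finite J"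
  shows "miss_prob M S ((\<lambda>s. s + h) ` J) = miss_prob M S J"
  using eq_fin_dim_distr_void[of "\<lambda>t. ind_process S (t + h)" M "ind_process S" M J] assms
    ind_process_measurable[OF assms(1)]
  by (simp add: ind_process_def stationary_set_def stationary_process_def miss_prob_def indicator_eq_0_iff)

section \<open>Canonical measures of union infinitely divisible sets\<close>

text \<open>
  A union misses \<open>J\<close> if and only if every member does; by independence and equality in distribution the
  void probability of \<open>S\<close> is the \<open>n\<close>-th power of the void probability of one member.
\<close>
lemma union_id_root:
  fixes S :: "'a \<Rightarrow> ('t :: topological_space) set"
  assumes S: "random_set M S" and id: "union_id TYPE('b) M S" and n: "n \<ge> 1"
  shows "\<exists>R. prob_space R \<and> sets R = sets cyl \<and>
    (\<forall>J. finite J \<longrightarrow> measure R (void J) ^ n = miss_prob M S J)"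
proof -
  obtain N :: "'b measure" and C where iid: "iid_random_sets N n C"
    and eq: "eq_distr_sets M S N (\<lambda>\<omega>. \<Union>i<n. C i \<omega>)"
    using id n unfolding union_id_def by blast
  interpret prob_space N using iid by (simp add: iid_random_sets_def)
  have C: "Measurable.pred N (\<lambda>\<omega>. t \<in> C i \<omega>)" if "i < n" for i t
    using iid that by (intro pred_mem_random_set) (auto simp: iid_random_sets_def)
  have U: "Measurable.pred N (\<lambda>\<omega>. t \<in> (\<Union>i<n. C i \<omega>))" for t
    using C by simp
  define R where "R = set_law N (C 0)"
  have "measure R (void J) ^ n = miss_prob M S J" if J: "finite J" for J
  proof -
    let ?Z = "{f :: 't \<Rightarrow> real. \<forall>t\<in>J. f t = 0}"
    have Z: "?Z \<in> sets (PiM UNIV (\<lambda>_. borel))"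
    proof -
      have "{f \<in> space (PiM UNIV (\<lambda>_. borel)). \<forall>t\<in>J. f t = (0::real)} \<in> sets (PiM UNIV (\<lambda>_. borel))"
        using J by (intro predE pred_intros_finite) measurable
      then show ?thesis by (simp add: space_PiM)
    qed
    have ind: "indep_vars (\<lambda>_. PiM UNIV (\<lambda>_. borel)) (\<lambda>i \<omega> t. ind_process (C i) t \<omega>) {..<n}"
      using iid by (simp add: iid_random_sets_def)
    let ?V = "\<lambda>i. (\<lambda>\<omega> t. ind_process (C i) t \<omega>) -` ?Z \<inter> space N"
    have s: "?V i = {\<omega> \<in> space N. \<forall>t\<in>J. t \<notin> C i \<omega>}" for i
      by (auto simp: ind_process_def indicator_eq_0_iff)
    have "miss_prob M S J = miss_prob N (\<lambda>\<omega>. \<Union>i<n. C i \<omega>) J"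
      using pred_mem_random_set[OF S] U eq J by (rule miss_prob_eq)
    also have "{\<omega> \<in> space N. \<forall>t\<in>J. t \<notin> (\<Union>i<n. C i \<omega>)}
      = (\<Inter>i\<in>{..<n}. ?V i)"
      unfolding s using n by (auto simp: Suc_le_eq)
    then have "miss_prob N (\<lambda>\<omega>. \<Union>i<n. C i \<omega>) J
      = prob (\<Inter>i\<in>{..<n}. ?V i)"
      by (simp add: miss_prob_def)
    also have "\<dots> = (\<Prod>i<n. prob (?V i))"
      using n Z by (intro indep_varsD[OF ind]) (auto simp: lessThan_empty_iff)
    also have "\<dots> = (\<Prod>i<n. miss_prob N (C 0) J)"
    proof (rule prod.cong)
      fix i assume i: "i \<in> {..<n}"
      have "miss_prob N (C i) J = miss_prob N (C 0) J"
        by (rule miss_prob_eq) (use C i n iid J in \<open>auto simp: iid_random_sets_def\<close>)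
      then show "prob (?V i) = miss_prob N (C 0) J"
        unfolding s by (simp add: miss_prob_def)
    qed simp
    also have "\<dots> = miss_prob N (C 0) J ^ n" by simp
    also have "miss_prob N (C 0) J = measure R (void J)"
      using emeasure_set_law_void[of N "C 0" J] C n J prob_space_axioms
      by (simp add: R_def measure_def miss_prob_def)
    finally show ?thesis by simp
  qed
  moreover have "prob_space R"
    unfolding R_def set_law_def using C n by (intro prob_space_distr set_law_measurable) auto
  ultimately show ?thesis
    by (intro exI[of _ R]) (auto simp: R_def set_law_def)
qed

text \<open>
  The derivative at \<open>0\<close> of \<open>h \<mapsto> exp (h * ln q)\<close>, evaluated along \<open>h = 1 / n\<close>.
\<close>
lemma tendsto_n_one_minus_root:
  fixes q :: real
  assumes "0 < q" and r: "\<And>n. n \<ge> 1 \<Longrightarrow> 0 \<le> r n \<and> r n ^ n = q"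
  shows "(\<lambda>n. real n * (1 - r n)) \<longlonglongrightarrow> - ln q"
proof -
  have r_eq: "r n = exp (ln q / real n)" if "n \<ge> 1" for n
  proof -
    have "r n > 0"
      using r[OF that] assms(1) that by (metis less_eq_real_def power_0_left not_one_le_zero less_irrefl)
    then have "real n * ln (r n) = ln q"
      using r[OF that] by (metis ln_realpow)
    then show ?thesis using \<open>r n > 0\<close> that
      by (metis exp_ln nonzero_mult_div_cancel_left of_nat_0_eq_iff not_one_le_zero)
  qed
  have "((\<lambda>h. (exp (ln q * h) - exp (ln q * 0)) / h) \<longlongrightarrow> ln q * exp (ln q * 0)) (at 0)"
  proof -
    have "((\<lambda>h. exp (ln q * h)) has_field_derivative ln q * exp (ln q * 0)) (at 0)"
      by (auto intro!: derivative_eq_intros)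
    then show ?thesis by (simp add: has_field_derivative_iff)
  qed
  moreover have "filterlim (\<lambda>n. 1 / real n) (at 0) sequentially"
    unfolding filterlim_at using lim_1_over_n
    by (auto intro!: eventually_sequentiallyI[of 1])
  ultimately have "((\<lambda>n. (exp (ln q * (1 / real n)) - exp (ln q * 0)) / (1 / real n)) \<longlongrightarrow> ln q * exp (ln q * 0)) sequentially"
    by (rule filterlim_compose)
  then have "(\<lambda>n. - ((exp (ln q / real n) - 1) * real n)) \<longlonglongrightarrow> - ln q"
    by (intro tendsto_minus) simp
  then show ?thesis
    by (rule Lim_transform_eventually)
       (auto intro!: eventually_sequentiallyI[of 1] simp: r_eq algebra_simps)
qed

text \<open>
  Under \<open>n\<close> times \<open>R n\<close>, the subsets that contain \<open>t\<close> and miss \<open>J\<close> have mass tending to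
  \<open>\<Psi> (insert t J) - \<Psi> J\<close>.  So \<open>R n\<close> conditioned on containing \<open>t\<close> has convergent void probabilities,
  and the limit law, scaled by the limit mass \<open>\<Psi> {t} - \<Psi> {}\<close>, is the measure sought.
\<close>
lemma conditioned_limit:
  fixes R :: "nat \<Rightarrow> ('t \<Rightarrow> bool) measure"
  assumes prob: "\<And>n. prob_space (R n)" and sets: "\<And>n. sets (R n) = sets cyl"
    and lim: "\<And>J. finite J \<Longrightarrow> (\<lambda>n. real n * (1 - measure (R n) (void J))) \<longlonglongrightarrow> \<Psi> J"
  shows "\<exists>K. sets K = sets cyl \<and>
    (\<forall>J. finite J \<longrightarrow> emeasure K (void J) = ennreal (\<Psi> (insert t J) - \<Psi> J))"
proof -
  have space: "space (R n) = UNIV" for n using sets_eq_imp_space_eq[OF sets[of n]] by simp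
  have v: "void J \<in> sets (R n)" if "finite J" for J n using that by (simp add: sets void_in_sets)
  define T where "T = {x :: 't \<Rightarrow> bool. x t}"
  have T: "T \<in> sets cyl" "T = UNIV - void {t}"
    unfolding T_def by (auto intro!: Collect_in_sets_cyl simp: void_def)
  have hit: "measure (R n) (T \<inter> void J) = measure (R n) (void J) - measure (R n) (void (insert t J))"
    if "finite J" for n J
  proof -
    interpret prob_space "R n" by (rule prob)
    have "T \<inter> void J = void J - void (insert t J)" by (auto simp: T_def void_def)
    moreover have "prob (void J - void (insert t J)) = prob (void J) - prob (void (insert t J))"
      using that by (intro finite_measure_Diff v) (auto simp: void_def)
    ultimately show ?thesis by simp
  qed
  have hit_lim: "(\<lambda>n. real n * measure (R n) (T \<inter> void J)) \<longlonglongrightarrow> \<Psi> (insert t J) - \<Psi> J"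
    if J: "finite J" for J
  proof -
    have "(\<lambda>n. real n * (1 - measure (R n) (void (insert t J))) - real n * (1 - measure (R n) (void J)))
      \<longlonglongrightarrow> \<Psi> (insert t J) - \<Psi> J"
      using J by (intro tendsto_diff lim) auto
    then show ?thesis by (simp add: hit[OF J] algebra_simps)
  qed
  have nonneg: "0 \<le> \<Psi> (insert t J) - \<Psi> J" if "finite J" for J
    by (rule LIMSEQ_le_const[OF hit_lim[OF that]]) auto
  have le: "\<Psi> (insert t J) - \<Psi> J \<le> \<Psi> {t} - \<Psi> {}" if "finite J" for J
  proof (rule LIMSEQ_le[OF hit_lim[OF that] hit_lim])
    show "\<exists>N. \<forall>n\<ge>N. real n * measure (R n) (T \<inter> void J) \<le> real n * measure (R n) (T \<inter> void {})"
    proof (intro exI allI impI mult_left_mono)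
      fix n
      interpret prob_space "R n" by (rule prob)
      show "measure (R n) (T \<inter> void J) \<le> measure (R n) (T \<inter> void {})"
        using T(1) by (intro finite_measure_mono) (auto simp: void_def sets)
    qed simp
  qed simp
  show ?thesis
  \<comment> \<open>Conditioning is impossible when the limit mass is zero, but then the limit measure is zero.\<close>
  proof (cases "\<Psi> {t} - \<Psi> {} = 0")
    case True
    then show ?thesis using le nonneg
      by (intro exI[of _ "null_measure cyl"]) (auto simp: order_antisym)
  next
    case False
    define c where "c = \<Psi> {t} - \<Psi> {}"
    have c: "c > 0" using False nonneg[of "{}"] by (simp add: c_def)
    have T_lim: "(\<lambda>n. real n * measure (R n) T) \<longlonglongrightarrow> c"
      using hit_lim[of "{}"] by (simp add: void_def c_def)
    from order_tendstoD(1)[OF this c] obtain n0 where n0: "\<And>n. n \<ge> n0 \<Longrightarrow> 0 < real n * measure (R n) T"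
      by (auto simp: eventually_sequentially)
    then have pos: "0 < measure (R n) T" if "n \<ge> n0" for n
      using that by (metis of_nat_0_le_iff zero_less_mult_pos order_le_less mult_zero_left)
    \<comment> \<open>The condition has positive probability from index \<open>n0\<close> on.\<close>
    define R' where "R' n = uniform_measure (R (n + n0)) T" for n
    have em: "emeasure (R (n + n0)) T \<noteq> 0" "emeasure (R (n + n0)) T \<noteq> \<infinity>" for n
      using pos[of "n + n0"] prob_space.finite_measure[OF prob[of "n + n0"]]
      by (auto simp: finite_measure.emeasure_eq_measure)
    have R': "measure (R' n) (void J)
      = (real (n + n0) * measure (R (n + n0)) (T \<inter> void J)) / (real (n + n0) * measure (R (n + n0)) T)"
      if "finite J" for n J
    proof -
      have "real (n + n0) \<noteq> 0" using n0[of "n + n0"] by (metis less_irrefl mult_zero_left le_add2)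
      then show ?thesis
        unfolding R'_def using em[of n] T(1) v[OF that]
        by (subst measure_uniform_measure) (auto simp: sets)
    qed
    have R'_lim: "(\<lambda>n. measure (R' n) (void J)) \<longlonglongrightarrow> (\<Psi> (insert t J) - \<Psi> J) / c" if "finite J" for J
      unfolding R'[OF that] using c
      by (intro tendsto_divide LIMSEQ_ignore_initial_segment T_lim hit_lim that) auto
    have "prob_space (R' n)" for n
      unfolding R'_def using em by (intro prob_space_uniform_measure) auto
    moreover have "sets (R' n) = sets cyl" for n by (simp add: R'_def sets)
    ultimately obtain K where K: "prob_space K" "sets K = sets cyl"
      "\<And>J. finite J \<Longrightarrow> (\<lambda>n. measure (R' n) (void J)) \<longlonglongrightarrow> measure K (void J)"
      using prob_space_limit_of_void[of R'] R'_lim by (auto simp: convergent_def) blast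
    have "measure K (void J) = (\<Psi> (insert t J) - \<Psi> J) / c" if "finite J" for J
      using LIMSEQ_unique[OF R'_lim[OF that] K(3)[OF that]] by simp
    then have "emeasure (scale_measure (ennreal c) K) (void J) = ennreal (\<Psi> (insert t J) - \<Psi> J)"
      if "finite J" for J
      using that c K(1)
      by (simp add: finite_measure.emeasure_eq_measure prob_space_def ennreal_mult'[symmetric])
    then show ?thesis using K(2) by (intro exI[of _ "scale_measure (ennreal c) K"]) auto
  qed
qed

text \<open>
  The data extracted from a stationary, stochastically continuous, union infinitely divisible set:
  \<open>\<Psi>\<close> is minus the logarithm of the void probability, and \<open>K t\<close> is to become the restriction of the
  Levy measure to the subsets that contain \<open>t\<close>.
\<close>
locale stationary_levy =
  fixes \<Psi> :: "'t::euclidean_space set \<Rightarrow> real" and K :: "'t \<Rightarrow> ('t \<Rightarrow> bool) measure"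
  assumes sets_K: "sets (K t) = sets cyl"
    and K_void: "finite J \<Longrightarrow> emeasure (K t) (void J) = ennreal (\<Psi> (insert t J) - \<Psi> J)"
    and mono: "finite J \<Longrightarrow> \<Psi> J \<le> \<Psi> (insert t J)"
    and empty: "\<Psi> {} = 0"
    and shift: "finite J \<Longrightarrow> \<Psi> ((\<lambda>s. s + u) ` J) = \<Psi> J"
    and cont: "((\<lambda>h. \<Psi> {0, h}) \<longlongrightarrow> \<Psi> {0}) (at 0)"

text \<open>
  Positivity of all void probabilities needs more than positivity at single points.  It holds because
  an \<open>n\<close>-th root of a void probability is at least \<open>1\<close> minus the sum over \<open>t \<in> J\<close> of the probabilities
  that a given one of the \<open>n\<close> pieces contains \<open>t\<close>, and this sum tends to \<open>0\<close>.
\<close>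
lemma stationary_levy_of_union_id:
  fixes S :: "'a \<Rightarrow> ('t :: euclidean_space) set"
  assumes S: "random_set M S" and stat: "stationary_set M S"
    and sc: "stochastically_continuous_set M S"
    and id: "union_id TYPE('b) M S"
    and lt1: "\<forall>t. measure M {\<omega> \<in> space M. t \<in> S \<omega>} < 1"
  shows "(\<forall>J. finite J \<longrightarrow> 0 < miss_prob M S J) \<and> (\<exists>K. stationary_levy (\<lambda>J. - ln (miss_prob M S J)) K)"
proof -
  interpret prob_space M using S by (simp add: random_set_def)
  have mem [measurable]: "Measurable.pred M (\<lambda>\<omega>. t \<in> S \<omega>)" for t by (rule pred_mem_random_set[OF S])
  have miss_sets: "{\<omega> \<in> space M. \<forall>t\<in>J. t \<notin> S \<omega>} \<in> sets M" if "finite J" for J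
    using that by measurable
  have "\<exists>R. \<forall>n\<ge>1. prob_space (R n) \<and> sets (R n) = sets cyl \<and>
    (\<forall>J. finite J \<longrightarrow> measure (R n) (void J) ^ n = miss_prob M S J)"
    using union_id_root[OF S id] by metis
  then obtain R0 :: "nat \<Rightarrow> ('t \<Rightarrow> bool) measure" where R0:
    "\<And>n. n \<ge> 1 \<Longrightarrow> prob_space (R0 n)" "\<And>n. n \<ge> 1 \<Longrightarrow> sets (R0 n) = sets cyl"
    "\<And>n J. n \<ge> 1 \<Longrightarrow> finite J \<Longrightarrow> measure (R0 n) (void J) ^ n = miss_prob M S J" by blast
  \<comment> \<open>The roots exist from index \<open>1\<close> on; the sequence needs a probability measure at index \<open>0\<close> as well.\<close>
  define R where "R n = (if n = 0 then R0 1 else R0 n)" for n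
  have prob_R: "prob_space (R n)" and sets_R: "sets (R n) = sets cyl" for n
    using R0(1,2)[of n] R0(1,2)[of 1] by (auto simp: R_def)
  have R: "measure (R n) (void J) ^ n = miss_prob M S J" if "n \<ge> 1" "finite J" for n J
    using R0(3)[OF that] that by (simp add: R_def)
  have pos1: "0 < miss_prob M S {t}" for t
  proof -
    have "miss_prob M S {t} = 1 - prob {\<omega> \<in> space M. t \<in> S \<omega>}"
      using prob_neg[of "\<lambda>\<omega>. t \<in> S \<omega>"] by (simp add: miss_prob_def)
    with lt1 show ?thesis by simp
  qed
  have pos: "0 < miss_prob M S J" if J: "finite J" for J
  proof -
    have "(\<lambda>n. 1 - measure (R n) (void {t})) \<longlonglongrightarrow> 0" for t
    proof -
      have "(\<lambda>n. real n * (1 - measure (R n) (void {t})) * (1 / real n)) \<longlonglongrightarrow> - ln (miss_prob M S {t}) * 0"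
        using R by (intro tendsto_mult tendsto_n_one_minus_root pos1 lim_1_over_n) auto
      then show ?thesis
        unfolding mult_zero_right
        by (rule Lim_transform_eventually) (rule eventually_sequentiallyI[of 1], simp)
    qed
    then have "(\<lambda>n. \<Sum>t\<in>J. 1 - measure (R n) (void {t})) \<longlonglongrightarrow> (\<Sum>t\<in>J. 0)"
      by (intro tendsto_sum) auto
    then have "\<forall>\<^sub>F n in sequentially. (\<Sum>t\<in>J. 1 - measure (R n) (void {t})) < 1"
      by (rule order_tendstoD) simp
    then obtain n0 where n0: "\<And>n. n \<ge> n0 \<Longrightarrow> (\<Sum>t\<in>J. 1 - measure (R n) (void {t})) < 1"
      by (auto simp: eventually_sequentially)
    define n where "n = Suc n0"
    interpret Rn: prob_space "R n" by (rule prob_R)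
    have sp: "space (R n) = UNIV" using sets_eq_imp_space_eq[OF sets_R[of n]] by simp
    have v: "void L \<in> sets (R n)" if "finite L" for L using that by (simp add: sets_R void_in_sets)
    have "1 - measure (R n) (void J) = measure (R n) (space (R n) - void J)"
      using v[OF J] by (simp add: Rn.prob_compl)
    also have "space (R n) - void J = (\<Union>t\<in>J. space (R n) - void {t})"
      by (auto simp: void_def sp)
    also have "measure (R n) \<dots> \<le> (\<Sum>t\<in>J. measure (R n) (space (R n) - void {t}))"
      using v J by (intro Rn.finite_measure_subadditive_finite) auto
    also have "\<dots> = (\<Sum>t\<in>J. 1 - measure (R n) (void {t}))"
      using v by (simp add: Rn.prob_compl)
    also have "\<dots> < 1" by (rule n0) (simp add: n_def)
    finally have "0 < measure (R n) (void J)" by simp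
    then have "0 < measure (R n) (void J) ^ n" by simp
    then show ?thesis using R[of n J] J by (simp add: n_def)
  qed
  define \<Psi> where "\<Psi> J = - ln (miss_prob M S J)" for J
  have "(\<lambda>n. real n * (1 - measure (R n) (void J))) \<longlonglongrightarrow> \<Psi> J" if "finite J" for J
    unfolding \<Psi>_def by (intro tendsto_n_one_minus_root pos that conjI measure_nonneg R)
  then have "\<forall>t. \<exists>K. sets K = sets cyl \<and>
    (\<forall>J. finite J \<longrightarrow> emeasure K (void J) = ennreal (\<Psi> (insert t J) - \<Psi> J))"
    by (intro allI conditioned_limit[of R, OF prob_R sets_R])
  then obtain K where K: "\<And>t. sets (K t) = sets cyl"
    "\<And>t J. finite J \<Longrightarrow> emeasure (K t) (void J) = ennreal (\<Psi> (insert t J) - \<Psi> J)"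
    by metis
  have "stationary_levy \<Psi> K"
  proof
    show "\<Psi> J \<le> \<Psi> (insert t J)" if "finite J" for J t
    proof -
      have "miss_prob M S (insert t J) \<le> miss_prob M S J"
        unfolding miss_prob_def using that by (intro finite_measure_mono miss_sets) auto
      then show ?thesis using pos[of "insert t J"] that by (simp add: \<Psi>_def)
    qed
    show "\<Psi> {} = 0" by (simp add: \<Psi>_def miss_prob_def prob_space)
    show "\<Psi> ((\<lambda>s. s + u) ` J) = \<Psi> J" if "finite J" for u J
      using miss_prob_shift[OF S stat that] by (simp add: \<Psi>_def)
    have "miss_prob M S {0} - miss_prob M S {0, h} = prob {\<omega> \<in> space M. 0 \<notin> S \<omega> \<and> h \<in> S \<omega>}" for h
    proof -
      have "{\<omega> \<in> space M. 0 \<notin> S \<omega> \<and> h \<in> S \<omega>}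
        = {\<omega> \<in> space M. \<forall>t\<in>{0}. t \<notin> S \<omega>} - {\<omega> \<in> space M. \<forall>t\<in>{0, h}. t \<notin> S \<omega>}" by auto
      also have "prob \<dots> = miss_prob M S {0} - miss_prob M S {0, h}"
        unfolding miss_prob_def by (intro finite_measure_Diff miss_sets) auto
      finally show ?thesis by simp
    qed
    moreover have "((\<lambda>h. prob {\<omega> \<in> space M. 0 \<notin> S \<omega> \<and> h \<in> S \<omega>}) \<longlongrightarrow> 0) (at 0)"
      using sc unfolding stochastically_continuous_set_def by blast
    ultimately have "((\<lambda>h. miss_prob M S {0} - (miss_prob M S {0} - miss_prob M S {0, h}))
      \<longlongrightarrow> miss_prob M S {0} - 0) (at 0)"
      by (intro tendsto_diff tendsto_const) simp
    then show "((\<lambda>h. \<Psi> {0, h}) \<longlongrightarrow> \<Psi> {0}) (at 0)"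
      unfolding \<Psi>_def using pos[of "{0}"] by (intro tendsto_minus tendsto_ln) auto
  qed (use K in auto)
  then show ?thesis using pos unfolding \<Psi>_def by blast
qed

section \<open>The translation invariant Levy measure\<close>

definition dense_seq :: "nat \<Rightarrow> 'a::second_countable_topology"
  where "dense_seq = (SOME q. \<forall>X. open X \<longrightarrow> X \<noteq> {} \<longrightarrow> (\<exists>j. q j \<in> X))"

lemma dense_seq:
  fixes X :: "'a::second_countable_topology set"
  assumes "open X" "X \<noteq> {}"
  shows "\<exists>j. dense_seq j \<in> X"
proof -
  obtain D :: "'a set" where D: "countable D" "\<And>X. open X \<Longrightarrow> X \<noteq> {} \<Longrightarrow> \<exists>d\<in>D. d \<in> X"
    using countable_dense_setE by blast
  have "D \<noteq> {}" using D(2)[of UNIV] by auto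
  then have "\<forall>X. open X \<longrightarrow> X \<noteq> {} \<longrightarrow> (\<exists>j. from_nat_into D j \<in> X)"
    using D by (metis from_nat_into_surj)
  then have "\<forall>X :: 'a set. open X \<longrightarrow> X \<noteq> {} \<longrightarrow> (\<exists>j. dense_seq j \<in> X)"
    unfolding dense_seq_def
    by (rule someI[where P = "\<lambda>q :: nat \<Rightarrow> 'a. \<forall>X. open X \<longrightarrow> X \<noteq> {} \<longrightarrow> (\<exists>j. q j \<in> X)"])
  with assms show ?thesis by blast
qed

lemma dense_seq_dist:
  fixes t :: "'a::{metric_space, second_countable_topology}"
  assumes "e > 0"
  shows "\<exists>j. dist (dense_seq j) t < e"
  using dense_seq[of "ball t e"] assms by (auto simp: dist_commute)

text \<open>
  The subset coded by \<open>x\<close>, translated by \<open>- u\<close>.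
\<close>
definition shift_cfg :: "'t::plus \<Rightarrow> ('t \<Rightarrow> bool) \<Rightarrow> 't \<Rightarrow> bool"
  where "shift_cfg u x = (\<lambda>s. x (s + u))"

lemma shift_cfg_measurable [measurable]: "shift_cfg u \<in> cyl \<rightarrow>\<^sub>M cyl"
  unfolding shift_cfg_def by (rule measurable_PiM_single') auto

lemma vimage_shift_cfg_void: "shift_cfg u -` void J = void ((\<lambda>s. s + u) ` J)"
  by (auto simp: shift_cfg_def void_def)

context stationary_levy
begin

abbreviation q :: "nat \<Rightarrow> 't" where "q \<equiv> dense_seq"

lemmas [measurable_cong] = sets_K

lemma space_K [simp]: "space (K t) = UNIV"
  using sets_eq_imp_space_eq[OF sets_K[of t]] by simp

lemma finite_measure_K: "finite_measure (K t)"
  using K_void[of "{}" t] by (intro finite_measureI) (simp add: void_def)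

lemma measure_K_void: "finite J \<Longrightarrow> measure (K t) (void J) = \<Psi> (insert t J) - \<Psi> J"
  using K_void[of J t] mono[of J t] by (simp add: measure_def)

text \<open>
  Both sides are finite measures in \<open>B\<close>, and at \<open>B = void J\<close> both equal
  \<open>\<Psi> (insert s J) + \<Psi> (insert t J) - \<Psi> J - \<Psi> (insert s (insert t J))\<close>, which is symmetric in \<open>s\<close>
  and \<open>t\<close>.
\<close>
lemma K_swap:
  assumes B: "B \<in> sets cyl"
  shows "emeasure (K s) (B \<inter> {x. x t}) = emeasure (K t) (B \<inter> {x. x s})"
proof -
  have hit: "{x. x t} \<in> sets (K s)" for s t :: 't
    unfolding sets_K by (rule Collect_in_sets_cyl) simp
  define D where "D s t = density (K s) (indicator {x. x t})" for s t
  have D: "emeasure (D s t) A = emeasure (K s) (A \<inter> {x. x t})" if "A \<in> sets cyl" for A s t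
    using that hit[of t s] unfolding D_def by (subst emeasure_restricted) (auto simp: sets_K Int_commute)
  have fin: "emeasure (K s) A \<noteq> \<infinity>" for s A
    using finite_measure_K[of s] by (simp add: finite_measure.emeasure_finite)
  have "D s t = D t s"
  proof (rule measure_eqI_void)
    show "sets (D s t) = sets cyl" "sets (D t s) = sets cyl" by (simp_all add: D_def sets_K)
    show "emeasure (D s t) UNIV \<noteq> \<infinity>" using fin by (subst D) (auto intro: sets.top[of cyl, simplified])
    fix J :: "'t set" assume J: "finite J"
    have *: "emeasure (D s t) (void J) = ennreal (\<Psi> (insert s J) - \<Psi> J - (\<Psi> (insert s (insert t J)) - \<Psi> (insert t J)))"
      for s t
    proof -
      interpret finite_measure "K s" by (rule finite_measure_K)
      have "void J \<inter> {x. x t} = void J - void (insert t J)" by (auto simp: void_def)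
      moreover have "measure (K s) (void J - void (insert t J)) = measure (K s) (void J) - measure (K s) (void (insert t J))"
        using J by (intro finite_measure_Diff) (simp_all add: sets_K void_in_sets, auto simp: void_def)
      ultimately show ?thesis
        using J by (simp add: D void_in_sets emeasure_eq_measure measure_K_void)
    qed
    show "emeasure (D s t) (void J) = emeasure (D t s) (void J)"
      unfolding * by (simp add: insert_commute algebra_simps)
  qed
  then show ?thesis using D[OF B, of s t] D[OF B, of t s] by simp
qed

lemma K_shift:
  assumes B: "B \<in> sets cyl"
  shows "emeasure (K (t + u)) (shift_cfg u -` B) = emeasure (K t) B"
proof -
  let ?D = "distr (K (t + u)) cyl (shift_cfg u)"
  have m: "shift_cfg u \<in> K (t + u) \<rightarrow>\<^sub>M cyl" by measurable
  have "?D = K t"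
  proof (rule measure_eqI_void)
    show "emeasure (?D) UNIV \<noteq> \<infinity>"
      using finite_measure.emeasure_finite[OF finite_measure_K[of "t + u"]] m
      by (subst emeasure_distr) (auto intro: sets.top[of cyl, simplified])
    fix J :: "'t set" assume J: "finite J"
    have "emeasure (?D) (void J) = emeasure (K (t + u)) (void ((\<lambda>s. s + u) ` J))"
      using J m by (subst emeasure_distr) (auto simp: vimage_shift_cfg_void void_in_sets)
    also have "\<dots> = ennreal (\<Psi> ((\<lambda>s. s + u) ` insert t J) - \<Psi> ((\<lambda>s. s + u) ` J))"
      using J by (simp add: K_void)
    also have "\<dots> = emeasure (K t) (void J)"
      using J shift[of J u] shift[of "insert t J" u] by (simp add: K_void del: image_insert)
    finally show "emeasure (?D) (void J) = emeasure (K t) (void J)" .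
  qed (auto simp: sets_K)
  then show ?thesis using B m by (metis emeasure_distr inf_top.right_neutral space_K)
qed

text \<open>
  Half the Levy measure of the subsets that distinguish two points at displacement \<open>h\<close>, see
  \<open>emeasure_levy_jump\<close>; it tends to \<open>0\<close> by stochastic continuity.
\<close>
definition jump :: "'t \<Rightarrow> real" where "jump h = \<Psi> {0, h} - \<Psi> {0}"

lemma Psi_pair: "\<Psi> {s, t} = \<Psi> {0, t - s}"
  using shift[of "{0, t - s}" s] by simp

lemma Psi_singleton: "\<Psi> {t} = \<Psi> {0}"
  using shift[of "{0}" t] by simp

lemma jump_minus: "jump (- h) = jump h"
proof -
  have "{h, 0} = {0, h}" by auto
  with Psi_pair[of h 0] show ?thesis by (simp add: jump_def)
qed

lemma jump_nonneg: "0 \<le> jump h"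
  unfolding jump_def using mono[of "{0}" h] by (simp add: insert_commute)

lemma jump_tendsto_0: "(jump \<longlongrightarrow> 0) (at 0)"
  using tendsto_diff[OF cont tendsto_const, of "\<Psi> {0}"] by (simp add: jump_def[abs_def])

lemma K_miss_one: "emeasure (K s) {x. \<not> x t} = ennreal (jump (t - s))"
  using K_void[of "{t}" s] Psi_pair[of s t] Psi_singleton[of t] by (simp add: void_def jump_def)

lemma jump_small:
  assumes "e > 0"
  shows "\<exists>d>0. \<forall>h. norm h \<le> d \<longrightarrow> jump h \<le> e"
proof -
  from order_tendstoD(2)[OF jump_tendsto_0 assms]
  obtain d where d: "d > 0" "\<And>h. h \<noteq> 0 \<Longrightarrow> dist h 0 < d \<Longrightarrow> jump h < e"
    unfolding eventually_at by auto
  moreover have "jump 0 = 0" by (simp add: jump_def)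
  ultimately have "jump h \<le> e" if "norm h \<le> d / 2" for h
    using that assms by (cases "h = 0") (auto simp: less_imp_le)
  then show ?thesis using d(1) by (intro exI[of _ "d / 2"]) auto
qed

text \<open>
  A subset that contains \<open>t\<close> but no point of a dense set contains \<open>t\<close> and misses points arbitrarily
  close to \<open>t\<close>, which has arbitrarily small mass.
\<close>
lemma K_miss_dense: "emeasure (K t) {x. \<forall>j. \<not> x (q j + u)} = 0"
proof (rule ccontr)
  let ?m = "emeasure (K t) {x. \<forall>j. \<not> x (q j + u)}"
  assume "?m \<noteq> 0"
  define e where "e = measure (K t) {x. \<forall>j. \<not> x (q j + u)}"
  have "?m = ennreal e"
    unfolding e_def by (rule finite_measure.emeasure_eq_measure[OF finite_measure_K])
  moreover from this have "e \<noteq> 0" using \<open>?m \<noteq> 0\<close> by auto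
  moreover have "0 \<le> e" by (simp add: e_def)
  ultimately have e: "?m = ennreal e" "e > 0" by auto
  obtain d where d: "d > 0" "\<And>h. norm h \<le> d \<Longrightarrow> jump h \<le> e / 2"
    using jump_small[of "e / 2"] e by auto
  obtain j where j: "dist (q j) (t - u) < d" using dense_seq_dist[OF d(1)] by blast
  have "?m \<le> emeasure (K t) {x. \<not> x (q j + u)}"
    by (rule emeasure_mono) (auto simp: sets_K intro!: Collect_in_sets_cyl)
  also have "\<dots> = ennreal (jump (q j + u - t))" by (rule K_miss_one)
  also have "\<dots> \<le> ennreal (e / 2)"
    using j by (intro ennreal_leI d) (simp add: dist_norm algebra_simps)
  finally show False using e by (simp add: ennreal_le_iff)
qed

text \<open>
  The subsets are classified by the first point of the dense sequence that they contain.
\<close>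
definition first_hit :: "nat \<Rightarrow> ('t \<Rightarrow> bool) set"
  where "first_hit j = {x. x (q j) \<and> (\<forall>i<j. \<not> x (q i))}"

lemma first_hit_in_sets [measurable]: "first_hit j \<in> sets cyl"
  unfolding first_hit_def by (rule Collect_in_sets_cyl) measurable

lemma disjoint_first_hit: "disjoint_family first_hit"
proof -
  have "first_hit i \<inter> first_hit j = {}" if "i < j" for i j
    using that by (auto simp: first_hit_def)
  then have "first_hit i \<inter> first_hit j = {}" if "i \<noteq> j" for i j
    using that by (cases i j rule: linorder_cases) (auto simp: Int_commute)
  then show ?thesis by (simp add: disjoint_family_on_def)
qed

lemma UN_first_hit: "(\<Union>j. first_hit j) = UNIV - {x. \<forall>j. \<not> x (q j)}"
proof -
  have 1: "\<exists>j. x \<in> first_hit j" if "x (q j)" for x j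
  proof -
    define n where "n = (LEAST j. x (q j))"
    have "x (q n)" unfolding n_def by (rule LeastI[of "\<lambda>j. x (q j)", OF that])
    moreover have "\<not> x (q i)" if "i < n" for i using not_less_Least[of i "\<lambda>j. x (q j)"] that by (simp add: n_def)
    ultimately show ?thesis by (auto simp: first_hit_def)
  qed
  have 2: "x (q j)" if "x \<in> first_hit j" for x j using that by (simp add: first_hit_def)
  show ?thesis
  proof (intro set_eqI iffI)
    fix x assume "x \<in> (\<Union>j. first_hit j)"
    then obtain j where "x \<in> first_hit j" by auto
    from 2[OF this] show "x \<in> UNIV - {x. \<forall>j. \<not> x (q j)}" by auto
  next
    fix x assume "x \<in> UNIV - {x. \<forall>j. \<not> x (q j)}"
    then obtain j where "x (q j)" by auto
    from 1[of x j, OF this] show "x \<in> (\<Union>j. first_hit j)" by auto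
  qed
qed

lemma miss_all_in_sets: "{x. \<forall>j :: nat. \<not> x (f j)} \<in> sets cyl"
  by (rule Collect_in_sets_cyl) measurable

lemma emeasure_eq_suminf_first_hit:
  assumes M: "sets M = sets cyl" and miss: "emeasure M {x. \<forall>j. \<not> x (q j)} = 0" and B: "B \<in> sets cyl"
  shows "emeasure M B = (\<Sum>j. emeasure M (B \<inter> first_hit j))"
proof -
  have "(\<Sum>j. emeasure M (B \<inter> first_hit j)) = emeasure M (\<Union>j. B \<inter> first_hit j)"
    using disjoint_first_hit B M
    by (intro suminf_emeasure) (auto simp: disjoint_family_on_def)
  also have "(\<Union>j. B \<inter> first_hit j) = B - {x. \<forall>j. \<not> x (q j)}"
    using UN_first_hit by blast
  also have "emeasure M (B - {x. \<forall>j. \<not> x (q j)}) = emeasure M B"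
    using B miss miss_all_in_sets M by (intro emeasure_Diff_null_set) (auto simp: null_sets_def)
  finally show ?thesis by simp
qed

text \<open>
  On \<open>first_hit j\<close>, whose members contain \<open>q j\<close>, the measure \<open>K (q j)\<close> is used.
\<close>
definition levy :: "('t \<Rightarrow> bool) measure"
  where "levy = measure_of UNIV (sets cyl) (\<lambda>B. \<Sum>j. emeasure (K (q j)) (B \<inter> first_hit j))"

lemma sets_levy [simp, measurable_cong]: "sets levy = sets cyl"
  unfolding levy_def using sets.sigma_sets_eq[of "cyl :: ('t \<Rightarrow> bool) measure"] by simp

lemma space_levy [simp]: "space levy = UNIV"
  unfolding levy_def by simp

lemma emeasure_levy:
  assumes "B \<in> sets cyl"
  shows "emeasure levy B = (\<Sum>j. emeasure (K (q j)) (B \<inter> first_hit j))"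
  unfolding levy_def
proof (rule emeasure_measure_of_sigma)
  let ?f = "\<lambda>B. \<Sum>j. emeasure (K (q j)) (B \<inter> first_hit j)"
  show "sigma_algebra UNIV (sets (cyl :: ('t \<Rightarrow> bool) measure))"
    using sets.sigma_algebra_axioms[of "cyl :: ('t \<Rightarrow> bool) measure"] by simp
  show "positive (sets cyl) ?f" by (simp add: positive_def)
  show "countably_additive (sets cyl) ?f"
  proof (rule countably_additiveI)
    fix A :: "nat \<Rightarrow> ('t \<Rightarrow> bool) set"
    assume A: "range A \<subseteq> sets cyl" "disjoint_family A"
    have "(\<Sum>i. ?f (A i)) = (\<Sum>i. \<integral>\<^sup>+ j. emeasure (K (q j)) (A i \<inter> first_hit j) \<partial>count_space UNIV)"
      by (simp add: nn_integral_count_space_nat)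
    also have "\<dots> = (\<integral>\<^sup>+ j. (\<Sum>i. emeasure (K (q j)) (A i \<inter> first_hit j)) \<partial>count_space UNIV)"
      by (rule nn_integral_suminf[symmetric]) simp
    also have "\<dots> = (\<integral>\<^sup>+ j. emeasure (K (q j)) ((\<Union>i. A i) \<inter> first_hit j) \<partial>count_space UNIV)"
    proof (rule nn_integral_cong)
      fix j
      have "(\<Sum>i. emeasure (K (q j)) (A i \<inter> first_hit j)) = emeasure (K (q j)) (\<Union>i. A i \<inter> first_hit j)"
        using A by (intro suminf_emeasure) (auto simp: sets_K disjoint_family_on_def)
      then show "(\<Sum>i. emeasure (K (q j)) (A i \<inter> first_hit j)) = emeasure (K (q j)) ((\<Union>i. A i) \<inter> first_hit j)"
        by (simp add: UN_extend_simps del: UN_simps)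
    qed
    also have "\<dots> = ?f (\<Union>i. A i)" by (simp add: nn_integral_count_space_nat)
    finally show "(\<Sum>i. ?f (A i)) = ?f (\<Union>i. A i)" .
  qed
qed (use assms in auto)

text \<open>
  \<open>K_swap\<close> exchanges \<open>K (q j)\<close> for \<open>K t\<close> on the subsets that contain both points, so the pieces add up
  to \<open>K t\<close>: no mass of \<open>K t\<close> is lost on subsets without points of the dense sequence.
\<close>
lemma emeasure_levy_hit:
  assumes B: "B \<in> sets cyl"
  shows "emeasure levy (B \<inter> {x. x t}) = emeasure (K t) B"
proof -
  have hit: "{x. x t} \<in> sets cyl" for t :: 't by (rule Collect_in_sets_cyl) simp
  have F: "{x. \<forall>i<j. \<not> x (q i)} \<in> sets cyl" for j
    by (rule Collect_in_sets_cyl) measurable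
  have "emeasure levy (B \<inter> {x. x t}) = (\<Sum>j. emeasure (K (q j)) (B \<inter> {x. x t} \<inter> first_hit j))"
    using B hit by (intro emeasure_levy sets.Int)
  also have "\<dots> = (\<Sum>j. emeasure (K t) (B \<inter> first_hit j))"
  proof (rule suminf_cong)
    fix j
    have "B \<inter> {x. x t} \<inter> first_hit j = (B \<inter> first_hit j) \<inter> {x. x t}" by auto
    also have "emeasure (K (q j)) \<dots> = emeasure (K t) ((B \<inter> first_hit j) \<inter> {x. x (q j)})"
      using B by (intro K_swap) auto
    also have "(B \<inter> first_hit j) \<inter> {x. x (q j)} = B \<inter> first_hit j"
      by (auto simp: first_hit_def)
    finally show "emeasure (K (q j)) (B \<inter> {x. x t} \<inter> first_hit j) = emeasure (K t) (B \<inter> first_hit j)" .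
  qed
  also have "\<dots> = emeasure (K t) B"
    using K_miss_dense[of t 0] B by (intro emeasure_eq_suminf_first_hit[symmetric]) (auto simp: sets_K)
  finally show ?thesis .
qed

lemma emeasure_levy_miss: "emeasure levy {x. \<forall>j. \<not> x (q j + u)} = 0"
proof -
  have "emeasure (K (q i)) ({x. \<forall>j. \<not> x (q j + u)} \<inter> first_hit i) = 0" for i
    by (rule emeasure_eq_0[OF _ K_miss_dense[of "q i" u]])
       (simp_all add: sets_K miss_all_in_sets[of "\<lambda>j. q j + u"])
  then show ?thesis
    by (subst emeasure_levy[OF miss_all_in_sets[of "\<lambda>j. q j + u"]]) simp
qed

text \<open>
  On subsets that contain a fixed point the two measures are \<open>K (t + u)\<close>, translated, and \<open>K t\<close>, and both
  vanish on the subsets that contain no point of the dense sequence.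
\<close>
lemma levy_shift: "distr levy cyl (shift_cfg u) = levy"
proof (rule measure_eqI)
  let ?L = "distr levy cyl (shift_cfg u)"
  show "sets ?L = sets levy" by simp
  have m: "shift_cfg u \<in> levy \<rightarrow>\<^sub>M cyl" by measurable
  have L: "emeasure ?L A = emeasure levy (shift_cfg u -` A)" if "A \<in> sets cyl" for A
    using emeasure_distr[OF m that] by simp
  fix B assume "B \<in> sets ?L"
  then have B: "B \<in> sets cyl" by simp
  \<comment> \<open>A translate of the dense sequence is dense as well.\<close>
  have miss: "emeasure ?L {x. \<forall>j. \<not> x (q j)} = 0"
  proof -
    have "shift_cfg u -` {x. \<forall>j. \<not> x (q j)} = {x. \<forall>j. \<not> x (q j + u)}" by (auto simp: shift_cfg_def)
    then show ?thesis
      using emeasure_levy_miss[of u] L[OF miss_all_in_sets[of q]] by simp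
  qed
  have hit: "emeasure ?L (A \<inter> {x. x t}) = emeasure levy (A \<inter> {x. x t})" if A: "A \<in> sets cyl" for A t
  proof -
    have "{x. x t} \<in> sets cyl" by (rule Collect_in_sets_cyl) simp
    then have "emeasure ?L (A \<inter> {x. x t}) = emeasure levy (shift_cfg u -` A \<inter> {x. x (t + u)})"
      using A by (subst L) (auto simp: shift_cfg_def vimage_def Int_def)
    also have "\<dots> = emeasure (K (t + u)) (shift_cfg u -` A)"
      using measurable_sets[OF shift_cfg_measurable A, of u] by (intro emeasure_levy_hit) simp
    also have "\<dots> = emeasure (K t) A" by (rule K_shift[OF A])
    also have "\<dots> = emeasure levy (A \<inter> {x. x t})" by (rule emeasure_levy_hit[OF A, symmetric])
    finally show ?thesis .
  qed
  have "emeasure ?L B = (\<Sum>j. emeasure ?L (B \<inter> first_hit j))"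
    using miss B by (intro emeasure_eq_suminf_first_hit) auto
  also have "\<dots> = (\<Sum>j. emeasure levy (B \<inter> first_hit j))"
  proof (rule suminf_cong)
    fix j
    have "B \<inter> first_hit j = B \<inter> first_hit j \<inter> {x. x (q j)}" by (auto simp: first_hit_def)
    then show "emeasure ?L (B \<inter> first_hit j) = emeasure levy (B \<inter> first_hit j)"
      using hit[of "B \<inter> first_hit j" "q j"] B by simp
  qed
  also have "\<dots> = emeasure levy B"
    using emeasure_levy_miss[of 0] B by (intro emeasure_eq_suminf_first_hit[symmetric]) auto
  finally show "emeasure ?L B = emeasure levy B" .
qed

lemma Psi_nonneg: "finite J \<Longrightarrow> 0 \<le> \<Psi> J"
proof (induction J rule: finite_induct)
  case (insert t J)
  then show ?case using mono[of J t] by simp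
qed (simp add: empty)

text \<open>
  Induction on \<open>J\<close>: the subsets that meet \<open>insert t J\<close> but not \<open>J\<close> have mass \<open>K t (void J)\<close>.
\<close>
lemma emeasure_levy_hits:
  assumes "finite J"
  shows "emeasure levy {x. \<exists>t\<in>J. x t} = ennreal (\<Psi> J)"
  using assms
proof (induction J rule: finite_induct)
  case empty
  then show ?case by (simp add: stationary_levy.empty[OF stationary_levy_axioms])
next
  case (insert t J)
  have h: "{x. \<exists>t\<in>J. x t} \<in> sets cyl" "{x. x t} \<in> sets cyl"
    using insert by (auto intro!: Collect_in_sets_cyl)
  have "{x. \<exists>t\<in>insert t J. x t} = {x. \<exists>t\<in>J. x t} \<union> (void J \<inter> {x. x t})"
    by (auto simp: void_def)
  also have "emeasure levy \<dots> = emeasure levy {x. \<exists>t\<in>J. x t} + emeasure levy (void J \<inter> {x. x t})"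
    using h insert.hyps by (intro plus_emeasure[symmetric]) (auto simp: void_in_sets void_def)
  also have "\<dots> = ennreal (\<Psi> J) + ennreal (\<Psi> (insert t J) - \<Psi> J)"
    using insert by (simp add: emeasure_levy_hit void_in_sets K_void)
  also have "\<dots> = ennreal (\<Psi> (insert t J))"
    using insert.hyps mono[of J t] Psi_nonneg[of J] by (simp add: ennreal_plus[symmetric] del: ennreal_plus)
  finally show ?case .
qed

lemma emeasure_levy_single: "emeasure levy {x. x t} = ennreal (\<Psi> {0})"
  using emeasure_levy_hits[of "{t}"] Psi_singleton[of t] by simp

lemma sigma_finite_levy: "sigma_finite_measure levy"
proof
  let ?A = "insert {x. \<forall>j. \<not> x (q j)} (range (\<lambda>j. {x. x (q j)}))"
  have "?A \<subseteq> sets levy"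
    by (auto simp: miss_all_in_sets intro!: Collect_in_sets_cyl)
  moreover have "\<forall>a\<in>?A. emeasure levy a \<noteq> \<infinity>"
    using emeasure_levy_miss[of 0] by (auto simp: emeasure_levy_single)
  moreover have "\<Union>?A = space levy" by auto
  ultimately show "\<exists>A. countable A \<and> A \<subseteq> sets levy \<and> \<Union>A = space levy \<and> (\<forall>a\<in>A. emeasure levy a \<noteq> \<infinity>)"
    by (intro exI[of _ ?A]) auto
qed

lemma emeasure_levy_jump: "emeasure levy {x. x s \<noteq> x t} = ennreal (2 * jump (t - s))"
proof -
  have h: "{x. \<not> x t} \<in> sets cyl" "{x. x t} \<in> sets cyl" for t :: 't
    by (auto intro!: Collect_in_sets_cyl)
  have "{x. x s \<noteq> x t} = ({x. \<not> x t} \<inter> {x. x s}) \<union> ({x. \<not> x s} \<inter> {x. x t})" by auto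
  also have "emeasure levy \<dots> = emeasure levy ({x. \<not> x t} \<inter> {x. x s}) + emeasure levy ({x. \<not> x s} \<inter> {x. x t})"
    using h by (intro plus_emeasure[symmetric]) auto
  also have "\<dots> = ennreal (jump (t - s)) + ennreal (jump (s - t))"
    by (simp add: emeasure_levy_hit h K_miss_one)
  also have "jump (s - t) = jump (t - s)" using jump_minus[of "t - s"] by simp
  finally show ?thesis using jump_nonneg by (simp add: ennreal_plus[symmetric] del: ennreal_plus)
qed

end

section \<open>A translation flow on real sequences\<close>

text \<open>
  A real sequence is read as a double array: row \<open>k\<close> holds the values of the \<open>k\<close>-th function at the
  points of the sequence \<open>q\<close>.
\<close>
definition entry :: "real_seq \<Rightarrow> nat \<Rightarrow> nat \<Rightarrow> real"
  where "entry w k j = w (prod_encode (k, j))"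

definition lip_seqs :: "(nat \<Rightarrow> 't::metric_space) \<Rightarrow> real_seq set"
  where "lip_seqs q = {w. \<forall>k i j. \<bar>entry w k i - entry w k j\<bar> \<le> dist (q i) (q j)}"

text \<open>
  McShane's formula for extending a 1-Lipschitz function from the range of \<open>q\<close> to the whole space.
\<close>
definition lip_ext :: "(nat \<Rightarrow> 't::metric_space) \<Rightarrow> real_seq \<Rightarrow> nat \<Rightarrow> 't \<Rightarrow> real"
  where "lip_ext q w k t = (INF j. entry w k j + dist t (q j))"

definition sample :: "(nat \<Rightarrow> 't) \<Rightarrow> (nat \<Rightarrow> 't \<Rightarrow> real) \<Rightarrow> real_seq"
  where "sample q f = (\<lambda>n. case prod_decode n of (k, j) \<Rightarrow> f k (q j))"

text \<open>
  Translation of all functions of the array at once.  Sequences that do not come from 1-Lipschitz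
  functions are fixed points, which makes the flow defined everywhere.
\<close>
definition flow :: "(nat \<Rightarrow> 't::euclidean_space) \<Rightarrow> 't \<Rightarrow> real_seq \<Rightarrow> real_seq"
  where "flow q t w = (if w \<in> lip_seqs q then sample q (\<lambda>k s. lip_ext q w k (s + t)) else w)"

definition nonexpansive :: "('t::metric_space \<Rightarrow> real) \<Rightarrow> bool"
  where "nonexpansive f \<longleftrightarrow> (\<forall>s t. \<bar>f s - f t\<bar> \<le> dist s t)"

lemma entry_sample [simp]: "entry (sample q f) k j = f k (q j)"
  by (simp add: entry_def sample_def)

lemma real_seq_eqI: "(\<And>k j. entry v k j = entry w k j) \<Longrightarrow> v = w"
  unfolding entry_def by (metis ext surj_pair prod_decode_inverse)

lemma sample_in_lip_seqs: "(\<And>k. nonexpansive (f k)) \<Longrightarrow> sample q f \<in> lip_seqs q"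
  by (simp add: lip_seqs_def nonexpansive_def)

lemma entry_measurable [measurable]: "(\<lambda>w. entry w k j) \<in> borel_measurable borel"
  unfolding entry_def by measurable

lemma sample_measurable:
  assumes "\<And>k j. (\<lambda>x. f x k (q j)) \<in> borel_measurable M"
  shows "(\<lambda>x. sample q (f x)) \<in> borel_measurable M"
  unfolding sample_def
  by (rule measurable_coordinatewise_then_product) (use assms in \<open>auto split: prod.split\<close>)

lemma lip_seqs_in_sets [measurable]: "lip_seqs q \<in> sets borel"
  unfolding lip_seqs_def by measurable

lemma lip_ext_bdd_below:
  assumes "w \<in> lip_seqs q"
  shows "bdd_below (range (\<lambda>j. entry w k j + dist t (q j)))"
proof (rule bdd_belowI2)
  fix j
  have "\<bar>entry w k 0 - entry w k j\<bar> \<le> dist (q 0) (q j)" using assms by (simp add: lip_seqs_def)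
  moreover have "dist (q 0) (q j) \<le> dist t (q 0) + dist t (q j)"
    by (rule dist_triangle3)
  ultimately show "entry w k 0 - dist t (q 0) \<le> entry w k j + dist t (q j)" by linarith
qed

lemma lip_ext_entry:
  assumes "w \<in> lip_seqs q"
  shows "lip_ext q w k (q i) = entry w k i"
  unfolding lip_ext_def
proof (rule antisym)
  show "(INF j. entry w k j + dist (q i) (q j)) \<le> entry w k i"
    using cINF_lower[OF lip_ext_bdd_below[OF assms], of i k "q i"] by simp
  show "entry w k i \<le> (INF j. entry w k j + dist (q i) (q j))"
  proof (rule cINF_greatest)
    fix j
    have "\<bar>entry w k i - entry w k j\<bar> \<le> dist (q i) (q j)" using assms by (simp add: lip_seqs_def)
    then show "entry w k i \<le> entry w k j + dist (q i) (q j)" by linarith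
  qed simp
qed

lemma nonexpansive_lip_ext:
  assumes "w \<in> lip_seqs q"
  shows "nonexpansive (lip_ext q w k)"
proof -
  have *: "lip_ext q w k s \<le> lip_ext q w k t + dist s t" for s t
  proof -
    have "lip_ext q w k s - dist s t \<le> lip_ext q w k t"
      unfolding lip_ext_def[of q w k t]
    proof (rule cINF_greatest)
      fix j
      have "lip_ext q w k s \<le> entry w k j + dist s (q j)"
        unfolding lip_ext_def by (rule cINF_lower[OF lip_ext_bdd_below[OF assms]]) simp
      also have "dist s (q j) \<le> dist s t + dist t (q j)" by (rule dist_triangle)
      finally show "lip_ext q w k s - dist s t \<le> entry w k j + dist t (q j)" by simp
    qed simp
    then show ?thesis by simp
  qed
  show ?thesis unfolding nonexpansive_def
  proof (intro allI)
    fix s t show "\<bar>lip_ext q w k s - lip_ext q w k t\<bar> \<le> dist s t"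
      using *[of s t] *[of t s] by (simp add: dist_commute)
  qed
qed

locale dense_sequence =
  fixes q :: "nat \<Rightarrow> 't::euclidean_space"
  assumes dense: "0 < e \<Longrightarrow> \<exists>j. dist (q j) t < e"
begin

text \<open>
  Two 1-Lipschitz functions that agree on a dense set are equal; all identities of the flow rest on
  this.
\<close>
lemma nonexpansive_eqI:
  assumes f: "nonexpansive f" and g: "nonexpansive g" and eq: "\<And>j. f (q j) = g (q j)"
  shows "f t = g t"
proof (rule ccontr)
  assume "f t \<noteq> g t"
  then have "0 < \<bar>f t - g t\<bar> / 2" by simp
  from dense[OF this] obtain j where j: "dist (q j) t < \<bar>f t - g t\<bar> / 2" by blast
  have "\<bar>f t - g t\<bar> \<le> \<bar>f (q j) - f t\<bar> + \<bar>g (q j) - g t\<bar>"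
    using eq[of j] by simp
  also have "\<dots> \<le> dist (q j) t + dist (q j) t"
    using f g by (intro add_mono) (auto simp: nonexpansive_def)
  also have "\<dots> < \<bar>f t - g t\<bar> / 2 + \<bar>f t - g t\<bar> / 2"
    by (intro add_strict_mono j)
  finally show False by simp
qed

lemma lip_ext_sample:
  assumes "\<And>k. nonexpansive (f k)"
  shows "lip_ext q (sample q f) k t = f k t"
  by (rule nonexpansive_eqI[OF nonexpansive_lip_ext[OF sample_in_lip_seqs[of f q]]])
     (simp_all add: assms lip_ext_entry sample_in_lip_seqs)

lemma nonexpansive_translate: "nonexpansive f \<Longrightarrow> nonexpansive (\<lambda>s. f (s + u))" for u :: 't
proof -
  assume f: "nonexpansive f"
  have "\<bar>f (s + u) - f (t + u)\<bar> \<le> dist (s + u) (t + u)" for s t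
    using f unfolding nonexpansive_def by blast
  then show "nonexpansive (\<lambda>s. f (s + u))" by (simp add: nonexpansive_def dist_norm)
qed

lemma flow_in_lip_seqs: "w \<in> lip_seqs q \<Longrightarrow> flow q t w \<in> lip_seqs q"
  unfolding flow_def by (auto intro!: sample_in_lip_seqs nonexpansive_translate nonexpansive_lip_ext)

lemma lip_ext_flow:
  assumes "w \<in> lip_seqs q"
  shows "lip_ext q (flow q t w) k s = lip_ext q w k (s + t)"
  unfolding flow_def using assms
  by (simp add: lip_ext_sample nonexpansive_translate nonexpansive_lip_ext)

lemma flow_zero: "flow q 0 w = w"
  by (auto simp: flow_def lip_ext_entry intro: real_seq_eqI)

lemma flow_flow: "flow q t (flow q s w) = flow q (t + s) w"
proof (cases "w \<in> lip_seqs q")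
  case True
  then show ?thesis
    by (intro real_seq_eqI)
       (simp add: flow_def[of q t] flow_def[of q "t + s"] flow_in_lip_seqs lip_ext_flow add.assoc)
qed (simp add: flow_def)

lemma flow_sample:
  assumes "\<And>k. nonexpansive (f k)"
  shows "flow q t (sample q f) = sample q (\<lambda>k s. f k (s + t))"
  using assms by (simp add: flow_def sample_in_lip_seqs lip_ext_sample)

lemma bij_flow: "bij (flow q t)"
  by (rule o_bij[of "flow q (- t)"]) (auto simp: fun_eq_iff flow_flow flow_zero)

lemma the_inv_flow: "the_inv_into UNIV (flow q t) = flow q (- t)"
proof
  fix w
  have "the_inv_into UNIV (flow q t) (flow q t (flow q (- t) w)) = flow q (- t) w"
    by (rule the_inv_into_f_f) (use bij_flow in \<open>auto simp: bij_def\<close>)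
  then show "the_inv_into UNIV (flow q t) w = flow q (- t) w" by (simp add: flow_flow flow_zero)
qed

lemma lip_ext_measurable [measurable]:
  "(\<lambda>z. lip_ext q (snd z) k (s + fst z)) \<in> borel_measurable (borel \<Otimes>\<^sub>M borel)"
  unfolding lip_ext_def by measurable

lemma flow_measurable: "(\<lambda>(t, w). flow q t w) \<in> borel \<Otimes>\<^sub>M borel \<rightarrow>\<^sub>M borel"
proof -
  have "(\<lambda>z. sample q (\<lambda>k s. lip_ext q (snd z) k (s + fst z))) \<in> borel_measurable (borel \<Otimes>\<^sub>M borel)"
    by (rule sample_measurable) measurable
  then have "(\<lambda>z. if snd z \<in> lip_seqs q then sample q (\<lambda>k s. lip_ext q (snd z) k (s + fst z)) else snd z)
    \<in> borel_measurable (borel \<Otimes>\<^sub>M borel)"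
    by measurable
  then show ?thesis by (simp add: flow_def case_prod_unfold)
qed

lemma flow_measurable1: "flow q t \<in> borel \<rightarrow>\<^sub>M borel"
  using measurable_compose[OF measurable_Pair1' flow_measurable, of t] by simp

lemma measurable_mp_action_flow:
  assumes sets: "sets \<mu> = sets borel"
    and inv: "\<And>t B. B \<in> sets borel \<Longrightarrow> emeasure \<mu> (flow q t -` B) = emeasure \<mu> B"
  shows "measurable_mp_action \<mu> (flow q)"
proof -
  have space: "space \<mu> = UNIV" using sets_eq_imp_space_eq[OF sets] by simp
  have m: "flow q t \<in> \<mu> \<rightarrow>\<^sub>M \<mu>" for t
    using flow_measurable1[of t] sets by (simp cong: measurable_cong_sets)
  have "measure_iso_mod_null \<mu> \<mu> (flow q t)" for t
    unfolding measure_iso_mod_null_def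
  proof (intro bexI conjI ballI impI)
    show "bij_betw (flow q t) (space \<mu> - {}) (space \<mu> - {})" using bij_flow by (simp add: space)
    have r: "restrict_space \<mu> (space \<mu> - {}) = \<mu>"
      using sets.top[of \<mu>]
      by (intro measure_eqI) (auto simp: sets_restrict_space space emeasure_restrict_space)
    show "flow q t \<in> restrict_space \<mu> (space \<mu> - {}) \<rightarrow>\<^sub>M restrict_space \<mu> (space \<mu> - {})"
      unfolding r by (rule m)
    show "the_inv_into (space \<mu> - {}) (flow q t) \<in> restrict_space \<mu> (space \<mu> - {}) \<rightarrow>\<^sub>M restrict_space \<mu> (space \<mu> - {})"
      unfolding r using m[of "- t"] by (simp add: space the_inv_flow)
    show "emeasure \<mu> (flow q t -` B \<inter> (space \<mu> - {})) = emeasure \<mu> B" if "B \<in> sets \<mu>" for B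
      using inv[of B t] that sets space by simp
  qed auto
  moreover have "(\<lambda>(t, w). flow q t w) \<in> borel \<Otimes>\<^sub>M \<mu> \<rightarrow>\<^sub>M \<mu>"
    using flow_measurable sets by (simp cong: measurable_cong_sets sets_pair_measure_cong)
  ultimately show ?thesis
    unfolding measurable_mp_action_def mp_action_def by (auto simp: space flow_zero flow_flow)
qed

end

text \<open>
  The metric of the type itself is complete and separable, and the identity is the isomorphism.
\<close>
lemma borel_space_borel:
  fixes M :: "'a::polish_space measure"
  assumes sets: "sets M = sets borel"
  shows "borel_space M"
proof -
  have space: "space M = UNIV" using sets_eq_imp_space_eq[OF sets] by simp
  have b: "borel_algebra_of euclidean = (borel :: 'a measure)"
    by (simp add: borel_algebra_of_def borel_def open_openin[symmetric])
  have "Metric_space.mcomplete (UNIV :: 'a set) dist"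
    using complete_UNIV by (simp add: mcomplete_iff_complete)
  then have c: "mcomplete_of (euclidean_metric :: 'a metric)"
    by (simp add: mcomplete_of_def)
  have s: "separable_space (euclidean :: 'a topology)"
  proof -
    obtain D :: "'a set" where D: "countable D" "\<And>X. open X \<Longrightarrow> X \<noteq> {} \<Longrightarrow> \<exists>d\<in>D. d \<in> X"
      using countable_dense_setE by blast
    have "euclidean closure_of D = topspace euclidean"
      unfolding dense_intersects_open using D(2) by (auto simp: open_openin[symmetric])
    then show ?thesis using D(1) by (auto simp: separable_space_def)
  qed
  show ?thesis
    unfolding borel_space_def
  proof (intro exI conjI)
    show "id \<in> M \<rightarrow>\<^sub>M borel_algebra_of (mtopology_of euclidean_metric)"
      using sets by (simp add: b cong: measurable_cong_sets)
    have "the_inv_into UNIV id = (id :: 'a \<Rightarrow> 'a)" by (auto simp: the_inv_into_def fun_eq_iff)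
    then show "the_inv_into (space M) id \<in> borel_algebra_of (mtopology_of euclidean_metric) \<rightarrow>\<^sub>M M"
      using sets by (simp add: b space cong: measurable_cong_sets)
  qed (use c s in \<open>simp_all add: space\<close>)
qed

section \<open>Smoothing configurations\<close>

lemma integral_lborel_translate:
  fixes f :: "'t::euclidean_space \<Rightarrow> real"
  assumes [measurable]: "f \<in> borel_measurable borel"
  shows "(\<integral>s. f (s + u) \<partial>lborel) = (\<integral>s. f s \<partial>lborel)"
proof -
  have "(\<integral>s. f s \<partial>lborel) = (\<integral>s. f s \<partial>distr lborel borel ((+) u))"
    by (simp add: lborel_distr_plus)
  also have "\<dots> = (\<integral>s. f (u + s) \<partial>lborel)"
    by (rule integral_distr) auto
  finally show ?thesis by (simp add: add.commute)
qed

lemma integrable_indicator_ball: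
  "integrable lborel (\<lambda>s. c * indicator (ball t r) s :: real)" for t :: "'t::euclidean_space"
  using emeasure_lborel_ball_finite[of t r] by simp

lemma integral_indicator_ball:
  "(\<integral>s. c * indicator (ball t r) s \<partial>lborel) = c * measure lborel (ball (0 :: 't) r)" for t :: "'t::euclidean_space" and c :: real
  using content_ball_conv_unit_ball[of r t] content_ball_conv_unit_ball[of r "0 :: 't"]
  by (cases "r \<ge> 0") (simp_all add: ball_empty)

lemma AE_eventually_notin_of_geometric:
  fixes A :: "nat \<Rightarrow> 'a set"
  assumes A: "\<And>n. A n \<in> sets M" and le: "\<And>n. emeasure M (A n) \<le> ennreal (c * (1 / 2) ^ n)"
    and c: "0 \<le> c"
  shows "AE x in M. \<exists>m. \<forall>n\<ge>m. x \<notin> A n"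
proof -
  have "AE x in M. eventually (\<lambda>n. x \<in> space M - A n) sequentially"
  proof (rule borel_cantelli_AE1[OF A])
    show "emeasure M (A n) < \<infinity>" for n
      using le[of n] by (simp add: order_le_less_trans)
    have "measure M (A n) \<le> c * (1 / 2) ^ n" for n
      using le[of n] c unfolding measure_def by (simp add: enn2real_leI)
    then show "summable (\<lambda>n. measure M (A n))"
      by (intro summable_comparison_test'[OF summable_mult[OF summable_geometric]]) auto
  qed
  then show ?thesis by eventually_elim (auto simp: eventually_sequentially)
qed

sublocale stationary_levy \<subseteq> ds: dense_sequence "dense_seq :: nat \<Rightarrow> 't"
  by standard (rule dense_seq_dist)

context stationary_levy
begin

text \<open>
  Scales on which the error of stochastic continuity is summable.
\<close>
definition eps :: "nat \<Rightarrow> real"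
  where "eps k = (SOME d. d > 0 \<and> (\<forall>h. norm h \<le> d \<longrightarrow> jump h \<le> (1 / 2) ^ k))"

lemma eps_pos: "eps k > 0" and jump_le: "norm h \<le> eps k \<Longrightarrow> jump h \<le> (1 / 2) ^ k"
proof -
  have "\<exists>d>0. \<forall>h. norm h \<le> d \<longrightarrow> jump h \<le> (1 / 2) ^ k" by (rule jump_small) simp
  then have "eps k > 0 \<and> (\<forall>h. norm h \<le> eps k \<longrightarrow> jump h \<le> (1 / 2) ^ k)"
    unfolding eps_def by (rule someI_ex)
  then show "eps k > 0" "norm h \<le> eps k \<Longrightarrow> jump h \<le> (1 / 2) ^ k" by auto
qed

definition near :: "nat \<Rightarrow> 't \<Rightarrow> nat"
  where "near n t = (LEAST j. dist (q j) t < eps n)"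

lemma dist_near: "dist (q (near n t)) t < eps n"
proof -
  obtain j where "dist (q j) t < eps n" using dense_seq_dist[OF eps_pos] by blast
  then show ?thesis unfolding near_def by (rule LeastI)
qed

lemma near_measurable [measurable]: "near n \<in> borel \<rightarrow>\<^sub>M count_space UNIV"
  unfolding near_def by measurable

text \<open>
  The process is read off at points of the dense sequence near \<open>t\<close>.  The index of the point chosen is a
  measurable function of \<open>t\<close> with countable range, which makes the version jointly measurable.
\<close>
definition version :: "'t \<Rightarrow> ('t \<Rightarrow> bool) \<Rightarrow> bool"
  where "version t x \<longleftrightarrow> (\<exists>m. \<forall>n\<ge>m. x (q (near n t)))"

lemma version_measurable [measurable]:
  assumes [measurable]: "f \<in> M \<rightarrow>\<^sub>M borel" "g \<in> M \<rightarrow>\<^sub>M cyl"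
  shows "Measurable.pred M (\<lambda>z. version (f z) (g z))"
proof -
  have *: "Measurable.pred M (\<lambda>z. g z (q (near n (f z))))" for n
  proof (rule measurable_compose_countable[where f = "\<lambda>j z. g z (q j)" and g = "\<lambda>z. near n (f z)"])
    show "Measurable.pred M (\<lambda>z. g z (q j))" for j
      using measurable_compose[OF assms(2) pred_coordinate] .
  qed measurable
  show ?thesis unfolding version_def using * by measurable
qed

text \<open>
  Borel-Cantelli: the \<open>n\<close>-th approximating point disagrees with \<open>t\<close> only on a set of subsets of mass
  at most \<open>2 * (1 / 2) ^ n\<close>.
\<close>
lemma AE_version: "AE x in levy. version t x \<longleftrightarrow> x t"
proof -
  define A where "A n = {x :: 't \<Rightarrow> bool. x (q (near n t)) \<noteq> x t}" for n
  have e: "emeasure levy (A n) \<le> ennreal (2 * (1 / 2) ^ n)" for n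
  proof -
    have "norm (t - q (near n t)) \<le> eps n" using dist_near[of n t] by (simp add: dist_norm norm_minus_commute)
    from jump_le[OF this] show ?thesis
      unfolding A_def emeasure_levy_jump by (intro ennreal_leI) simp
  qed
  have "A n \<in> sets levy" for n
    unfolding A_def by (simp, intro Collect_in_sets_cyl, measurable)
  from AE_eventually_notin_of_geometric[OF this e] have "AE x in levy. \<exists>m. \<forall>n\<ge>m. x \<notin> A n" by simp
  then show ?thesis
  proof eventually_elim
    case (elim x)
    then obtain m where m: "\<And>n. n \<ge> m \<Longrightarrow> x (q (near n t)) = x t"
      by (auto simp: A_def)
    show ?case
    proof
      assume "version t x"
      then obtain m' where "\<And>n. n \<ge> m' \<Longrightarrow> x (q (near n t))" by (auto simp: version_def)
      from this[of "max m m'"] m[of "max m m'"] show "x t" by simp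
    next
      assume "x t"
      then show "version t x" using m by (auto simp: version_def)
    qed
  qed
qed

lemma pair_sigma_finite_levy: "pair_sigma_finite lborel levy"
  by (intro pair_sigma_finite.intro sigma_finite_levy lborel.sigma_finite_measure_axioms)

lemma nn_integral_levy_lborel:
  fixes f :: "'t \<Rightarrow> ennreal"
  assumes [measurable]: "f \<in> borel_measurable borel"
    "Measurable.pred (borel \<Otimes>\<^sub>M cyl) (\<lambda>z. P (fst z) (snd z))"
  shows "(\<integral>\<^sup>+x. (\<integral>\<^sup>+s. f s * indicator {s. P s x} s \<partial>lborel) \<partial>levy)
    = (\<integral>\<^sup>+s. f s * emeasure levy {x. P s x} \<partial>lborel)"
proof -
  interpret pair_sigma_finite lborel levy by (rule pair_sigma_finite_levy)
  have P: "Measurable.pred (lborel \<Otimes>\<^sub>M levy) (\<lambda>z. P (fst z) (snd z))"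
    using assms(2) by (simp cong: measurable_cong_sets sets_pair_measure_cong)
  have Px: "{x. P s x} \<in> sets levy" for s
    using measurable_compose[OF measurable_Pair1' assms(2), of s]
    by (simp add: Collect_in_sets_cyl)
  have "(\<lambda>z. f (fst z) * indicator {z \<in> space (lborel \<Otimes>\<^sub>M levy). P (fst z) (snd z)} z) \<in> borel_measurable (lborel \<Otimes>\<^sub>M levy)"
    using P by measurable
  also have "(\<lambda>z. f (fst z) * indicator {z \<in> space (lborel \<Otimes>\<^sub>M levy). P (fst z) (snd z)} z)
    = (\<lambda>(s, x). f s * indicator {s. P s x} s)"
    by (auto simp: fun_eq_iff indicator_def space_pair_measure)
  finally have m: "(\<lambda>(s, x). f s * indicator {s. P s x} s) \<in> borel_measurable (lborel \<Otimes>\<^sub>M levy)" .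
  have "(\<integral>\<^sup>+x. (\<integral>\<^sup>+s. f s * indicator {s. P s x} s \<partial>lborel) \<partial>levy)
     = (\<integral>\<^sup>+s. (\<integral>\<^sup>+x. f s * indicator {s. P s x} s \<partial>levy) \<partial>lborel)"
    using Fubini[OF m] by simp
  also have "\<dots> = (\<integral>\<^sup>+s. f s * emeasure levy {x. P s x} \<partial>lborel)"
  proof (rule nn_integral_cong)
    fix s
    have "(\<integral>\<^sup>+x. f s * indicator {s. P s x} s \<partial>levy) = (\<integral>\<^sup>+x. f s * indicator {x. P s x} x \<partial>levy)"
      by (simp add: indicator_def)
    then show "(\<integral>\<^sup>+x. f s * indicator {s. P s x} s \<partial>levy) = f s * emeasure levy {x. P s x}"
      using Px by (simp add: nn_integral_cmult_indicator)
  qed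
  finally show ?thesis .
qed

definition vol :: "nat \<Rightarrow> real" where "vol k = measure lborel (ball (0 :: 't) (eps k))"

lemma vol_pos: "vol k > 0"
  unfolding vol_def by (rule content_ball_pos[OF eps_pos])

text \<open>
  With this normalization, two kernels with centres at distance \<open>r\<close> differ by at most
  \<open>r / (2 * vol k)\<close>, and only on two balls of volume \<open>vol k\<close>.  Averages are then 1-Lipschitz functions of
  the centre (\<open>nonexpansive_smooth\<close>); the price is a total mass other than \<open>1\<close>.
\<close>
definition bump :: "nat \<Rightarrow> 't \<Rightarrow> real"
  where "bump k v = max 0 (eps k - norm v) / (2 * vol k)"

lemma bump_measurable [measurable]: "bump k \<in> borel_measurable borel"
  unfolding bump_def by measurable

lemma bump_nonneg: "0 \<le> bump k v"
  using vol_pos[of k] by (simp add: bump_def)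

lemma bump_eq_0: "eps k \<le> norm v \<Longrightarrow> bump k v = 0"
  by (simp add: bump_def)

lemma bump_le: "bump k (t - s) \<le> eps k / (2 * vol k) * indicator (ball t (eps k)) s"
  using vol_pos[of k] eps_pos[of k]
  by (auto simp: bump_def indicator_def dist_norm divide_simps)

lemma integrable_bump: "integrable lborel (\<lambda>s. bump k (t - s))"
proof (rule Bochner_Integration.integrable_bound[OF integrable_indicator_ball[of "eps k / (2 * vol k)" t "eps k"]])
  have "norm (bump k (t - s)) \<le> norm (eps k / (2 * vol k) * indicator (ball t (eps k)) s)" for s
    unfolding real_norm_def abs_of_nonneg[OF bump_nonneg] by (rule order_trans[OF bump_le abs_ge_self])
  then show "AE s in lborel. norm (bump k (t - s)) \<le> norm (eps k / (2 * vol k) * indicator (ball t (eps k)) s)"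
    by simp
qed measurable

definition mass :: "nat \<Rightarrow> real" where "mass k = (\<integral>s. bump k s \<partial>lborel)"

lemma integral_bump: "(\<integral>s. bump k (t - s) \<partial>lborel) = mass k"
proof -
  have "bump k (t - s) = bump k (s + (- t))" for s by (simp add: bump_def norm_minus_commute)
  then show ?thesis unfolding mass_def by (simp only:) (rule integral_lborel_translate, measurable)
qed

lemma nn_integral_bump: "(\<integral>\<^sup>+s. ennreal (bump k (t - s)) \<partial>lborel) = ennreal (mass k)"
  using nn_integral_eq_integral[OF integrable_bump[of k t]] bump_nonneg by (simp add: integral_bump)

lemma mass_pos: "mass k > 0"
proof -
  let ?c = "eps k / (4 * vol k)"
  have "0 < ?c * measure lborel (ball (0 :: 't) (eps k / 2))"
    using eps_pos[of k] vol_pos[of k] by (intro mult_pos_pos content_ball_pos divide_pos_pos) auto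
  also have "\<dots> = (\<integral>s. ?c * indicator (ball 0 (eps k / 2)) (s :: 't) \<partial>lborel)"
    by (rule integral_indicator_ball[symmetric])
  also have "\<dots> \<le> (\<integral>s. bump k (0 - s) \<partial>lborel)"
  proof (rule integral_mono[OF integrable_indicator_ball integrable_bump])
    fix s :: 't
    show "?c * indicator (ball 0 (eps k / 2)) s \<le> bump k (0 - s)"
      using eps_pos[of k] vol_pos[of k] by (auto simp: bump_def indicator_def divide_simps)
  qed
  finally show ?thesis by (simp only: integral_bump)
qed

definition smooth :: "nat \<Rightarrow> 't \<Rightarrow> ('t \<Rightarrow> bool) \<Rightarrow> real"
  where "smooth k t x = (\<integral>s. bump k (t - s) * of_bool (version s x) \<partial>lborel)"

lemma version_section [measurable]: "Measurable.pred borel (\<lambda>s. version s x)"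
proof -
  have "(\<lambda>s. x) \<in> borel \<rightarrow>\<^sub>M (cyl :: ('t \<Rightarrow> bool) measure)" by simp
  from version_measurable[OF _ this, of "\<lambda>s. s"] show ?thesis by simp
qed

lemma integrable_bump_mult:
  assumes [measurable]: "f \<in> borel_measurable borel" and "\<And>s. \<bar>f s\<bar> \<le> 1"
  shows "integrable lborel (\<lambda>s. bump k (t - s) * f s)"
  by (rule Bochner_Integration.integrable_bound[OF integrable_bump[of k t]])
     (use assms(2) bump_nonneg in \<open>auto simp: abs_mult intro!: mult_left_le\<close>)

lemma smooth_nonneg: "0 \<le> smooth k t x"
  unfolding smooth_def using bump_nonneg by (intro Bochner_Integration.integral_nonneg) auto

lemma nonexpansive_smooth: "nonexpansive (\<lambda>t. smooth k t x)"
  unfolding nonexpansive_def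
proof (intro allI)
  fix t t' :: 't
  let ?f = "\<lambda>t s. bump k (t - s) * of_bool (version s x)"
  let ?c = "dist t t' / (2 * vol k)"
  have i: "integrable lborel (?f t)" for t by (rule integrable_bump_mult) auto
  have "\<bar>smooth k t x - smooth k t' x\<bar> = \<bar>\<integral>s. ?f t s - ?f t' s \<partial>lborel\<bar>"
    unfolding smooth_def using i by simp
  also have "\<dots> \<le> (\<integral>s. \<bar>?f t s - ?f t' s\<bar> \<partial>lborel)"
    by (rule integral_abs_bound)
  also have "\<dots> \<le> (\<integral>s. ?c * indicator (ball t (eps k)) s + ?c * indicator (ball t' (eps k)) s \<partial>lborel)"
  proof (rule integral_mono)
    show "integrable lborel (\<lambda>s. \<bar>?f t s - ?f t' s\<bar>)"
      using i by (intro integrable_abs Bochner_Integration.integrable_diff)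
    show "integrable lborel (\<lambda>s. ?c * indicator (ball t (eps k)) s + ?c * indicator (ball t' (eps k)) s)"
      by (intro Bochner_Integration.integrable_add integrable_indicator_ball)
    fix s
    have c: "0 \<le> ?c" using vol_pos[of k] by simp
    have "\<bar>?f t s - ?f t' s\<bar> \<le> \<bar>bump k (t - s) - bump k (t' - s)\<bar>" by simp
    also have "\<dots> \<le> ?c * indicator (ball t (eps k)) s + ?c * indicator (ball t' (eps k)) s"
    proof (cases "s \<in> ball t (eps k) \<or> s \<in> ball t' (eps k)")
      case True
      have "\<bar>norm (t - s) - norm (t' - s)\<bar> \<le> norm ((t - s) - (t' - s))" by (rule norm_triangle_ineq3)
      also have "\<dots> = dist t t'" by (simp add: dist_norm)
      finally have "\<bar>max 0 (eps k - norm (t - s)) - max 0 (eps k - norm (t' - s))\<bar> \<le> dist t t'" by linarith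
      then have "\<bar>bump k (t - s) - bump k (t' - s)\<bar> \<le> ?c"
        using vol_pos[of k] by (simp add: bump_def diff_divide_distrib[symmetric] abs_divide divide_right_mono)
      also have "\<dots> \<le> ?c * indicator (ball t (eps k)) s + ?c * indicator (ball t' (eps k)) s"
        using True c by (auto simp: indicator_def)
      finally show ?thesis .
    next
      case False
      then have "bump k (t - s) = 0" "bump k (t' - s) = 0" by (auto simp: dist_norm intro!: bump_eq_0)
      with c show ?thesis by (simp add: indicator_def)
    qed
    finally show "\<bar>?f t s - ?f t' s\<bar> \<le> ?c * indicator (ball t (eps k)) s + ?c * indicator (ball t' (eps k)) s" .
  qed
  also have "\<dots> = ?c * vol k + ?c * vol k"
    by (subst Bochner_Integration.integral_add)
       (simp_all only: integrable_indicator_ball integral_indicator_ball vol_def)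
  also have "\<dots> = dist t t'" using vol_pos[of k] by (simp add: field_simps)
  finally show "\<bar>smooth k t x - smooth k t' x\<bar> \<le> dist t t'" .
qed

lemma smooth_measurable [measurable]: "smooth k t \<in> borel_measurable cyl"
  unfolding smooth_def
proof (rule lborel.borel_measurable_lebesgue_integral)
  have [measurable]: "Measurable.pred (cyl \<Otimes>\<^sub>M lborel) (\<lambda>z. version (snd z) (fst z))"
    by (rule version_measurable) measurable
  show "(\<lambda>(x, s). bump k (t - s) * of_bool (version s x)) \<in> borel_measurable (cyl \<Otimes>\<^sub>M lborel)"
    unfolding case_prod_beta by measurable
qed

lemma emeasure_version_eq:
  "emeasure levy {x. version s x} = ennreal (\<Psi> {0})"
  "emeasure levy {x. version s x \<noteq> x t} = ennreal (2 * jump (t - s))"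
proof -
  have "emeasure levy {x. version s x} = emeasure levy {x. x s}"
    using AE_version[of s] by (intro emeasure_eq_AE) (auto intro!: Collect_in_sets_cyl)
  then show "emeasure levy {x. version s x} = ennreal (\<Psi> {0})" by (simp add: emeasure_levy_single)
  have "emeasure levy {x. version s x \<noteq> x t} = emeasure levy {x. x s \<noteq> x t}"
    using AE_version[of s] by (intro emeasure_eq_AE) (auto intro!: Collect_in_sets_cyl)
  then show "emeasure levy {x. version s x \<noteq> x t} = ennreal (2 * jump (t - s))" by (simp only: emeasure_levy_jump)
qed

lemma nn_integral_smooth: "(\<integral>\<^sup>+x. ennreal (smooth k t x) \<partial>levy) = ennreal (mass k) * ennreal (\<Psi> {0})"
proof -
  have "ennreal (smooth k t x) = (\<integral>\<^sup>+s. ennreal (bump k (t - s)) * indicator {s. version s x} s \<partial>lborel)" for x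
  proof -
    have "ennreal (smooth k t x) = (\<integral>\<^sup>+s. ennreal (bump k (t - s) * of_bool (version s x)) \<partial>lborel)"
      unfolding smooth_def using bump_nonneg
      by (intro nn_integral_eq_integral[symmetric] integrable_bump_mult) auto
    also have "\<dots> = (\<integral>\<^sup>+s. ennreal (bump k (t - s)) * indicator {s. version s x} s \<partial>lborel)"
      by (intro nn_integral_cong) (auto simp: indicator_def)
    finally show ?thesis .
  qed
  then have "(\<integral>\<^sup>+x. ennreal (smooth k t x) \<partial>levy)
    = (\<integral>\<^sup>+s. ennreal (bump k (t - s)) * emeasure levy {x. version s x} \<partial>lborel)"
    by (simp only:) (rule nn_integral_levy_lborel, auto)
  also have "\<dots> = ennreal (mass k) * ennreal (\<Psi> {0})"
    unfolding emeasure_version_eq by (subst nn_integral_multc) (auto simp: nn_integral_bump)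
  finally show ?thesis .
qed

text \<open>
  The kernel at scale \<open>k\<close> only sees points at distance less than \<open>eps k\<close> from \<open>t\<close>, and such points
  disagree with \<open>t\<close> on a set of mass at most \<open>2 * (1 / 2) ^ k\<close>.
\<close>
lemma nn_integral_smooth_diff:
  "(\<integral>\<^sup>+x. ennreal \<bar>smooth k t x - mass k * of_bool (x t)\<bar> \<partial>levy) \<le> ennreal (2 * (1 / 2) ^ k * mass k)"
proof -
  let ?B = "\<lambda>x. \<integral>\<^sup>+s. ennreal (bump k (t - s)) * indicator {s. version s x \<noteq> x t} s \<partial>lborel"
  let ?d = "\<lambda>x. \<bar>smooth k t x - mass k * of_bool (x t)\<bar>"
  have "ennreal (?d x)
    \<le> ?B x" for x
  proof -
    have i: "integrable lborel (\<lambda>s. bump k (t - s) * of_bool (version s x))"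
      by (rule integrable_bump_mult) auto
    have j: "integrable lborel (\<lambda>s. bump k (t - s) * (of_bool (version s x) - of_bool (x t)))"
      by (rule integrable_bump_mult) auto
    have "smooth k t x - mass k * of_bool (x t)
      = (\<integral>s. bump k (t - s) * of_bool (version s x) - bump k (t - s) * of_bool (x t) \<partial>lborel)"
      using i integrable_bump[of k t] by (simp add: smooth_def integral_bump)
    also have "\<dots> = (\<integral>s. bump k (t - s) * (of_bool (version s x) - of_bool (x t)) \<partial>lborel)"
      by (simp add: right_diff_distrib)
    finally have "ennreal (?d x)
      \<le> (\<integral>\<^sup>+s. ennreal (norm (bump k (t - s) * (of_bool (version s x) - of_bool (x t)))) \<partial>lborel)"
      using integral_norm_bound_ennreal[OF j] by simp
    also have "\<dots> = ?B x"
      using bump_nonneg by (intro nn_integral_cong) (auto simp: indicator_def)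
    finally show ?thesis .
  qed
  then have "(\<integral>\<^sup>+x. ennreal (?d x) \<partial>levy)
    \<le> (\<integral>\<^sup>+x. ?B x \<partial>levy)"
    by (intro nn_integral_mono)
  also have "\<dots> = (\<integral>\<^sup>+s. ennreal (bump k (t - s)) * emeasure levy {x. version s x \<noteq> x t} \<partial>lborel)"
    by (rule nn_integral_levy_lborel) auto
  also have "\<dots> \<le> (\<integral>\<^sup>+s. ennreal (bump k (t - s)) * ennreal (2 * (1 / 2) ^ k) \<partial>lborel)"
  proof (rule nn_integral_mono)
    fix s
    show "ennreal (bump k (t - s)) * emeasure levy {x. version s x \<noteq> x t} \<le> ennreal (bump k (t - s)) * ennreal (2 * (1 / 2) ^ k)"
    proof (cases "norm (t - s) \<le> eps k")
      case True
      from jump_le[OF this] show ?thesis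
        unfolding emeasure_version_eq by (intro mult_left_mono ennreal_leI) auto
    qed (simp add: bump_eq_0)
  qed
  also have "\<dots> = ennreal (mass k) * ennreal (2 * (1 / 2) ^ k)"
    by (subst nn_integral_multc) (auto simp: nn_integral_bump)
  also have "\<dots> = ennreal (2 * (1 / 2) ^ k * mass k)"
    using mass_pos[of k] by (simp add: ennreal_mult'[symmetric] mult.commute)
  finally show ?thesis .
qed

text \<open>
  By Markov's inequality and Borel-Cantelli, the averages divided by \<open>mass k\<close> are eventually closer than
  \<open>1 / 2\<close> to the indicator of \<open>x t\<close>.
\<close>
lemma AE_smooth_decides: "AE x in levy. (\<exists>m. \<forall>k\<ge>m. mass k / 2 < smooth k t x) \<longleftrightarrow> x t"
proof -
  let ?d = "\<lambda>k x. \<bar>smooth k t x - mass k * of_bool (x t)\<bar>"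
  define A where "A k = {x. mass k / 2 \<le> ?d k x}" for k
  have A: "A k \<in> sets cyl" for k
    unfolding A_def by (rule Collect_in_sets_cyl) measurable
  have e: "emeasure levy (A k) \<le> ennreal (4 * (1 / 2) ^ k)" for k
  proof -
    have "emeasure levy (A k) \<le> ennreal (2 / mass k) * (\<integral>\<^sup>+x. ennreal (?d k x) * indicator UNIV x \<partial>levy)"
    proof -
      have "A k = {x \<in> UNIV. 1 \<le> ennreal (2 / mass k) * ennreal (?d k x)}"
        using mass_pos[of k]
        by (auto simp: A_def ennreal_mult'[symmetric] ennreal_1[symmetric] field_simps simp del: ennreal_1)
      also have "emeasure levy \<dots> \<le> ennreal (2 / mass k) * (\<integral>\<^sup>+x. ennreal (?d k x) * indicator UNIV x \<partial>levy)"
        by (rule nn_integral_Markov_inequality) (auto intro: sets.top[of levy, simplified])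
      finally show ?thesis .
    qed
    also have "\<dots> \<le> ennreal (2 / mass k) * ennreal (2 * (1 / 2) ^ k * mass k)"
      using nn_integral_smooth_diff[of k t] by (intro mult_left_mono) auto
    also have "\<dots> = ennreal (4 * (1 / 2) ^ k)"
      using mass_pos[of k] by (simp add: ennreal_mult'[symmetric])
    finally show ?thesis .
  qed
  have "A k \<in> sets levy" for k using A by simp
  from AE_eventually_notin_of_geometric[OF this e] have "AE x in levy. \<exists>m. \<forall>k\<ge>m. x \<notin> A k" by simp
  then show ?thesis
  proof eventually_elim
    case (elim x)
    then obtain m where m: "\<And>k. k \<ge> m \<Longrightarrow> ?d k x < mass k / 2"
      by (auto simp: A_def not_le)
    show ?case
    proof
      assume "x t"
      have "mass k / 2 < smooth k t x" if "k \<ge> m" for k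
        using m[OF that] \<open>x t\<close> by (simp add: abs_if split: if_splits)
      then show "\<exists>m. \<forall>k\<ge>m. mass k / 2 < smooth k t x" by blast
    next
      assume "\<exists>m. \<forall>k\<ge>m. mass k / 2 < smooth k t x"
      then obtain m' where "\<And>k. k \<ge> m' \<Longrightarrow> mass k / 2 < smooth k t x" by blast
      from this[of "max m m'"] m[of "max m m'"] show "x t" by (cases "x t") auto
    qed
  qed
qed

text \<open>
  For a fixed \<open>s\<close> both versions agree almost everywhere with the value of the subset at \<open>s + u\<close>.  Fubini's
  theorem turns this into agreement for almost all \<open>s\<close>, which is all that an average depends on.  This
  is the point at which joint measurability is indispensable.
\<close>
lemma AE_smooth_shift: "AE x in levy. \<forall>k t. smooth k t (shift_cfg u x) = smooth k (t + u) x"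
proof -
  interpret pair_sigma_finite lborel levy by (rule pair_sigma_finite_levy)
  have "AE x in levy. version s (shift_cfg u x) \<longleftrightarrow> version (s + u) x" for s
  proof -
    have "AE y in distr levy cyl (shift_cfg u). version s y \<longleftrightarrow> y s"
      unfolding levy_shift by (rule AE_version)
    then have "AE x in levy. version s (shift_cfg u x) \<longleftrightarrow> shift_cfg u x s"
      by (rule AE_distrD[rotated]) measurable
    with AE_version[of "s + u"] show ?thesis
      by eventually_elim (simp add: shift_cfg_def)
  qed
  then have "AE s in lborel. AE x in levy. version s (shift_cfg u x) \<longleftrightarrow> version (s + u) x" by simp
  then have "AE x in levy. AE s in lborel. version s (shift_cfg u x) \<longleftrightarrow> version (s + u) x"
  proof (subst AE_commute[symmetric])
    have [measurable]: "Measurable.pred (lborel \<Otimes>\<^sub>M levy) (\<lambda>z. version (fst z) (shift_cfg u (snd z)))"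
      "Measurable.pred (lborel \<Otimes>\<^sub>M levy) (\<lambda>z. version (fst z + u) (snd z))"
      by (rule version_measurable; measurable)+
    show "{z \<in> space (lborel \<Otimes>\<^sub>M levy). version (fst z) (shift_cfg u (snd z)) \<longleftrightarrow> version (fst z + u) (snd z)}
      \<in> sets (lborel \<Otimes>\<^sub>M levy)"
      by measurable
  qed
  then show ?thesis
  proof eventually_elim
    case (elim x)
    show ?case
    proof (intro allI)
      fix k t
      have "smooth k t (shift_cfg u x) = (\<integral>s. bump k (t - s) * of_bool (version (s + u) x) \<partial>lborel)"
        unfolding smooth_def
      proof (rule integral_cong_AE)
        have [measurable]: "Measurable.pred borel (\<lambda>s. version (s + u) x)"
          using measurable_compose[OF _ version_section, of "\<lambda>s. s + u" borel x] by simp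
        show "(\<lambda>s. bump k (t - s) * of_bool (version (s + u) x)) \<in> borel_measurable lborel" by measurable
        show "AE s in lborel. bump k (t - s) * of_bool (version s (shift_cfg u x)) = bump k (t - s) * of_bool (version (s + u) x)"
          using elim by eventually_elim simp
      qed measurable
      also have "\<dots> = (\<integral>s. bump k (t + u - (s + u)) * of_bool (version (s + u) x) \<partial>lborel)" by simp
      also have "\<dots> = smooth k (t + u) x"
        unfolding smooth_def by (rule integral_lborel_translate) measurable
      finally show "smooth k t (shift_cfg u x) = smooth k (t + u) x" .
    qed
  qed
qed

end

section \<open>The measure carried by the flow\<close>

context stationary_levy
begin

definition encode :: "('t \<Rightarrow> bool) \<Rightarrow> real_seq"
  where "encode x = sample q (\<lambda>k t. smooth k t x)"

lemma encode_measurable [measurable]: "encode \<in> cyl \<rightarrow>\<^sub>M borel"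
  unfolding encode_def by (rule sample_measurable) measurable

lemma encode_in_lip_seqs: "encode x \<in> lip_seqs q"
  unfolding encode_def by (intro sample_in_lip_seqs nonexpansive_smooth)

lemma lip_ext_encode: "lip_ext q (encode x) k t = smooth k t x"
  unfolding encode_def by (rule ds.lip_ext_sample) (rule nonexpansive_smooth)

lemma AE_encode_shift: "AE x in levy. encode (shift_cfg u x) = flow q u (encode x)"
  using AE_smooth_shift[of u]
proof eventually_elim
  case (elim x)
  then show ?case
    unfolding encode_def by (subst ds.flow_sample) (auto intro: nonexpansive_smooth)
qed

definition flow_measure :: "real_seq measure"
  where "flow_measure = distr levy borel encode"

lemma sets_flow_measure [simp, measurable_cong]: "sets flow_measure = sets borel"
  by (simp add: flow_measure_def)

lemma space_flow_measure [simp]: "space flow_measure = UNIV"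
  by (simp add: flow_measure_def)

lemma encode_in_sets_levy: "B \<in> sets borel \<Longrightarrow> {x. encode x \<in> B} \<in> sets levy"
  using measurable_sets[OF encode_measurable, of B] by (simp add: vimage_def)

lemma emeasure_flow_measure:
  assumes "B \<in> sets borel"
  shows "emeasure flow_measure B = emeasure levy {x. encode x \<in> B}"
proof -
  have "encode \<in> levy \<rightarrow>\<^sub>M borel" by measurable
  from emeasure_distr[OF this assms] show ?thesis by (simp add: flow_measure_def vimage_def)
qed

lemma emeasure_flow_measure_flow:
  assumes B: "B \<in> sets borel"
  shows "emeasure flow_measure (flow q t -` B) = emeasure flow_measure B"
proof -
  have fB: "flow q t -` B \<in> sets borel"
    using measurable_sets[OF ds.flow_measurable1 B] by simp
  have "emeasure flow_measure (flow q t -` B) = emeasure levy {x. encode x \<in> flow q t -` B}"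
    by (rule emeasure_flow_measure[OF fB])
  also have "\<dots> = emeasure levy {x. encode (shift_cfg t x) \<in> B}"
  proof (rule emeasure_eq_AE)
    show "AE x in levy. x \<in> {x. encode x \<in> flow q t -` B} \<longleftrightarrow> x \<in> {x. encode (shift_cfg t x) \<in> B}"
      using AE_encode_shift[of t] by eventually_elim simp
    show "{x. encode x \<in> flow q t -` B} \<in> sets levy"
      by (rule encode_in_sets_levy[OF fB])
    show "{x. encode (shift_cfg t x) \<in> B} \<in> sets levy"
      using measurable_sets[OF measurable_compose[OF shift_cfg_measurable encode_measurable] B, of t]
      by (simp add: vimage_def)
  qed
  also have "\<dots> = emeasure (distr levy cyl (shift_cfg t)) {x. encode x \<in> B}"
  proof -
    have "shift_cfg t \<in> levy \<rightarrow>\<^sub>M cyl" by measurable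
    then show ?thesis using encode_in_sets_levy[OF B] by (subst emeasure_distr) (auto simp: vimage_def)
  qed
  also have "\<dots> = emeasure flow_measure B"
    by (simp add: levy_shift emeasure_flow_measure[OF B])
  finally show ?thesis .
qed

text \<open>
  The codes of subsets that contain the origin, as far as the averages can tell.
\<close>
definition origin_set :: "real_seq set"
  where "origin_set = {w \<in> lip_seqs q. \<exists>m. \<forall>k\<ge>m. mass k / 2 < lip_ext q w k 0}"

lemma origin_set_in_sets [measurable]: "origin_set \<in> sets borel"
  unfolding origin_set_def lip_ext_def by measurable

lemma smooth_eq_0_of_encode:
  assumes "encode x = (\<lambda>_. 0)"
  shows "smooth k t x = 0"
proof -
  have z: "(\<lambda>_. 0) = sample q (\<lambda>k s. 0)" by (auto simp: sample_def split: prod.split)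
  have "smooth k t x = lip_ext q (encode x) k t" by (simp add: lip_ext_encode)
  also have "\<dots> = 0" unfolding assms z by (rule ds.lip_ext_sample) (simp add: nonexpansive_def)
  finally show ?thesis .
qed

lemma flow_encode_in_origin_set:
  "flow q t (encode x) \<in> origin_set \<longleftrightarrow> (\<exists>m. \<forall>k\<ge>m. mass k / 2 < smooth k t x)"
  by (simp add: origin_set_def ds.flow_in_lip_seqs encode_in_lip_seqs ds.lip_ext_flow lip_ext_encode)

lemma emeasure_flow_measure_UN:
  assumes "finite J"
  shows "emeasure flow_measure (\<Union>t\<in>J. flow q t -` origin_set) = ennreal (\<Psi> J)"
proof -
  have f: "flow q t -` origin_set \<in> sets borel" for t
    using measurable_sets[OF ds.flow_measurable1[of t] origin_set_in_sets] by simp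
  have "emeasure flow_measure (\<Union>t\<in>J. flow q t -` origin_set)
    = emeasure levy {x. \<exists>t\<in>J. \<exists>m. \<forall>k\<ge>m. mass k / 2 < smooth k t x}"
    using assms f by (subst emeasure_flow_measure) (auto simp: flow_encode_in_origin_set)
  also have "\<dots> = emeasure levy {x. \<exists>t\<in>J. x t}"
  proof (rule emeasure_eq_AE)
    have "AE x in levy. \<forall>t\<in>J. (\<exists>m. \<forall>k\<ge>m. mass k / 2 < smooth k t x) \<longleftrightarrow> x t"
      using assms AE_smooth_decides by (intro AE_finite_allI) auto
    then show "AE x in levy. x \<in> {x. \<exists>t\<in>J. \<exists>m. \<forall>k\<ge>m. mass k / 2 < smooth k t x} \<longleftrightarrow> x \<in> {x. \<exists>t\<in>J. x t}"
      by eventually_elim auto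
    show "{x. \<exists>t\<in>J. \<exists>m. \<forall>k\<ge>m. mass k / 2 < smooth k t x} \<in> sets levy"
      unfolding sets_levy using assms by (intro Collect_in_sets_cyl pred_intros_finite) measurable
    show "{x. \<exists>t\<in>J. x t} \<in> sets levy"
      unfolding sets_levy using assms by (intro Collect_in_sets_cyl pred_intros_finite) measurable
  qed
  also have "\<dots> = ennreal (\<Psi> J)" by (rule emeasure_levy_hits[OF assms])
  finally show ?thesis .
qed

text \<open>
  Almost every subset contains a point of the dense sequence, and the averages detect that point.
\<close>
lemma emeasure_flow_measure_zero: "emeasure flow_measure {\<lambda>_. 0} = 0"
proof -
  have "AE x in levy. \<forall>j. (\<exists>m. \<forall>k\<ge>m. mass k / 2 < smooth k (q j) x) \<longleftrightarrow> x (q j)"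
    using AE_smooth_decides by (simp add: AE_all_countable)
  moreover have "AE x in levy. \<exists>j. x (q j)"
    using emeasure_levy_miss[of 0] miss_all_in_sets[of q]
    by (intro AE_I[where N = "{x. \<forall>j. \<not> x (q j)}"]) auto
  ultimately have "AE x in levy. encode x \<noteq> (\<lambda>_. 0)"
  proof eventually_elim
    case (elim x)
    then obtain j m where "\<forall>k\<ge>m. mass k / 2 < smooth k (q j) x" by blast
    then have "mass m / 2 < smooth m (q j) x" by blast
    then show ?case using mass_pos[of m] smooth_eq_0_of_encode[of x m "q j"] by auto
  qed
  then have "emeasure levy {x. encode x \<in> {\<lambda>_. 0}} = emeasure levy {}"
    by (intro emeasure_eq_AE encode_in_sets_levy) auto
  then show ?thesis by (simp add: emeasure_flow_measure)
qed

text \<open>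
  Codes have no negative entries, a nonzero code has a positive entry, and by Markov's inequality the codes with an entry of at least
  \<open>1 / Suc m\<close> have finite mass.
\<close>
lemma sigma_finite_flow_measure: "sigma_finite_measure flow_measure"
proof
  define U where "U n m = {w :: real_seq. 1 / real (Suc m) \<le> w n}" for n m
  have U: "U n m \<in> sets borel" for n m unfolding U_def by measurable
  have N: "{w :: real_seq. w n < 0} \<in> sets borel" for n by measurable
  have enc: "encode x n = (case prod_decode n of (k, j) \<Rightarrow> smooth k (q j) x)" for x n
    by (simp add: encode_def sample_def)
  let ?A = "insert {\<lambda>_. 0} (range (\<lambda>n. {w. w n < 0}) \<union> range (\<lambda>(n, m). U n m))"
  have "emeasure flow_measure {w. w n < 0} = 0" for n
  proof -
    have "{x. encode x \<in> {w. w n < 0}} = {}"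
      using smooth_nonneg by (auto simp: enc not_less split: prod.split)
    then show ?thesis by (simp only: emeasure_flow_measure[OF N] emeasure_empty)
  qed
  moreover have "emeasure flow_measure (U n m) \<noteq> \<infinity>" for n m
  proof -
    obtain k j where kj: "prod_decode n = (k, j)" by fastforce
    have "emeasure flow_measure (U n m) \<le> emeasure levy {x \<in> UNIV. 1 \<le> ennreal (Suc m) * ennreal (smooth k (q j) x)}"
    proof -
      have "1 \<le> ennreal (Suc m) * ennreal (smooth k (q j) x)" if "1 / real (Suc m) \<le> smooth k (q j) x" for x
      proof -
        have "1 \<le> real (Suc m) * smooth k (q j) x" using that by (simp add: field_simps)
        from ennreal_leI[OF this] show ?thesis
          unfolding ennreal_1 ennreal_mult[OF of_nat_0_le_iff smooth_nonneg] .
      qed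
      moreover have "{x \<in> UNIV. 1 \<le> ennreal (Suc m) * ennreal (smooth k (q j) x)} \<in> sets levy"
        unfolding sets_levy by (simp, intro Collect_in_sets_cyl) measurable
      ultimately show ?thesis
        unfolding emeasure_flow_measure[OF U] by (intro emeasure_mono) (auto simp: U_def enc kj)
    qed
    also have "\<dots> \<le> ennreal (Suc m) * (\<integral>\<^sup>+x. ennreal (smooth k (q j) x) * indicator UNIV x \<partial>levy)"
      by (rule nn_integral_Markov_inequality) (auto intro: sets.top[of levy, simplified])
    also have "\<dots> < \<infinity>" by (simp add: nn_integral_smooth ennreal_mult_less_top)
    finally show ?thesis by simp
  qed
  ultimately have fin: "\<forall>a\<in>?A. emeasure flow_measure a \<noteq> \<infinity>"
    using emeasure_flow_measure_zero by auto
  have "\<Union>?A = UNIV"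
  proof (intro set_eqI iffI UNIV_I)
    fix w :: real_seq
    show "w \<in> \<Union>?A"
    proof (cases "w = (\<lambda>_. 0)")
      case False
      then obtain n where n: "w n \<noteq> 0" by auto
      show ?thesis
      proof (cases "w n < 0")
        case False
        with n have "0 < w n" by simp
        then obtain m where "inverse (real (Suc m)) < w n" using reals_Archimedean by blast
        then have "w \<in> U n m" by (simp add: U_def inverse_eq_divide less_imp_le)
        then show ?thesis by (auto intro!: bexI[of _ "(n, m)"])
      qed auto
    qed simp
  qed
  moreover have "?A \<subseteq> sets flow_measure" using U N by auto
  moreover have "countable ?A" by auto
  ultimately show "\<exists>A. countable A \<and> A \<subseteq> sets flow_measure \<and> \<Union>A = space flow_measure
      \<and> (\<forall>a\<in>A. emeasure flow_measure a \<noteq> \<infinity>)"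
    using fin by (intro exI[of _ ?A]) simp
qed

end

section \<open>Poisson random measures and generating functions\<close>

lemma (in product_prob_space) nn_integral_PiM_prod:
  assumes J: "finite J" "J \<subseteq> I" and f: "\<And>i. i \<in> J \<Longrightarrow> f i \<in> borel_measurable (M i)"
  shows "(\<integral>\<^sup>+x. (\<Prod>i\<in>J. f i (x i)) \<partial>PiM I M) = (\<Prod>i\<in>J. \<integral>\<^sup>+x. f i x \<partial>M i)"
proof -
  have "(\<integral>\<^sup>+x. (\<Prod>i\<in>J. f i (x i)) \<partial>PiM I M) = (\<integral>\<^sup>+x. (\<Prod>i\<in>J. f i (restrict x J i)) \<partial>PiM I M)"
    by (simp cong: prod.cong)
  also have "\<dots> = (\<integral>\<^sup>+x. (\<Prod>i\<in>J. f i (x i)) \<partial>distr (PiM I M) (PiM J M) (\<lambda>x. restrict x J))"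
  proof (rule nn_integral_distr[symmetric])
    show "(\<lambda>x. restrict x J) \<in> PiM I M \<rightarrow>\<^sub>M PiM J M" by (rule measurable_restrict_subset[OF J(2)])
    show "(\<lambda>x. \<Prod>i\<in>J. f i (x i)) \<in> borel_measurable (distr (PiM I M) (PiM J M) (\<lambda>x. restrict x J))"
      using f by (auto intro!: borel_measurable_prod_ennreal measurable_compose[OF measurable_component_singleton])
  qed
  also have "\<dots> = (\<integral>\<^sup>+x. (\<Prod>i\<in>J. f i (x i)) \<partial>PiM J M)"
    by (simp only: distr_PiM_restrict_finite[OF J])
  also have "\<dots> = (\<Prod>i\<in>J. \<integral>\<^sup>+x. f i x \<partial>M i)"
    by (rule product_nn_integral_prod[OF J(1) f])
  finally show ?thesis .
qed

lemma poisson_pgf: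
  fixes r c :: real
  assumes r: "r > 0" and c: "0 \<le> c"
  shows "(\<integral>\<^sup>+n. ennreal (c ^ n) \<partial>measure_pmf (poisson_pmf r)) = ennreal (exp (- r * (1 - c)))"
proof -
  have "(\<lambda>n. (r * c) ^ n /\<^sub>R fact n) sums exp (r * c)" by (rule exp_converges)
  then have "(\<lambda>n. (r * c) ^ n /\<^sub>R fact n * exp (- r)) sums (exp (r * c) * exp (- r))" by (rule sums_mult2)
  moreover have "(r * c) ^ n /\<^sub>R fact n * exp (- r) = pmf (poisson_pmf r) n * c ^ n" for n
    using r by (simp add: power_mult_distrib divide_inverse mult_ac)
  moreover have "exp (r * c) * exp (- r) = exp (- r * (1 - c))"
    by (simp add: exp_add[symmetric] algebra_simps)
  ultimately have s: "(\<lambda>n. pmf (poisson_pmf r) n * c ^ n) sums exp (- r * (1 - c))" by simp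
  have "(\<integral>\<^sup>+n. ennreal (c ^ n) \<partial>measure_pmf (poisson_pmf r)) = (\<Sum>n. ennreal (pmf (poisson_pmf r) n * c ^ n))"
    using c by (simp add: nn_integral_measure_pmf nn_integral_count_space_nat ennreal_mult')
  also have "\<dots> = ennreal (exp (- r * (1 - c)))"
    using s c by (subst suminf_ennreal2) (auto simp: sums_iff)
  finally show ?thesis .
qed

lemma mark_prod_measurable:
  fixes M :: "'w measure" and g :: "'w \<Rightarrow> real"
  assumes g: "g \<in> borel_measurable M"
  shows "(\<lambda>z :: nat \<times> (nat \<Rightarrow> 'w). ennreal (\<Prod>i<fst z. g (snd z i))) \<in> borel_measurable (count_space UNIV \<Otimes>\<^sub>M PiM UNIV (\<lambda>_. M))"
proof (rule measurable_compose_countable[where g = "fst :: nat \<times> (nat \<Rightarrow> 'w) \<Rightarrow> nat" and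
      f = "\<lambda>n (z :: nat \<times> (nat \<Rightarrow> 'w)). ennreal (\<Prod>i<n. g (snd z i))"])
  fix n
  have [measurable]: "(\<lambda>z :: nat \<times> (nat \<Rightarrow> 'w). g (snd z i)) \<in> borel_measurable (count_space UNIV \<Otimes>\<^sub>M PiM UNIV (\<lambda>_. M))" for i :: nat
    using g by (intro measurable_compose[OF _ g] measurable_compose[OF measurable_snd]) simp
  show "(\<lambda>z :: nat \<times> (nat \<Rightarrow> 'w). ennreal (\<Prod>i<n. g (snd z i))) \<in> borel_measurable (count_space UNIV \<Otimes>\<^sub>M PiM UNIV (\<lambda>_. M))"
    by measurable
qed simp

text \<open>
  The process consists of \<open>fst z\<close> points, a Poisson number with mean the total mass of \<open>M\<close>, taken from the
  start of a sequence \<open>snd z\<close> of independent points with the normalized measure as law.  Given the number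
  \<open>n\<close> of points, the product of the values of \<open>g\<close> at the points has the mean of \<open>g\<close> to the power \<open>n\<close> as
  expectation, and the Poisson generating function gives the formula.
\<close>
lemma finite_poisson_process:
  fixes M :: "'w measure"
  assumes fin: "finite_measure M" and ne: "space M \<noteq> {}"
  shows "\<exists>V :: (nat \<times> (nat \<Rightarrow> 'w)) measure. prob_space V \<and>
    sets V = sets (count_space UNIV \<Otimes>\<^sub>M PiM UNIV (\<lambda>_. M)) \<and>
    (\<forall>g \<in> borel_measurable M. (\<forall>x. 0 \<le> g x \<and> g x \<le> 1) \<longrightarrow>
      (\<integral>\<^sup>+z. ennreal (\<Prod>i<fst z. g (snd z i)) \<partial>V) = ennreal (exp (- (\<integral>x. 1 - g x \<partial>M))))"
proof -
  interpret M: finite_measure M by fact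
  note g_meas = mark_prod_measurable[where M = M]
  define r where "r = measure M (space M)"
  show ?thesis
  proof (cases "r = 0")
    case True
    then have null: "emeasure M (space M) = 0" by (simp add: r_def M.emeasure_eq_measure)
    obtain x0 where x0: "x0 \<in> space M" using ne by blast
    let ?N = "count_space UNIV \<Otimes>\<^sub>M PiM UNIV (\<lambda>_. M) :: (nat \<times> (nat \<Rightarrow> 'w)) measure"
    let ?V = "return ?N (0, \<lambda>_. x0)"
    have sp: "(0, \<lambda>_. x0) \<in> space ?N" using x0 by (simp add: space_pair_measure space_PiM PiE_iff)
    have "(\<integral>\<^sup>+z. ennreal (\<Prod>i<fst z. g (snd z i)) \<partial>?V) = ennreal (exp (- (\<integral>x. 1 - g x \<partial>M)))"
      if g: "g \<in> borel_measurable M" for g :: "'w \<Rightarrow> real"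
    proof -
      have "AE x in M. 1 - g x = 0" using null by (intro AE_I[where N = "space M"]) auto
      then have "(\<integral>x. 1 - g x \<partial>M) = 0" by (rule integral_eq_zero_AE)
      then show ?thesis using g_meas[OF g] sp by (simp add: nn_integral_return)
    qed
    then show ?thesis using sp by (intro exI[of _ ?V]) (auto intro!: prob_space_return)
  next
    case False
    then have r: "r > 0" by (simp add: r_def zero_less_measure_iff less_le)
    define D where "D = scale_measure (ennreal (1 / r)) M"
    have sets_D [measurable_cong]: "sets D = sets M" by (simp add: D_def)
    have "prob_space D"
    proof
      have "emeasure D (space D) = ennreal (1 / r) * ennreal r"
        by (simp add: D_def r_def M.emeasure_eq_measure space_scale_measure)
      also have "\<dots> = 1" using r by (simp add: ennreal_mult[symmetric])
      finally show "emeasure D (space D) = 1" .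
    qed
    then interpret D: prob_space D .
    interpret prod: product_prob_space "\<lambda>_. D" "UNIV :: nat set" ..
    define V where "V = measure_pmf (poisson_pmf r) \<Otimes>\<^sub>M PiM UNIV (\<lambda>_::nat. D)"
    have "sigma_finite_measure (PiM UNIV (\<lambda>_::nat. D))"
      by (intro prob_space_imp_sigma_finite prob_space_PiM D.prob_space_axioms)
    note nn_integral_fst = sigma_finite_measure.nn_integral_fst[OF this]
    interpret pair: pair_prob_space "measure_pmf (poisson_pmf r)" "PiM UNIV (\<lambda>_::nat. D)" ..
    have sets_V: "sets V = sets (count_space UNIV \<Otimes>\<^sub>M PiM UNIV (\<lambda>_. M))"
      unfolding V_def by (intro sets_pair_measure_cong sets_PiM_cong) (auto simp: sets_D)
    have "(\<integral>\<^sup>+z. ennreal (\<Prod>i<fst z. g (snd z i)) \<partial>V) = ennreal (exp (- (\<integral>x. 1 - g x \<partial>M)))"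
      if g: "g \<in> borel_measurable M" and b: "\<forall>x. 0 \<le> g x \<and> g x \<le> 1" for g :: "'w \<Rightarrow> real"
    proof -
      have gi: "integrable M g" using g b by (intro M.integrable_const_bound[where B = 1]) auto
      have gD: "g \<in> borel_measurable D" using g by simp
      define c where "c = (\<integral>x. g x \<partial>M) / r"
      have c0: "0 \<le> c" using r b by (auto simp: c_def intro!: divide_nonneg_pos Bochner_Integration.integral_nonneg)
      have gc: "(\<integral>\<^sup>+x. ennreal (g x) \<partial>D) = ennreal c"
      proof -
        have "(\<integral>\<^sup>+x. ennreal (g x) \<partial>D) = ennreal (1 / r) * (\<integral>\<^sup>+x. ennreal (g x) \<partial>M)"
          unfolding D_def using g by (subst nn_integral_scale_measure) auto
        also have "(\<integral>\<^sup>+x. ennreal (g x) \<partial>M) = ennreal (\<integral>x. g x \<partial>M)"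
          using gi b by (intro nn_integral_eq_integral) auto
        finally show ?thesis using r by (simp add: c_def ennreal_mult'[symmetric])
      qed
      have m: "(\<lambda>z. ennreal (\<Prod>i<fst z. g (snd z i))) \<in> borel_measurable V"
        using g_meas[OF g] sets_V by (simp cong: measurable_cong_sets)
      have "(\<integral>\<^sup>+z. ennreal (\<Prod>i<fst z. g (snd z i)) \<partial>V)
        = (\<integral>\<^sup>+n. (\<integral>\<^sup>+y. ennreal (\<Prod>i<n. g (y i)) \<partial>PiM UNIV (\<lambda>_::nat. D)) \<partial>measure_pmf (poisson_pmf r))"
        using nn_integral_fst[OF m[unfolded V_def]] by (simp add: V_def)
      also have "\<dots> = (\<integral>\<^sup>+n. ennreal (c ^ n) \<partial>measure_pmf (poisson_pmf r))"
      proof (rule nn_integral_cong)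
        fix n :: nat
        have "(\<integral>\<^sup>+y. ennreal (\<Prod>i<n. g (y i)) \<partial>PiM UNIV (\<lambda>_::nat. D))
          = (\<integral>\<^sup>+y. (\<Prod>i\<in>{..<n}. ennreal (g (y i))) \<partial>PiM UNIV (\<lambda>_::nat. D))"
          using b by (simp add: prod_ennreal)
        also have "\<dots> = (\<Prod>i<n. \<integral>\<^sup>+x. ennreal (g x) \<partial>D)"
          using gD by (intro prod.nn_integral_PiM_prod) auto
        also have "\<dots> = ennreal (c ^ n)" using c0 by (simp add: gc ennreal_power)
        finally show "(\<integral>\<^sup>+y. ennreal (\<Prod>i<n. g (y i)) \<partial>PiM UNIV (\<lambda>_::nat. D)) = ennreal (c ^ n)" .
      qed
      also have "\<dots> = ennreal (exp (- r * (1 - c)))" by (rule poisson_pgf[OF r c0])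
      also have "- r * (1 - c) = - (\<integral>x. 1 - g x \<partial>M)"
        using gi r by (simp add: c_def r_def field_simps)
      finally show ?thesis .
    qed
    moreover have "prob_space V" unfolding V_def by (rule pair.prob_space_axioms)
    ultimately show ?thesis using sets_V by (intro exI[of _ V]) blast
  qed
qed

text \<open>
  The power \<open>s\<close> to the exponent \<open>N\<close>, extended to \<open>N = \<top>\<close> by its limit for \<open>0 \<le> s < 1\<close>.  In this way the
  generating function also records the probability of an infinite count, as the mass missing at \<open>s\<close>
  near \<open>1\<close>.
\<close>
definition pgf_power :: "real \<Rightarrow> ennreal \<Rightarrow> real"
  where "pgf_power s N = (if N = \<top> then 0 else s ^ nat \<lfloor>enn2real N\<rfloor>)"

lemma pgf_power_of_nat [simp]: "pgf_power s (of_nat k) = s ^ k"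
  by (simp add: pgf_power_def)

lemma pgf_power_bounds: "0 \<le> s \<Longrightarrow> s < 1 \<Longrightarrow> 0 \<le> pgf_power s N \<and> pgf_power s N \<le> 1"
  by (simp add: pgf_power_def power_le_one)

lemma pgf_power_measurable [measurable]: "pgf_power s \<in> borel_measurable borel"
  unfolding pgf_power_def by measurable

lemma pgf_power_LIMSEQ:
  fixes c :: "nat \<Rightarrow> nat"
  assumes s: "0 \<le> s" "s < 1"
  shows "(\<lambda>M. s ^ (\<Sum>m<M. c m)) \<longlonglongrightarrow> pgf_power s (\<Sum>m. of_nat (c m))"
    and "(\<Sum>m. of_nat (c m)) = (\<top> :: ennreal) \<or> (\<exists>k. (\<Sum>m. of_nat (c m)) = (of_nat k :: ennreal))"
proof -
  have lim: "(\<lambda>M. of_nat (\<Sum>m<M. c m) :: ennreal) \<longlonglongrightarrow> (\<Sum>m. of_nat (c m))"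
    using summable_LIMSEQ[of "\<lambda>m. of_nat (c m) :: ennreal"] by simp
  have "(\<lambda>M. s ^ (\<Sum>m<M. c m)) \<longlonglongrightarrow> pgf_power s (\<Sum>m. of_nat (c m)) \<and>
    ((\<Sum>m. of_nat (c m)) = (\<top> :: ennreal) \<or> (\<exists>k. (\<Sum>m. of_nat (c m)) = (of_nat k :: ennreal)))"
  proof (cases "finite {m. c m \<noteq> 0}")
    case True
    then obtain b where b: "\<And>m. c m \<noteq> 0 \<Longrightarrow> m < b"
      unfolding finite_nat_set_iff_bounded by auto
    have e: "(\<Sum>m<M. c m) = (\<Sum>m<b. c m)" if "M \<ge> b" for M
    proof (rule sum.mono_neutral_right)
      show "\<forall>m\<in>{..<M} - {..<b}. c m = 0" using b by (meson DiffD2 lessThan_iff)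
    qed (use that in auto)
    have "(\<Sum>m. of_nat (c m)) = (of_nat (\<Sum>m<b. c m) :: ennreal)"
    proof -
      have "(of_nat (c m) :: ennreal) = 0" if "m \<notin> {..<b}" for m
        using b[of m] that by (cases "c m = 0") auto
      then have "(\<Sum>m. of_nat (c m)) = (\<Sum>m\<in>{..<b}. (of_nat (c m) :: ennreal))"
        by (intro suminf_finite) simp_all
      then show ?thesis by simp
    qed
    moreover have "(\<lambda>M. s ^ (\<Sum>m<M. c m)) \<longlonglongrightarrow> s ^ (\<Sum>m<b. c m)"
      by (intro tendsto_eventually eventually_sequentiallyI[of b] arg_cong[of _ _ "power s"] e)
    ultimately show ?thesis by (metis pgf_power_of_nat)
  next
    case False
    have big: "filterlim (\<lambda>M. \<Sum>m<M. c m) at_top sequentially"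
    proof (rule filterlim_at_top[THEN iffD2], rule allI)
      fix Z
      obtain T where T: "T \<subseteq> {m. c m \<noteq> 0}" "finite T" "card T = Z"
        using infinite_arbitrarily_large[OF False] by blast
      then obtain b where b: "\<And>m. m \<in> T \<Longrightarrow> m < b" unfolding finite_nat_set_iff_bounded by blast
      have "Z \<le> (\<Sum>m<M. c m)" if "M \<ge> b" for M
      proof -
        have "Z = (\<Sum>m\<in>T. 1)" using T by simp
        also have "\<dots> \<le> (\<Sum>m\<in>T. c m)" using T by (intro sum_mono) auto
        also have "\<dots> \<le> (\<Sum>m<M. c m)" using T b that by (intro sum_mono2) (auto intro: less_le_trans)
        finally show ?thesis .
      qed
      then show "\<forall>\<^sub>F M in sequentially. Z \<le> (\<Sum>m<M. c m)" by (rule eventually_sequentiallyI)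
    qed
    have "(\<lambda>k. s ^ k) \<longlonglongrightarrow> 0" using s by (intro LIMSEQ_power_zero) auto
    from filterlim_compose[OF this big] have "(\<lambda>M. s ^ (\<Sum>m<M. c m)) \<longlonglongrightarrow> 0" .
    moreover have "(\<Sum>m. of_nat (c m)) = (\<top> :: ennreal)"
    proof (rule ccontr)
      assume n: "(\<Sum>m. of_nat (c m)) \<noteq> (\<top> :: ennreal)"
      obtain k where k: "(\<Sum>m. of_nat (c m)) < (of_nat k :: ennreal)"
        using ennreal_Ex_less_of_nat n by (metis top.not_eq_extremum)
      obtain M where "k \<le> (\<Sum>m<M. c m)"
        using big unfolding filterlim_at_top by (meson eventually_sequentially order_refl)
      then have "(of_nat k :: ennreal) \<le> of_nat (\<Sum>m<M. c m)" by (rule of_nat_mono)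
      also have "\<dots> \<le> (\<Sum>m. of_nat (c m))"
        using sum_le_suminf[of "\<lambda>m. of_nat (c m) :: ennreal" "{..<M}"] by simp
      finally show False using k by simp
    qed
    ultimately show ?thesis by (simp add: pgf_power_def)
  qed
  then show "(\<lambda>M. s ^ (\<Sum>m<M. c m)) \<longlonglongrightarrow> pgf_power s (\<Sum>m. of_nat (c m))"
    and "(\<Sum>m. of_nat (c m)) = (\<top> :: ennreal) \<or> (\<exists>k. (\<Sum>m. of_nat (c m)) = (of_nat k :: ennreal))" by auto
qed

text \<open>
  All lower coefficients vanish by induction; divided by \<open>s ^ n\<close>, the series tends to \<open>a n\<close> as
  \<open>s\<close> decreases to \<open>0\<close>.
\<close>
lemma powser_eq_zero_coeff:
  fixes a :: "nat \<Rightarrow> real"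
  assumes bd: "\<And>k. \<bar>a k\<bar> \<le> C" and z: "\<And>s. 0 \<le> s \<Longrightarrow> s < 1 \<Longrightarrow> (\<lambda>k. a k * s ^ k) sums 0"
  shows "a k = 0"
proof (induction k rule: less_induct)
  case (less n)
  have "summable (\<lambda>k. a (k + n) * x ^ k)" if "norm x < 1" for x :: real
  proof (rule summable_comparison_test')
    show "summable (\<lambda>k. C * \<bar>x\<bar> ^ k)" using that by (intro summable_mult summable_geometric) simp
    show "norm (a (k + n) * x ^ k) \<le> C * \<bar>x\<bar> ^ k" for k
      using bd[of "k + n"] by (simp add: abs_mult power_abs mult_right_mono)
  qed
  then have sm: "(\<lambda>k. a (k + n) * x ^ k) sums (\<Sum>k. a (k + n) * x ^ k)" if "norm x < 1" for x :: real
    using that by (simp add: summable_sums)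
  have "((\<lambda>x. \<Sum>k. a (k + n) * x ^ k) \<longlongrightarrow> a (0 + n)) (at 0)"
    by (rule powser_limit_0[where a = "\<lambda>k. a (k + n)" and s = 1]) (use sm in auto)
  then have "((\<lambda>x. \<Sum>k. a (k + n) * x ^ k) \<longlongrightarrow> a n) (at_right 0)"
    by (simp add: filterlim_at_split)
  moreover have "\<forall>\<^sub>F x in at_right 0. (\<Sum>k. a (k + n) * x ^ k) = 0"
  proof -
    have "(\<Sum>k. a (k + n) * x ^ k) = 0" if x: "0 < x" "x < 1" for x
    proof -
      have "(\<lambda>k. a (k + n) * x ^ (k + n)) sums (0 - (\<Sum>k<n. a k * x ^ k))"
        using z[of x] x by (intro sums_split_initial_segment) auto
      then have "(\<lambda>k. a (k + n) * x ^ (k + n)) sums 0" using less by simp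
      then have "(\<lambda>k. a (k + n) * x ^ (k + n) / x ^ n) sums (0 / x ^ n)" by (rule sums_divide)
      moreover have "a (k + n) * x ^ (k + n) / x ^ n = a (k + n) * x ^ k" for k
        using x by (simp add: power_add)
      ultimately have "(\<lambda>k. a (k + n) * x ^ k) sums 0" by simp
      then show ?thesis by (rule sums_unique[symmetric])
    qed
    then show ?thesis by (intro eventually_at_rightI[of 0 1]) auto
  qed
  ultimately have "((\<lambda>x. 0 :: real) \<longlongrightarrow> a n) (at_right (0 :: real))"
    by (rule Lim_transform_eventually)
  then show "a n = 0"
    by (rule tendsto_unique[OF trivial_limit_at_right_real _ tendsto_const])
qed

lemma pgf_power_sums:
  assumes "N = \<top> \<or> (\<exists>k. N = of_nat k)"
  shows "(\<lambda>k. s ^ k * of_bool (N = of_nat k)) sums pgf_power s N"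
  using assms
proof (elim disjE exE)
  fix n assume N: "N = of_nat n"
  have "(\<lambda>k. if k = n then s ^ k else 0) sums (s ^ n)" by (rule sums_single)
  moreover have "(\<lambda>k. if k = n then s ^ k else 0) = (\<lambda>k. s ^ k * of_bool (N = of_nat k))"
    by (auto simp: N fun_eq_iff)
  ultimately show ?thesis by (simp add: N)
qed (simp add: pgf_power_def)

context prob_space
begin

lemma expectation_pgf_power_sums:
  fixes X :: "'a \<Rightarrow> ennreal" and Y :: "'a \<Rightarrow> real"
  assumes [measurable]: "X \<in> borel_measurable M" "Y \<in> borel_measurable M"
    and Y: "\<And>\<omega>. 0 \<le> Y \<omega> \<and> Y \<omega> \<le> 1"
    and X: "\<And>\<omega>. \<omega> \<in> space M \<Longrightarrow> X \<omega> = \<top> \<or> (\<exists>k. X \<omega> = of_nat k)"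
    and s: "0 \<le> s" "s < 1"
  shows "(\<lambda>k. expectation (\<lambda>\<omega>. Y \<omega> * of_bool (X \<omega> = of_nat k)) * s ^ k)
    sums expectation (\<lambda>\<omega>. Y \<omega> * pgf_power s (X \<omega>))"
proof -
  let ?f = "\<lambda>k \<omega>. Y \<omega> * of_bool (X \<omega> = of_nat k) * s ^ k"
  have b: "norm (?f k \<omega>) \<le> s ^ k" for k \<omega>
    using Y[of \<omega>] s by (auto intro: mult_left_le_one_le)
  have sum_s: "summable (\<lambda>k. s ^ k)" using s by (simp add: summable_geometric)
  have i: "integrable M (?f k)" for k
    by (rule integrable_const_bound[where B = "s ^ k"]) (use b in auto)
  have "(\<lambda>k. expectation (?f k)) sums expectation (\<lambda>\<omega>. \<Sum>k. ?f k \<omega>)"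
  proof (rule sums_integral[OF i])
    show "AE \<omega> in M. summable (\<lambda>k. norm (?f k \<omega>))"
      using b by (intro AE_I2 summable_comparison_test'[OF sum_s]) auto
    have "norm (expectation (\<lambda>\<omega>. norm (?f k \<omega>))) \<le> s ^ k" for k
    proof -
      have "expectation (\<lambda>\<omega>. norm (?f k \<omega>)) \<le> expectation (\<lambda>_. s ^ k)"
        using i b by (intro integral_mono integrable_norm) auto
      moreover have "0 \<le> expectation (\<lambda>\<omega>. norm (?f k \<omega>))"
        by (intro Bochner_Integration.integral_nonneg) auto
      ultimately show ?thesis by (simp add: prob_space)
    qed
    then show "summable (\<lambda>k. expectation (\<lambda>\<omega>. norm (?f k \<omega>)))"
      by (intro summable_comparison_test'[OF sum_s])
  qed
  moreover have "expectation (\<lambda>\<omega>. \<Sum>k. ?f k \<omega>) = expectation (\<lambda>\<omega>. Y \<omega> * pgf_power s (X \<omega>))"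
  proof (rule Bochner_Integration.integral_cong[OF refl])
    fix \<omega> assume "\<omega> \<in> space M"
    from sums_mult[OF pgf_power_sums[OF X[OF this], of s], of "Y \<omega>"]
    show "(\<Sum>k. ?f k \<omega>) = Y \<omega> * pgf_power s (X \<omega>)"
      by (simp add: sums_iff mult_ac)
  qed
  ultimately show ?thesis by simp
qed

lemma prob_eq_of_pgf:
  fixes X :: "'a \<Rightarrow> ennreal" and p :: "nat \<Rightarrow> real"
  assumes [measurable]: "X \<in> borel_measurable M"
    and X: "\<And>\<omega>. \<omega> \<in> space M \<Longrightarrow> X \<omega> = \<top> \<or> (\<exists>k. X \<omega> = of_nat k)"
    and p: "\<And>k. \<bar>p k\<bar> \<le> C"
    and pgf: "\<And>s. 0 \<le> s \<Longrightarrow> s < 1 \<Longrightarrow> (\<lambda>k. p k * s ^ k) sums expectation (\<lambda>\<omega>. Y \<omega> * pgf_power s (X \<omega>))"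
    and [measurable]: "Y \<in> borel_measurable M" and Y: "\<And>\<omega>. 0 \<le> Y \<omega> \<and> Y \<omega> \<le> (1 :: real)"
  shows "expectation (\<lambda>\<omega>. Y \<omega> * of_bool (X \<omega> = of_nat k)) = p k"
proof -
  let ?e = "\<lambda>k. expectation (\<lambda>\<omega>. Y \<omega> * of_bool (X \<omega> = of_nat k))"
  have "?e k - p k = 0" for k
  proof (rule powser_eq_zero_coeff[where C = "1 + C" and a = "\<lambda>k. ?e k - p k"])
    fix k
    have "\<bar>?e k\<bar> \<le> expectation (\<lambda>_. 1)"
      using Y by (intro order_trans[OF integral_abs_bound] integral_mono integrable_const_bound[where B = 1])
        (auto intro: mult_left_le_one_le)
    then show "\<bar>?e k - p k\<bar> \<le> 1 + C" using p[of k] by (simp add: prob_space)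
  next
    fix s :: real assume s: "0 \<le> s" "s < 1"
    from sums_diff[OF expectation_pgf_power_sums[OF assms(1) assms(5) Y X s] pgf[OF s]]
    show "(\<lambda>k. (?e k - p k) * s ^ k) sums 0" by (simp add: left_diff_distrib)
  qed
  then show ?thesis by simp
qed

text \<open>
  The joint generating function is converted into joint probabilities one variable at a time: the
  variables in \<open>K\<close> have been converted, those in \<open>L\<close> have not, and one conversion compares the
  coefficients of two power series.
\<close>
lemma prob_joint_of_pgf:
  fixes X :: "'i \<Rightarrow> 'a \<Rightarrow> ennreal"
  assumes J: "finite J" and X [measurable]: "\<And>j. j \<in> J \<Longrightarrow> X j \<in> borel_measurable M"
    and vals: "\<And>j \<omega>. j \<in> J \<Longrightarrow> \<omega> \<in> space M \<Longrightarrow> X j \<omega> = \<top> \<or> (\<exists>k. X j \<omega> = of_nat k)"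
    and pgf: "\<And>K s. K \<subseteq> J \<Longrightarrow> (\<And>j. j \<in> K \<Longrightarrow> 0 \<le> s j \<and> s j < 1) \<Longrightarrow>
      expectation (\<lambda>\<omega>. \<Prod>j\<in>K. pgf_power (s j) (X j \<omega>)) = (\<Prod>j\<in>K. \<psi> j (s j))"
  shows "prob {\<omega> \<in> space M. \<forall>j\<in>J. X j \<omega> = of_nat (k j)} = (\<Prod>j\<in>J. prob {\<omega> \<in> space M. X j \<omega> = of_nat (k j)})"
proof -
  let ?p = "\<lambda>j n. expectation (\<lambda>\<omega>. of_bool (X j \<omega> = of_nat n) :: real)"
  let ?i = "\<lambda>K \<omega>. \<Prod>j\<in>K. of_bool (X j \<omega> = of_nat (k j)) :: real"
  let ?z = "\<lambda>K s \<omega>. \<Prod>j\<in>K. pgf_power (s j) (X j \<omega>)"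
  have p: "(\<lambda>n. ?p j n * s ^ n) sums \<psi> j s" if j: "j \<in> J" and s: "0 \<le> s" "s < 1" for j s
  proof -
    have "(\<lambda>n. ?p j n * s ^ n) sums expectation (\<lambda>\<omega>. pgf_power s (X j \<omega>))"
      using expectation_pgf_power_sums[of "X j" "\<lambda>_. 1" s] X[OF j] vals[OF j] s by simp
    also have "expectation (\<lambda>\<omega>. pgf_power s (X j \<omega>)) = \<psi> j s"
      using pgf[of "{j}" "\<lambda>_. s"] j s by simp
    finally show ?thesis .
  qed
  have "\<forall>L s. K \<inter> L = {} \<longrightarrow> K \<union> L \<subseteq> J \<longrightarrow> (\<forall>j\<in>L. 0 \<le> s j \<and> s j < 1) \<longrightarrow>
    expectation (\<lambda>\<omega>. ?i K \<omega> * ?z L s \<omega>) = (\<Prod>j\<in>K. ?p j (k j)) * (\<Prod>j\<in>L. \<psi> j (s j))" if "finite K" for K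
    using that
  proof (induction K rule: finite_induct)
    case empty
    then show ?case using pgf by simp
  next
    case (insert a K)
    show ?case
    proof (intro allI impI)
      fix L s
      assume KL: "insert a K \<inter> L = {}" "insert a K \<union> L \<subseteq> J" and s: "\<forall>j\<in>L. 0 \<le> s j \<and> s j < (1::real)"
      have a: "a \<in> J" "a \<notin> L" using KL by auto
      have finL: "finite L" using KL(2) J finite_subset by auto
      \<comment> \<open>\<open>Y\<close> collects all factors except the one of the variable \<open>a\<close> being converted.\<close>
      define Y where "Y \<omega> = ?i K \<omega> * ?z L s \<omega>" for \<omega>
      define C where "C = (\<Prod>j\<in>K. ?p j (k j)) * (\<Prod>j\<in>L. \<psi> j (s j))"
      have [measurable]: "Y \<in> borel_measurable M"
      proof -
        have "(\<lambda>\<omega>. of_bool (X j \<omega> = of_nat (k j)) :: real) \<in> borel_measurable M" if "j \<in> K" for j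
        proof -
          have [measurable]: "X j \<in> borel_measurable M" using that KL by (intro X) auto
          show ?thesis by measurable
        qed
        moreover have "(\<lambda>\<omega>. pgf_power (s j) (X j \<omega>)) \<in> borel_measurable M" if "j \<in> L" for j
          using that KL by (intro measurable_compose[OF _ pgf_power_measurable] X) auto
        ultimately show ?thesis unfolding Y_def by (intro borel_measurable_times borel_measurable_prod)
      qed
      have Y: "0 \<le> Y \<omega> \<and> Y \<omega> \<le> 1" for \<omega>
      proof -
        have "0 \<le> ?i K \<omega> \<and> ?i K \<omega> \<le> 1" by (auto intro: prod_nonneg prod_le_1)
        moreover have "0 \<le> ?z L s \<omega> \<and> ?z L s \<omega> \<le> 1"
          using pgf_power_bounds s by (auto intro!: prod_nonneg prod_le_1)
        ultimately show ?thesis unfolding Y_def by (auto intro: mult_le_one)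
      qed
      have "expectation (\<lambda>\<omega>. Y \<omega> * of_bool (X a \<omega> = of_nat (k a))) = C * ?p a (k a)"
      proof (rule prob_eq_of_pgf[OF X[OF a(1)] vals[OF a(1)]])
        show "\<bar>C * ?p a n\<bar> \<le> \<bar>C\<bar>" for n
        proof -
          have "\<bar>?p a n\<bar> \<le> expectation (\<lambda>_. 1)"
            using X[OF a(1)]
            by (intro order_trans[OF integral_abs_bound] integral_mono integrable_const_bound[where B = 1]) auto
          then show ?thesis by (simp add: abs_mult prob_space mult_left_le)
        qed
        fix u :: real assume u: "0 \<le> u" "u < 1"
        have IH: "expectation (\<lambda>\<omega>. ?i K \<omega> * ?z (insert a L) (s(a := u)) \<omega>)
          = (\<Prod>j\<in>K. ?p j (k j)) * (\<Prod>j\<in>insert a L. \<psi> j ((s(a := u)) j))"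
          using KL s u insert.hyps by (intro insert.IH[rule_format]) auto
        have \<psi>: "(\<Prod>j\<in>insert a L. \<psi> j ((s(a := u)) j)) = \<psi> a u * (\<Prod>j\<in>L. \<psi> j (s j))"
        proof -
          have "(\<Prod>j\<in>L. \<psi> j ((s(a := u)) j)) = (\<Prod>j\<in>L. \<psi> j (s j))"
            by (rule prod.cong) (use a in auto)
          then show ?thesis using finL a by simp
        qed
        have z: "?z (insert a L) (s(a := u)) \<omega> = pgf_power u (X a \<omega>) * ?z L s \<omega>" for \<omega>
        proof -
          have "(\<Prod>j\<in>L. pgf_power ((s(a := u)) j) (X j \<omega>)) = ?z L s \<omega>"
            by (rule prod.cong) (use a in auto)
          then show ?thesis using finL a by simp
        qed
        from IH have "expectation (\<lambda>\<omega>. Y \<omega> * pgf_power u (X a \<omega>)) = C * \<psi> a u"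
          unfolding z \<psi> by (simp add: Y_def C_def mult_ac)
        with sums_mult[OF p[OF a(1) u], of C]
        show "(\<lambda>n. C * ?p a n * u ^ n) sums expectation (\<lambda>\<omega>. Y \<omega> * pgf_power u (X a \<omega>))"
          by (simp add: mult_ac)
      qed (use Y in auto)
      then show "expectation (\<lambda>\<omega>. ?i (insert a K) \<omega> * ?z L s \<omega>)
        = (\<Prod>j\<in>insert a K. ?p j (k j)) * (\<Prod>j\<in>L. \<psi> j (s j))"
        using insert.hyps by (simp add: Y_def C_def mult_ac)
    qed
  qed
  from this[OF J, rule_format, of "{}"]
  have e: "expectation (?i J) = (\<Prod>j\<in>J. ?p j (k j))" by simp
  have "?p j n = prob {\<omega> \<in> space M. X j \<omega> = of_nat n}" if "j \<in> J" for j n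
  proof -
    have "?p j n = expectation (indicator {\<omega> \<in> space M. X j \<omega> = of_nat n})"
      by (intro Bochner_Integration.integral_cong) (auto simp: indicator_def)
    also have "\<dots> = prob {\<omega> \<in> space M. X j \<omega> = of_nat n}"
      by (simp add: Int_absorb2)
    finally show ?thesis .
  qed
  moreover have "expectation (?i J) = prob {\<omega> \<in> space M. \<forall>j\<in>J. X j \<omega> = of_nat (k j)}"
  proof -
    have "?i J \<omega> = of_bool (\<forall>j\<in>J. X j \<omega> = of_nat (k j))" for \<omega>
      using J by (induction J rule: finite_induct) auto
    then have "expectation (?i J) = expectation (indicator {\<omega> \<in> space M. \<forall>j\<in>J. X j \<omega> = of_nat (k j)})"
      by (intro Bochner_Integration.integral_cong) (auto simp: indicator_def)
    also have "\<dots> = prob {\<omega> \<in> space M. \<forall>j\<in>J. X j \<omega> = of_nat (k j)}"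
    proof -
      have "{\<omega> \<in> space M. \<forall>j\<in>J. X j \<omega> = of_nat (k j)} \<in> events"
      proof -
        have "Measurable.pred M (\<lambda>\<omega>. \<forall>j\<in>J. X j \<omega> = of_nat (k j))"
        proof (intro pred_intros_finite J)
          fix j assume "j \<in> J"
          note [measurable] = X[OF this]
          show "Measurable.pred M (\<lambda>\<omega>. X j \<omega> = of_nat (k j))" by measurable
        qed
        then show ?thesis by (simp add: pred_def)
      qed
      then show ?thesis by (simp add: Int_absorb2)
    qed
    finally show ?thesis .
  qed
  ultimately show ?thesis using e by simp
qed

text \<open>
  For variables that are natural numbers or \<open>\<top>\<close>, the events of having a given finite value, together with
  the empty event, are closed under intersection and generate all events.
\<close>
lemma indep_vars_of_prob_joint:
  fixes X :: "'i \<Rightarrow> 'a \<Rightarrow> ennreal"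
  assumes X: "\<And>j. j \<in> I \<Longrightarrow> X j \<in> borel_measurable M"
    and vals: "\<And>j \<omega>. j \<in> I \<Longrightarrow> \<omega> \<in> space M \<Longrightarrow> X j \<omega> = \<top> \<or> (\<exists>k. X j \<omega> = of_nat k)"
    and joint: "\<And>J k. J \<subseteq> I \<Longrightarrow> finite J \<Longrightarrow> prob {\<omega> \<in> space M. \<forall>j\<in>J. X j \<omega> = of_nat (k j)}
      = (\<Prod>j\<in>J. prob {\<omega> \<in> space M. X j \<omega> = of_nat (k j)})"
  shows "indep_vars (\<lambda>_. borel) X I"
proof -
  define G where "G j = insert {} (range (\<lambda>k. {\<omega> \<in> space M. X j \<omega> = of_nat k}))" for j
  have G_sets: "G j \<subseteq> events" if "j \<in> I" for j
    using X[OF that] unfolding G_def by auto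
  have "indep_sets G I"
  proof (rule indep_setsI)
    fix A J assume J: "J \<noteq> {}" "J \<subseteq> I" "finite J" and A: "\<forall>j\<in>J. A j \<in> G j"
    show "prob (\<Inter>j\<in>J. A j) = (\<Prod>j\<in>J. prob (A j))"
    proof (cases "\<exists>j\<in>J. A j = {}")
      case True
      then have "(\<Inter>j\<in>J. A j) = {}" by auto
      moreover have "\<exists>j\<in>J. prob (A j) = 0" using True by (metis measure_empty)
      then have "(\<Prod>j\<in>J. prob (A j)) = 0" by (rule prod_zero[OF J(3)])
      ultimately show ?thesis by simp
    next
      case False
      then have "\<forall>j\<in>J. \<exists>k. A j = {\<omega> \<in> space M. X j \<omega> = of_nat k}" using A by (auto simp: G_def image_iff)
      then obtain k where k: "\<And>j. j \<in> J \<Longrightarrow> A j = {\<omega> \<in> space M. X j \<omega> = of_nat (k j)}" by metis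
      have "(\<Inter>j\<in>J. A j) = {\<omega> \<in> space M. \<forall>j\<in>J. X j \<omega> = of_nat (k j)}" using k J(1) by auto
      then show ?thesis using joint[OF J(2,3), of k] k by simp
    qed
  qed (rule G_sets)
  then have "indep_sets (\<lambda>j. sigma_sets (space M) (G j)) I"
  proof (rule indep_sets_sigma)
    fix j
    show "Int_stable (G j)"
    proof (rule Int_stableI)
      fix a b assume "a \<in> G j" "b \<in> G j"
      then consider "a = {} \<or> b = {}"
        | k l where "a = {\<omega> \<in> space M. X j \<omega> = of_nat k}" "b = {\<omega> \<in> space M. X j \<omega> = of_nat l}"
        unfolding G_def by auto
      then show "a \<inter> b \<in> G j"
      proof cases
        case (2 k l)
        then have "a \<inter> b = (if k = l then a else {})" by auto
        then show ?thesis using \<open>a \<in> G j\<close> by (simp add: G_def)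
      qed (auto simp: G_def)
    qed
  qed
  then have "indep_sets (\<lambda>j. {X j -` A \<inter> space M |A. A \<in> sets borel}) I"
  proof (rule indep_sets_mono_sets)
    fix j assume j: "j \<in> I"
    interpret S: sigma_algebra "space M" "sigma_sets (space M) (G j)"
      by (rule sigma_algebra_sigma_sets) (use G_sets[OF j] sets.sets_into_space in blast)
    have k: "{\<omega> \<in> space M. X j \<omega> = of_nat k} \<in> sigma_sets (space M) (G j)" for k
      by (rule sigma_sets.Basic) (simp add: G_def)
    show "{X j -` A \<inter> space M |A. A \<in> sets borel} \<subseteq> sigma_sets (space M) (G j)"
    proof safe
      fix A :: "ennreal set"
      have "X j -` A \<inter> space M = (\<Union>k\<in>{k. of_nat k \<in> A}. {\<omega> \<in> space M. X j \<omega> = of_nat k})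
        \<union> (if \<top> \<in> A then space M - (\<Union>k. {\<omega> \<in> space M. X j \<omega> = of_nat k}) else {})"
        (is "?L = ?R")
      proof (rule set_eqI)
        fix \<omega>
        show "\<omega> \<in> ?L \<longleftrightarrow> \<omega> \<in> ?R"
          using vals[OF j, of \<omega>] by (cases "\<omega> \<in> space M") auto
      qed
      also have "\<dots> \<in> sigma_sets (space M) (G j)"
        using k by (intro S.Un S.countable_UN' ) (auto intro!: S.Diff S.countable_UN S.top)
      finally show "X j -` A \<inter> space M \<in> sigma_sets (space M) (G j)" .
    qed
  qed
  with X show ?thesis by (simp add: indep_vars_def2)
qed

end

text \<open>
  The generating function of the Poisson distribution with mean \<open>L\<close>; for \<open>L = \<top>\<close> the count is infinite.
\<close>
definition poisson_pgf_at :: "real \<Rightarrow> ennreal \<Rightarrow> real"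
  where "poisson_pgf_at s L = (if L = \<top> then 0 else exp (- (1 - s) * enn2real L))"

lemma poisson_random_measure_of_pgf:
  assumes P: "prob_space P"
    and sets: "\<And>p. p \<in> space P \<Longrightarrow> sets (\<Phi> p) = sets \<mu>"
    and meas: "\<And>B. B \<in> sets \<mu> \<Longrightarrow> (\<lambda>p. emeasure (\<Phi> p) B) \<in> borel_measurable P"
    and vals: "\<And>p B. p \<in> space P \<Longrightarrow> B \<in> sets \<mu> \<Longrightarrow> emeasure (\<Phi> p) B = \<top> \<or> (\<exists>k. emeasure (\<Phi> p) B = of_nat k)"
    and pgf: "\<And>(J :: nat set) B s. finite J \<Longrightarrow> (\<And>j. j \<in> J \<Longrightarrow> B j \<in> sets \<mu>) \<Longrightarrow> disjoint_family_on B J \<Longrightarrow>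
      (\<And>j. j \<in> J \<Longrightarrow> 0 \<le> s j \<and> s j < 1) \<Longrightarrow>
      (\<integral>p. (\<Prod>j\<in>J. pgf_power (s j) (emeasure (\<Phi> p) (B j))) \<partial>P) = (\<Prod>j\<in>J. poisson_pgf_at (s j) (emeasure \<mu> (B j)))"
  shows "poisson_random_measure P \<Phi> \<mu>"
proof -
  interpret prob_space P by fact
  have single: "expectation (\<lambda>p. pgf_power s (emeasure (\<Phi> p) B)) = poisson_pgf_at s (emeasure \<mu> B)"
    if "B \<in> sets \<mu>" "0 \<le> s" "s < 1" for s B
    using pgf[of "{0}" "\<lambda>_. B" "\<lambda>_. s"] that by (simp add: disjoint_family_on_def)
  have prob_count: "prob {p \<in> space P. emeasure (\<Phi> p) B = of_nat k} = a k"
    if B: "B \<in> sets \<mu>" and a: "\<And>k. \<bar>a k\<bar> \<le> C"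
      "\<And>s. 0 \<le> s \<Longrightarrow> s < 1 \<Longrightarrow> (\<lambda>k. a k * s ^ k) sums poisson_pgf_at s (emeasure \<mu> B)" for B k a C
  proof -
    have "expectation (\<lambda>p. (1 :: real) * of_bool (emeasure (\<Phi> p) B = of_nat k)) = a k"
      by (rule prob_eq_of_pgf[OF meas[OF B] vals[OF _ B] a(1)]) (use a(2) single[OF B] in auto)
    moreover have "expectation (\<lambda>p. (1 :: real) * of_bool (emeasure (\<Phi> p) B = of_nat k))
      = expectation (indicator {p \<in> space P. emeasure (\<Phi> p) B = of_nat k})"
      by (intro Bochner_Integration.integral_cong) (auto simp: indicator_def)
    moreover have "\<dots> = prob {p \<in> space P. emeasure (\<Phi> p) B = of_nat k}"
      by (simp add: Int_absorb2)
    ultimately show ?thesis by simp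
  qed
  show ?thesis
    unfolding poisson_random_measure_def
  proof (intro conjI ballI impI allI)
    fix B k assume B: "B \<in> sets \<mu>" and fin: "emeasure \<mu> B < \<infinity>"
    define l where "l = measure \<mu> B"
    have l: "l \<ge> 0" by (simp add: l_def)
    have exp_s: "(\<lambda>k. l ^ k / fact k * exp (- l) * s ^ k) sums exp (- (1 - s) * l)" for s
    proof -
      have "(\<lambda>k. (l * s) ^ k /\<^sub>R fact k * exp (- l)) sums (exp (l * s) * exp (- l))"
        by (intro sums_mult2 exp_converges)
      moreover have "exp (l * s) * exp (- l) = exp (- (1 - s) * l)"
        by (simp add: exp_add[symmetric] algebra_simps)
      ultimately show ?thesis by (simp add: power_mult_distrib divide_inverse mult_ac)
    qed
    show "prob {p \<in> space P. emeasure (\<Phi> p) B = of_nat k} = measure \<mu> B ^ k / fact k * exp (- measure \<mu> B)"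
      unfolding l_def[symmetric]
    proof (rule prob_count[OF B])
      fix k
      have nn: "0 \<le> l ^ n / fact n * exp (- l)" for n using l by simp
      have "l ^ k / fact k * exp (- l) \<le> (\<Sum>n. l ^ n / fact n * exp (- l))"
        using sums_summable[OF exp_s[of 1]] nn sum_le_suminf[of "\<lambda>n. l ^ n / fact n * exp (- l)" "{k}"] by simp
      also have "\<dots> = 1" using sums_unique[OF exp_s[of 1]] by simp
      finally show "\<bar>l ^ k / fact k * exp (- l)\<bar> \<le> 1" unfolding abs_of_nonneg[OF nn] .
    next
      fix s :: real
      show "(\<lambda>k. l ^ k / fact k * exp (- l) * s ^ k) sums poisson_pgf_at s (emeasure \<mu> B)"
      proof -
        have "emeasure \<mu> B \<noteq> \<top>" using fin by auto
        then show ?thesis using exp_s[of s] by (simp only: poisson_pgf_at_def l_def measure_def if_False)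
      qed
    qed
  next
    fix B assume B: "B \<in> sets \<mu>" and inf: "emeasure \<mu> B = \<infinity>"
    have "prob {p \<in> space P. emeasure (\<Phi> p) B = of_nat k} = 0" for k
    proof (rule prob_count[OF B])
      show "\<bar>0 :: real\<bar> \<le> 0" by simp
      show "(\<lambda>k. 0 * s ^ k) sums poisson_pgf_at s (emeasure \<mu> B)" for s
        using inf by (simp add: poisson_pgf_at_def)
    qed
    then have "AE p in P. emeasure (\<Phi> p) B \<noteq> of_nat k" for k
      using meas[OF B] by (intro AE_I[where N = "{p \<in> space P. emeasure (\<Phi> p) B = of_nat k}"])
        (auto simp: emeasure_eq_measure)
    then have "AE p in P. \<forall>k. emeasure (\<Phi> p) B \<noteq> of_nat k" by (simp add: AE_all_countable)
    then show "AE p in P. emeasure (\<Phi> p) B = \<infinity>"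
      using AE_space by eventually_elim (use vals[OF _ B] in auto)
  next
    fix n :: nat and B assume B: "(\<forall>i<n. B i \<in> sets \<mu>) \<and> disjoint_family_on B {..<n}"
    show "indep_vars (\<lambda>_. borel) (\<lambda>i p. emeasure (\<Phi> p) (B i)) {..<n}"
    proof (rule indep_vars_of_prob_joint)
      fix J and k :: "nat \<Rightarrow> nat" assume J: "J \<subseteq> {..<n}" "finite J"
      have BJ: "B j \<in> sets \<mu>" if "j \<in> J" for j using B J(1) that by auto
      show "prob {p \<in> space P. \<forall>j\<in>J. emeasure (\<Phi> p) (B j) = of_nat (k j)}
        = (\<Prod>j\<in>J. prob {p \<in> space P. emeasure (\<Phi> p) (B j) = of_nat (k j)})"
      proof (rule prob_joint_of_pgf[OF J(2), where \<psi> = "\<lambda>j s. poisson_pgf_at s (emeasure \<mu> (B j))"])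
        fix K and s :: "nat \<Rightarrow> real" assume K: "K \<subseteq> J" and s: "\<And>j. j \<in> K \<Longrightarrow> 0 \<le> s j \<and> s j < 1"
        show "expectation (\<lambda>p. \<Prod>j\<in>K. pgf_power (s j) (emeasure (\<Phi> p) (B j)))
          = (\<Prod>j\<in>K. poisson_pgf_at (s j) (emeasure \<mu> (B j)))"
          by (rule pgf) (use K J B s in \<open>auto intro: finite_subset disjoint_family_on_mono\<close>)
      qed (use BJ meas vals in blast)+
    qed (use B meas vals in auto)
  qed (use P sets meas in auto)
qed

section \<open>Existence of Poisson random measures\<close>

lemma poisson_pgf_at_LIMSEQ:
  fixes a :: "nat \<Rightarrow> real"
  assumes a: "\<And>m. 0 \<le> a m" and s: "s < 1"
  shows "(\<lambda>M. exp (- (1 - s) * (\<Sum>m<M. a m))) \<longlonglongrightarrow> poisson_pgf_at s (\<Sum>m. ennreal (a m))"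
proof -
  define L where "L = (\<Sum>m. ennreal (a m))"
  have lim: "(\<lambda>M. ennreal (\<Sum>m<M. a m)) \<longlonglongrightarrow> L"
    using summable_LIMSEQ[OF summableI, of "\<lambda>m. ennreal (a m)"] unfolding L_def sum_ennreal[OF a] .
  show ?thesis
  proof (cases "L = \<top>")
    case True
    have "filterlim (\<lambda>M. \<Sum>m<M. a m) at_top sequentially"
    proof (rule filterlim_at_top[THEN iffD2], rule allI)
      fix Z :: real
      have "ennreal \<bar>Z\<bar> < L" using True by simp
      from order_tendstoD(1)[OF lim this]
      show "\<forall>\<^sub>F M in sequentially. Z \<le> (\<Sum>m<M. a m)"
        by eventually_elim (use a in \<open>auto simp: ennreal_less_iff sum_nonneg\<close>)
    qed
    then have "filterlim (\<lambda>M. (1 - s) * (\<Sum>m<M. a m)) at_top sequentially"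
      using s by (intro filterlim_tendsto_pos_mult_at_top[OF tendsto_const]) auto
    then have "filterlim (\<lambda>M. - ((1 - s) * (\<Sum>m<M. a m))) at_bot sequentially"
      by (simp add: filterlim_uminus_at_top)
    from filterlim_compose[OF exp_at_bot this] True show ?thesis
      by (simp add: poisson_pgf_at_def L_def algebra_simps)
  next
    case False
    then obtain l where l: "L = ennreal l" "0 \<le> l" by (cases L) auto
    have "(\<lambda>M. \<Sum>m<M. a m) \<longlonglongrightarrow> l"
      using lim l a by (intro tendsto_ennrealD) (auto simp: sum_nonneg)
    then have "(\<lambda>M. exp (- (1 - s) * (\<Sum>m<M. a m))) \<longlonglongrightarrow> exp (- (1 - s) * l)"
      by (intro tendsto_intros)
    then show ?thesis using l False by (simp add: poisson_pgf_at_def L_def[symmetric])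
  qed
qed

lemma prod_if_one_eq_power:
  fixes s :: "'b::comm_monoid_mult"
  assumes "finite A"
  shows "(\<Prod>i\<in>A. if Q i then s else 1) = s ^ card {i \<in> A. Q i}"
  using prod.inter_filter[OF assms, of "\<lambda>_. s" Q] by simp

text \<open>
  The point process with block \<open>m\<close> consisting of the first \<open>fst (z m)\<close> points of the sequence
  \<open>snd (z m)\<close>, as a sum of unit masses.
\<close>
definition marked_points :: "'w measure \<Rightarrow> (nat \<Rightarrow> nat \<times> (nat \<Rightarrow> 'w)) \<Rightarrow> 'w measure"
  where "marked_points M z = distr (count_space {(m, i). i < fst (z m)}) M (\<lambda>(m, i). snd (z m) i)"

lemma sets_marked_points [simp]: "sets (marked_points M z) = sets M"
  by (simp add: marked_points_def)

lemma emeasure_marked_points: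
  assumes B: "B \<in> sets M" and M: "space M = UNIV"
  shows "emeasure (marked_points M z) B = (\<Sum>m. of_nat (card {i. i < fst (z m) \<and> snd (z m) i \<in> B}))"
proof -
  let ?I = "{(m, i). i < fst (z m)}"
  let ?C = "\<lambda>m. {i. i < fst (z m) \<and> snd (z m) i \<in> B}"
  have "emeasure (marked_points M z) B = emeasure (count_space ?I) ((\<lambda>(m, i). snd (z m) i) -` B \<inter> ?I)"
    unfolding marked_points_def using B M by (subst emeasure_distr) auto
  also have "(\<lambda>(m, i). snd (z m) i) -` B \<inter> ?I = (\<Union>m. Pair m ` ?C m)" by auto
  also have "emeasure (count_space ?I) \<dots> = (\<Sum>m. emeasure (count_space ?I) (Pair m ` ?C m))"
    by (rule suminf_emeasure[symmetric]) (auto simp: disjoint_family_on_def)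
  also have "\<dots> = (\<Sum>m. of_nat (card (?C m)))"
  proof (rule suminf_cong)
    fix m
    have "emeasure (count_space ?I) (Pair m ` ?C m) = of_nat (card (Pair m ` ?C m))"
      by (rule emeasure_count_space_finite) auto
    also have "card (Pair m ` ?C m) = card (?C m)" by (rule card_image) (simp add: inj_on_def)
    finally show "emeasure (count_space ?I) (Pair m ` ?C m) = of_nat (card (?C m))" .
  qed
  finally show ?thesis .
qed

lemma emeasure_marked_points_nonzero:
  assumes B: "B \<in> sets M" and M: "space M = UNIV"
  shows "emeasure (marked_points M z) B \<noteq> 0 \<longleftrightarrow> (\<exists>m i. i < fst (z m) \<and> snd (z m) i \<in> B)"
proof -
  have "emeasure (marked_points M z) B = 0 \<longleftrightarrow> (\<forall>m. card {i. i < fst (z m) \<and> snd (z m) i \<in> B} = 0)"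
    unfolding emeasure_marked_points[OF B M] by (subst suminf_eq_zero_iff) auto
  then show ?thesis by auto
qed

text \<open>
  All random ingredients are written into one real sequence: position \<open>(m, 0)\<close> holds the number of points
  of block \<open>m\<close>, position \<open>(m, Suc (i, k))\<close> the \<open>k\<close>-th coordinate of its \<open>i\<close>-th point.
\<close>
definition enc_marks :: "(nat \<Rightarrow> nat \<times> (nat \<Rightarrow> real_seq)) \<Rightarrow> real_seq"
  where "enc_marks z = (\<lambda>n. case prod_decode n of (m, l) \<Rightarrow>
    (case l of 0 \<Rightarrow> real (fst (z m)) | Suc j \<Rightarrow> (case prod_decode j of (i, k) \<Rightarrow> snd (z m) i k)))"

definition dec_marks :: "real_seq \<Rightarrow> nat \<Rightarrow> nat \<times> (nat \<Rightarrow> real_seq)"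
  where "dec_marks p = (\<lambda>m. (nat \<lfloor>p (prod_encode (m, 0))\<rfloor>, \<lambda>i k. p (prod_encode (m, Suc (prod_encode (i, k))))))"

lemma dec_enc_marks [simp]: "dec_marks (enc_marks z) = z"
  by (simp add: dec_marks_def enc_marks_def)

lemma dec_marks_measurable [measurable]:
  "(\<lambda>p. fst (dec_marks p m)) \<in> borel \<rightarrow>\<^sub>M count_space UNIV"
  "(\<lambda>p. snd (dec_marks p m) i) \<in> borel \<rightarrow>\<^sub>M borel"
  unfolding dec_marks_def by (simp_all, measurable, auto intro: measurable_coordinatewise_then_product)

lemma emeasure_marked_points_dec_measurable:
  assumes M: "sets M = sets (borel :: real_seq measure)" and B: "B \<in> sets M"
  shows "(\<lambda>p. emeasure (marked_points M (dec_marks p)) B) \<in> borel_measurable borel"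
proof -
  have sp: "space M = UNIV" using sets_eq_imp_space_eq[OF M] by simp
  have [measurable]: "B \<in> sets borel" using B M by simp
  have "(of_nat (card {i. i < fst (z m) \<and> snd (z m) i \<in> B}) :: ennreal)
    = (\<Sum>i. of_bool (i < fst (z m) \<and> snd (z m) i \<in> B))" for z :: "nat \<Rightarrow> nat \<times> (nat \<Rightarrow> real_seq)" and m
  proof -
    have "(\<Sum>i. of_bool (i < fst (z m) \<and> snd (z m) i \<in> B) :: ennreal)
      = (\<Sum>i<fst (z m). of_bool (i < fst (z m) \<and> snd (z m) i \<in> B))"
      by (rule suminf_finite) auto
    also have "\<dots> = of_nat (card {i. i < fst (z m) \<and> snd (z m) i \<in> B})"
      by (simp add: of_bool_def sum.If_cases Int_def conj_commute)
    finally show ?thesis by simp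
  qed
  then have "(\<lambda>p. emeasure (marked_points M (dec_marks p)) B)
    = (\<lambda>p. \<Sum>m. \<Sum>i. of_bool (i < fst (dec_marks p m) \<and> snd (dec_marks p m) i \<in> B))"
    by (simp add: emeasure_marked_points[OF B sp])
  also have "\<dots> \<in> borel_measurable borel"
  proof -
    have "(\<lambda>p. of_bool (i < fst (dec_marks p m) \<and> snd (dec_marks p m) i \<in> B) :: ennreal) \<in> borel_measurable borel" for i m
      by measurable
    then show ?thesis by measurable
  qed
  finally show ?thesis .
qed

lemma enc_marks_measurable:
  assumes V: "\<And>m. sets (V m) = sets (count_space UNIV \<Otimes>\<^sub>M PiM UNIV (\<lambda>_::nat. borel))"
  shows "enc_marks \<in> PiM UNIV V \<rightarrow>\<^sub>M borel"
proof (rule measurable_coordinatewise_then_product)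
  fix n :: nat
  obtain m l where ml: "prod_decode n = (m, l)" by fastforce
  have c: "(\<lambda>z. z m) \<in> PiM UNIV V \<rightarrow>\<^sub>M count_space UNIV \<Otimes>\<^sub>M PiM UNIV (\<lambda>_::nat. borel :: real_seq measure)"
    using measurable_component_singleton[of m UNIV V] V[of m] by (simp cong: measurable_cong_sets)
  show "(\<lambda>z. enc_marks z n) \<in> borel_measurable (PiM UNIV V)"
  proof (cases l)
    case 0
    have "(\<lambda>z. real (fst (z m))) \<in> borel_measurable (PiM UNIV V)"
      by (rule measurable_compose[OF measurable_compose[OF c measurable_fst]]) simp
    then show ?thesis by (simp add: enc_marks_def ml 0)
  next
    case (Suc j)
    obtain i k where ik: "prod_decode j = (i, k)" by fastforce
    have "(\<lambda>z. snd (z m) i) \<in> PiM UNIV V \<rightarrow>\<^sub>M (borel :: real_seq measure)"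
      by (rule measurable_compose[OF measurable_compose[OF c measurable_snd]]) simp
    then have "(\<lambda>z. snd (z m) i k) \<in> borel_measurable (PiM UNIV V)"
      by (rule measurable_compose) simp
    then show ?thesis by (simp add: enc_marks_def ml Suc ik)
  qed
qed

text \<open>
  Superposition of independent processes on disjoint pieces \<open>E m\<close> of finite mass.  The generating
  function of the counts in the first \<open>M\<close> blocks is a product of \<open>finite_poisson_process\<close> formulas, and
  dominated convergence lets \<open>M\<close> tend to infinity.
\<close>
lemma poisson_random_measure_exists:
  fixes \<mu> :: "real_seq measure"
  assumes sets_\<mu>: "sets \<mu> = sets borel" and sf: "sigma_finite_measure \<mu>"
  shows "\<exists>P :: real_seq measure. sets P = sets borel \<and>
    poisson_random_measure P (\<lambda>p. marked_points \<mu> (dec_marks p)) \<mu>"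
proof -
  have space_\<mu>: "space \<mu> = UNIV" using sets_eq_imp_space_eq[OF sets_\<mu>] by simp
  interpret sigma_finite_measure \<mu> by (rule sf)
  obtain E :: "nat \<Rightarrow> real_seq set" where E: "range E \<subseteq> sets \<mu>" "(\<Union>m. E m) = space \<mu>"
    "\<And>m. emeasure \<mu> (E m) \<noteq> \<infinity>" "disjoint_family E"
    using sigma_finite_disjoint by metis
  have Em: "E m \<in> sets \<mu>" for m using E(1) by auto
  define \<mu>m where "\<mu>m m = density \<mu> (indicator (E m))" for m
  have sets_m [simp]: "sets (\<mu>m m) = sets \<mu>" and space_m: "space (\<mu>m m) = UNIV" for m
    by (simp_all add: \<mu>m_def space_\<mu>)
  have em_m: "emeasure (\<mu>m m) B = emeasure \<mu> (B \<inter> E m)" if "B \<in> sets \<mu>" for B m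
    using that Em[of m] unfolding \<mu>m_def by (subst emeasure_restricted) (auto simp: Int_commute)
  have fin_m: "finite_measure (\<mu>m m)" for m
    using E(3)[of m] Em[of m] sets.sets_into_space[OF Em[of m]] sets.top[of \<mu>]
    by (intro finite_measureI) (simp add: space_m em_m space_\<mu>)
  let ?Q = "\<lambda>m V. prob_space V \<and>
    sets V = sets (count_space UNIV \<Otimes>\<^sub>M PiM UNIV (\<lambda>_. \<mu>m m)) \<and>
    (\<forall>g \<in> borel_measurable (\<mu>m m). (\<forall>x. 0 \<le> g x \<and> g x \<le> 1) \<longrightarrow>
      (\<integral>\<^sup>+z. ennreal (\<Prod>i<fst z. g (snd z i)) \<partial>V) = ennreal (exp (- (\<integral>x. 1 - g x \<partial>\<mu>m m))))"
  have "\<forall>m. \<exists>V :: (nat \<times> (nat \<Rightarrow> real_seq)) measure. ?Q m V"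
    by (intro allI finite_poisson_process fin_m) (simp add: space_m)
  from choice[OF this] obtain V :: "nat \<Rightarrow> (nat \<times> (nat \<Rightarrow> real_seq)) measure"
    where V_all: "\<forall>m. ?Q m (V m)"
    by (elim exE)
  have V: "prob_space (V m)" "sets (V m) = sets (count_space UNIV \<Otimes>\<^sub>M PiM UNIV (\<lambda>_. \<mu>m m))" for m
    by (rule V_all[rule_format, THEN conjunct1], rule V_all[rule_format, THEN conjunct2, THEN conjunct1])
  have V_int: "(\<integral>\<^sup>+z. ennreal (\<Prod>i<fst z. g (snd z i)) \<partial>V m) = ennreal (exp (- (\<integral>x. 1 - g x \<partial>\<mu>m m)))"
    if "g \<in> borel_measurable (\<mu>m m)" "\<And>x. 0 \<le> g x \<and> g x \<le> 1" for m g
    by (rule V_all[rule_format, THEN conjunct2, THEN conjunct2, rule_format]) (rule that)+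
  have V_sets: "sets (V m) = sets (count_space UNIV \<Otimes>\<^sub>M PiM UNIV (\<lambda>_::nat. borel))" for m
    unfolding V(2) by (intro sets_pair_measure_cong sets_PiM_cong) (auto simp: sets_\<mu>)
  interpret V: prob_space "V m" for m by (rule V(1))
  interpret W: product_prob_space V "UNIV :: nat set" ..
  define W where "W = PiM UNIV V"
  interpret Wp: prob_space W unfolding W_def by (rule prob_space_PiM) (rule V(1))
  have enc: "enc_marks \<in> W \<rightarrow>\<^sub>M borel" unfolding W_def by (rule enc_marks_measurable[OF V_sets])
  define P where "P = distr W borel enc_marks"
  have W_meas: "h \<in> borel_measurable W" if "(\<lambda>p. h (dec_marks p)) \<in> borel_measurable borel" for h :: "_ \<Rightarrow> real"
    using measurable_compose[OF enc that] by simp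
  have "poisson_random_measure P (\<lambda>p. marked_points \<mu> (dec_marks p)) \<mu>"
  proof (rule poisson_random_measure_of_pgf)
    show "prob_space P" unfolding P_def by (rule Wp.prob_space_distr[OF enc])
    show "(\<lambda>p. emeasure (marked_points \<mu> (dec_marks p)) B) \<in> borel_measurable P" if "B \<in> sets \<mu>" for B
      using emeasure_marked_points_dec_measurable[OF sets_\<mu> that] by (simp add: P_def)
    show "emeasure (marked_points \<mu> (dec_marks p)) B = \<top> \<or> (\<exists>k. emeasure (marked_points \<mu> (dec_marks p)) B = of_nat k)"
      if "B \<in> sets \<mu>" for p B
      unfolding emeasure_marked_points[OF that space_\<mu>] by (rule pgf_power_LIMSEQ(2)[of 0]) auto
  next
    fix J :: "nat set" and B and s :: "nat \<Rightarrow> real"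
    assume J: "finite J" and B: "\<And>j. j \<in> J \<Longrightarrow> B j \<in> sets \<mu>" and disj: "disjoint_family_on B J"
      and s: "\<And>j. j \<in> J \<Longrightarrow> 0 \<le> s j \<and> s j < 1"
  \<comment> \<open>The joint generating function is the mean of the product of \<open>g\<close> over all points.\<close>
    define g where "g y = (\<Prod>j\<in>J. if y \<in> B j then s j else 1)" for y
    define c where "c z m j = card {i. i < fst (z m) \<and> snd (z m) i \<in> B j}" for z :: "nat \<Rightarrow> nat \<times> (nat \<Rightarrow> real_seq)" and m j
    have g01: "0 \<le> g y \<and> g y \<le> 1" for y
      unfolding g_def using s by (auto intro!: prod_nonneg prod_le_1 simp: less_imp_le)
    have g_meas: "g \<in> borel_measurable (\<mu>m m)" for m
    proof -
      have "(\<lambda>y. if y \<in> B j then s j else 1) \<in> borel_measurable (\<mu>m m)" if "j \<in> J" for j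
        using B[OF that] by (intro measurable_If_set) auto
      then show ?thesis unfolding g_def by (intro borel_measurable_prod)
    qed
    have one_g: "1 - g y = (\<Sum>j\<in>J. (1 - s j) * indicator (B j) y)" for y
    proof (cases "\<exists>j\<in>J. y \<in> B j")
      case True
      then obtain a where a: "a \<in> J" "y \<in> B a" by blast
      have n: "y \<notin> B j" if "j \<in> J - {a}" for j using disj a that by (auto simp: disjoint_family_on_def)
      have "g y = s a" unfolding g_def using a n by (subst prod.remove[OF J a(1)]) simp
      moreover have "(\<Sum>j\<in>J. (1 - s j) * indicator (B j) y) = 1 - s a"
        using a n by (subst sum.remove[OF J a(1)]) simp
      ultimately show ?thesis by simp
    qed (simp add: g_def)
    have int_g: "(\<integral>x. 1 - g x \<partial>\<mu>m m) = (\<Sum>j\<in>J. (1 - s j) * measure (\<mu>m m) (B j))" for m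
    proof -
      interpret f: finite_measure "\<mu>m m" by (rule fin_m)
      have "integrable (\<mu>m m) (\<lambda>y. (1 - s j) * indicator (B j) y :: real)" if "j \<in> J" for j
        using B[OF that] by (simp add: f.emeasure_finite less_top[symmetric])
      then show ?thesis unfolding one_g
        by (subst Bochner_Integration.integral_sum) (auto simp: space_m)
    qed
    define G where "G v = (\<Prod>i<fst v. g (snd v i))" for v :: "nat \<times> (nat \<Rightarrow> real_seq)"
    have G01: "0 \<le> G v \<and> G v \<le> 1" for v
      unfolding G_def using g01 by (auto intro!: prod_nonneg prod_le_1)
    have G_prod: "(\<Prod>m<M. G (z m)) = (\<Prod>j\<in>J. s j ^ (\<Sum>m<M. c z m j))" for z M
    proof -
      have "G (z m) = (\<Prod>j\<in>J. s j ^ c z m j)" for m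
        unfolding G_def g_def c_def
        by (subst prod.swap) (simp add: prod_if_one_eq_power)
      then have "(\<Prod>m<M. G (z m)) = (\<Prod>m<M. \<Prod>j\<in>J. s j ^ c z m j)" by simp
      also have "\<dots> = (\<Prod>j\<in>J. s j ^ (\<Sum>m<M. c z m j))"
        by (subst prod.swap) (simp add: power_sum)
      finally show ?thesis .
    qed
    have G_meas: "(\<lambda>v. ennreal (G v)) \<in> borel_measurable (V m)" for m
      unfolding G_def using mark_prod_measurable[OF g_meas[of m]] V(2)[of m] by (simp cong: measurable_cong_sets)
    have GW_meas: "(\<lambda>z. \<Prod>m<M. G (z m)) \<in> borel_measurable W" for M
    proof -
      have "(\<lambda>z. ennreal (G (z m))) \<in> borel_measurable W" for m
        using measurable_compose[OF measurable_component_singleton[of m UNIV V] G_meas[of m]] by (simp add: W_def)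
      then have "(\<lambda>z. enn2real (ennreal (G (z m)))) \<in> borel_measurable W" for m
        by (rule borel_measurable_enn2real)
      then have "(\<lambda>z. G (z m)) \<in> borel_measurable W" for m using G01 by simp
      then show ?thesis by (rule borel_measurable_prod)
    qed
    have int_G: "(\<integral>z. (\<Prod>m<M. G (z m)) \<partial>W) = (\<Prod>j\<in>J. exp (- (1 - s j) * (\<Sum>m<M. measure (\<mu>m m) (B j))))" for M
    proof -
      have "(\<integral>\<^sup>+z. ennreal (\<Prod>m<M. G (z m)) \<partial>W) = (\<integral>\<^sup>+z. (\<Prod>m\<in>{..<M}. ennreal (G (z m))) \<partial>PiM UNIV V)"
        unfolding W_def using G01 by (simp add: prod_ennreal)
      also have "\<dots> = (\<Prod>m<M. \<integral>\<^sup>+v. ennreal (G v) \<partial>V m)"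
        by (rule W.nn_integral_PiM_prod) (auto intro: G_meas)
      also have "\<dots> = (\<Prod>m<M. ennreal (exp (- (\<Sum>j\<in>J. (1 - s j) * measure (\<mu>m m) (B j)))))"
        unfolding G_def using V_int[OF g_meas g01] by (simp add: int_g)
      also have "\<dots> = ennreal (\<Prod>m<M. exp (- (\<Sum>j\<in>J. (1 - s j) * measure (\<mu>m m) (B j))))"
        by (rule prod_ennreal) simp
      finally have "(\<integral>z. (\<Prod>m<M. G (z m)) \<partial>W) = (\<Prod>m<M. exp (- (\<Sum>j\<in>J. (1 - s j) * measure (\<mu>m m) (B j))))"
        using G01 GW_meas by (subst integral_eq_nn_integral) (simp_all add: prod_nonneg)
      also have "\<dots> = exp (\<Sum>m<M. - (\<Sum>j\<in>J. (1 - s j) * measure (\<mu>m m) (B j)))"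
        by (simp add: exp_sum)
      also have "(\<Sum>m<M. - (\<Sum>j\<in>J. (1 - s j) * measure (\<mu>m m) (B j)))
        = (\<Sum>j\<in>J. - (1 - s j) * (\<Sum>m<M. measure (\<mu>m m) (B j)))"
        unfolding sum_negf by (subst sum.swap) (simp add: sum_negf[symmetric] sum_subtractf sum_distrib_left left_diff_distrib)
      also have "exp \<dots> = (\<Prod>j\<in>J. exp (- (1 - s j) * (\<Sum>m<M. measure (\<mu>m m) (B j))))"
        by (rule exp_sum[OF J])
      finally show ?thesis .
    qed
    let ?F = "\<lambda>z. \<Prod>j\<in>J. pgf_power (s j) (emeasure (marked_points \<mu> z) (B j))"
    have F_meas: "(\<lambda>p. ?F (dec_marks p)) \<in> borel_measurable borel"
      by (intro borel_measurable_prod measurable_compose[OF _ pgf_power_measurable]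
        emeasure_marked_points_dec_measurable[OF sets_\<mu>] B)
    have "(\<lambda>M. \<integral>z. (\<Prod>m<M. G (z m)) \<partial>W) \<longlonglongrightarrow> (\<integral>z. ?F z \<partial>W)"
    proof (rule integral_dominated_convergence[where w = "\<lambda>_. 1"])
      show "?F \<in> borel_measurable W" by (rule W_meas[OF F_meas])
      show "AE z in W. (\<lambda>M. \<Prod>m<M. G (z m)) \<longlonglongrightarrow> ?F z"
      proof (rule AE_I2)
        fix z
        show "(\<lambda>M. \<Prod>m<M. G (z m)) \<longlonglongrightarrow> ?F z"
          unfolding G_prod
        proof (rule tendsto_prod)
          fix j assume j: "j \<in> J"
          show "(\<lambda>M. s j ^ (\<Sum>m<M. c z m j)) \<longlonglongrightarrow> pgf_power (s j) (emeasure (marked_points \<mu> z) (B j))"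
            unfolding emeasure_marked_points[OF B[OF j] space_\<mu>] c_def
            using s[OF j] by (intro pgf_power_LIMSEQ(1)) auto
        qed
      qed
      show "AE z in W. norm (\<Prod>m<M. G (z m)) \<le> 1" for M
        using G01 by (intro AE_I2) (simp add: prod_nonneg prod_le_1)
    qed (use GW_meas in auto)
    moreover have "(\<lambda>M. \<integral>z. (\<Prod>m<M. G (z m)) \<partial>W) \<longlonglongrightarrow> (\<Prod>j\<in>J. poisson_pgf_at (s j) (emeasure \<mu> (B j)))"
      unfolding int_G
    proof (rule tendsto_prod)
      fix j assume j: "j \<in> J"
      have "emeasure \<mu> (B j) = (\<Sum>m. emeasure \<mu> (B j \<inter> E m))"
      proof -
        have "(\<Sum>m. emeasure \<mu> (B j \<inter> E m)) = emeasure \<mu> (\<Union>m. B j \<inter> E m)"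
          using E(4) Em B[OF j] by (intro suminf_emeasure) (auto simp: disjoint_family_on_def)
        also have "(\<Union>m. B j \<inter> E m) = B j" using E(2) by (auto simp: space_\<mu>)
        finally show ?thesis by simp
      qed
      also have "\<dots> = (\<Sum>m. ennreal (measure (\<mu>m m) (B j)))"
        using fin_m B[OF j] by (simp add: em_m[symmetric] finite_measure.emeasure_eq_measure)
      finally show "(\<lambda>M. exp (- (1 - s j) * (\<Sum>m<M. measure (\<mu>m m) (B j)))) \<longlonglongrightarrow> poisson_pgf_at (s j) (emeasure \<mu> (B j))"
        using s[OF j] by (simp only:) (rule poisson_pgf_at_LIMSEQ, auto)
    qed
    ultimately have "(\<integral>z. ?F z \<partial>W) = (\<Prod>j\<in>J. poisson_pgf_at (s j) (emeasure \<mu> (B j)))"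
      by (rule LIMSEQ_unique)
    moreover have "(\<integral>p. ?F (dec_marks p) \<partial>P) = (\<integral>z. ?F z \<partial>W)"
      unfolding P_def by (subst integral_distr[OF enc F_meas]) simp
    ultimately show "(\<integral>p. ?F (dec_marks p) \<partial>P) = (\<Prod>j\<in>J. poisson_pgf_at (s j) (emeasure \<mu> (B j)))" by simp
  qed simp
  then show ?thesis by (intro exI[of _ P]) (simp add: P_def)
qed

section \<open>The spectral representation\<close>

theorem theorem4p9:
  fixes M :: "'a measure" and S :: "'a \<Rightarrow> (real ^ 'd) set"
  assumes "random_set M S"
    and "stationary_set M S"
    and "stochastically_continuous_set M S"
    and "union_id TYPE('b) M S"
    and "\<forall>t. measure M {\<omega> \<in> space M. t \<in> S \<omega>} < 1"
  shows "\<exists>(\<mu> :: real_seq measure) (T :: real ^ 'd \<Rightarrow> real_seq \<Rightarrow> real_seq) A.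
    sigma_finite_borel_space \<mu> \<and> measurable_mp_action \<mu> T \<and>
    A \<in> sets \<mu> \<and> emeasure \<mu> A < \<infinity> \<and>
    (\<exists>(P :: real_seq measure) \<Phi>. poisson_random_measure P \<Phi> \<mu> \<and>
      random_set P (hitting_set \<mu> T A \<Phi>) \<and>
      eq_distr_sets M S P (hitting_set \<mu> T A \<Phi>))"
proof -
  have M: "prob_space M" using assms(1) by (simp add: random_set_def)
  obtain K where pos: "\<And>J. finite J \<Longrightarrow> 0 < miss_prob M S J"
    and "stationary_levy (\<lambda>J. - ln (miss_prob M S J)) K"
    using stationary_levy_of_union_id[OF assms] by blast
  then interpret L: stationary_levy "\<lambda>J. - ln (miss_prob M S J)" K by simp
  let ?T = "flow (dense_seq :: nat \<Rightarrow> real ^ 'd)"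
  have T [measurable]: "?T t \<in> borel \<rightarrow>\<^sub>M borel" for t by (rule L.ds.flow_measurable1)
  have TA: "?T t -` L.origin_set \<in> sets borel" for t
    using measurable_sets[OF T L.origin_set_in_sets] by simp
  have sb: "sigma_finite_borel_space L.flow_measure"
    unfolding sigma_finite_borel_space_def
    using borel_space_borel[OF L.sets_flow_measure] L.sigma_finite_flow_measure by simp
  have act: "measurable_mp_action L.flow_measure ?T"
    by (rule L.ds.measurable_mp_action_flow[OF L.sets_flow_measure L.emeasure_flow_measure_flow])
  have finA: "emeasure L.flow_measure L.origin_set < \<infinity>"
  proof -
    have "?T 0 -` L.origin_set = L.origin_set" by (auto simp: L.ds.flow_zero)
    then show ?thesis using L.emeasure_flow_measure_UN[of "{0}"] by simp
  qed
  define \<Phi> where "\<Phi> p = marked_points L.flow_measure (dec_marks p)" for p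
  obtain P :: "real_seq measure" where sets_P [measurable_cong]: "sets P = sets borel"
    and prm: "poisson_random_measure P \<Phi> L.flow_measure"
    using poisson_random_measure_exists[OF L.sets_flow_measure L.sigma_finite_flow_measure]
    unfolding \<Phi>_def by blast
  have P: "prob_space P" using prm by (simp add: poisson_random_measure_def)
  let ?H = "hitting_set L.flow_measure ?T L.origin_set \<Phi>"
  have nonzero: "emeasure (\<Phi> p) B \<noteq> 0 \<longleftrightarrow> (\<exists>m i. i < fst (dec_marks p m) \<and> snd (dec_marks p m) i \<in> B)"
    if "B \<in> sets borel" for p B
    unfolding \<Phi>_def using that by (intro emeasure_marked_points_nonzero) auto
  have mem: "t \<in> ?H p \<longleftrightarrow> (\<exists>m i. i < fst (dec_marks p m) \<and> ?T t (snd (dec_marks p m) i) \<in> L.origin_set)" for t p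
    using nonzero[OF TA[of t], of p] by (simp add: hitting_set_def)
  have rs: "random_set P ?H"
    unfolding random_set_def
  proof (intro conjI P)
    have [measurable]: "(\<lambda>z. ?T (fst z) (snd (dec_marks (snd z) m) i)) \<in> borel \<Otimes>\<^sub>M P \<rightarrow>\<^sub>M borel" for m i
    proof -
      have "(\<lambda>z. (fst z, snd (dec_marks (snd z) m) i)) \<in> borel \<Otimes>\<^sub>M P \<rightarrow>\<^sub>M borel \<Otimes>\<^sub>M borel"
        by measurable
      from measurable_compose[OF this L.ds.flow_measurable] show ?thesis by simp
    qed
    have "(\<lambda>z. of_bool (\<exists>m i. i < fst (dec_marks (snd z) m) \<and> ?T (fst z) (snd (dec_marks (snd z) m) i) \<in> L.origin_set) :: real)
      \<in> borel_measurable (borel \<Otimes>\<^sub>M P)"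
      by measurable
    then show "(\<lambda>(t, p). ind_process ?H t p) \<in> borel_measurable (borel \<Otimes>\<^sub>M P)"
      by (simp add: case_prod_beta' ind_process_def indicator_def of_bool_def mem cong: if_cong)
  qed
  have "eq_distr_sets M S P ?H"
  proof (rule eq_distr_sets_of_miss_prob[OF M pred_mem_random_set[OF assms(1)] P pred_mem_random_set[OF rs]])
    fix J :: "(real ^ 'd) set" assume J: "finite J"
    let ?U = "\<Union>t\<in>J. ?T t -` L.origin_set"
    have U: "?U \<in> sets borel" using J TA by auto
    have em: "emeasure L.flow_measure ?U = ennreal (- ln (miss_prob M S J))"
      by (rule L.emeasure_flow_measure_UN[OF J])
    have "(\<forall>t\<in>J. t \<notin> ?H p) \<longleftrightarrow> emeasure (\<Phi> p) ?U = of_nat 0" for p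
      using nonzero[OF U, of p] by (auto simp: mem)
    then have "miss_prob P ?H J = measure P {p \<in> space P. emeasure (\<Phi> p) ?U = of_nat 0}"
      by (simp add: miss_prob_def)
    also have "\<dots> = measure L.flow_measure ?U ^ 0 / fact 0 * exp (- measure L.flow_measure ?U)"
    proof -
      have "\<forall>B\<in>sets L.flow_measure. emeasure L.flow_measure B < \<infinity> \<longrightarrow> (\<forall>k::nat.
        measure P {p \<in> space P. emeasure (\<Phi> p) B = of_nat k}
          = measure L.flow_measure B ^ k / fact k * exp (- measure L.flow_measure B))"
        using prm unfolding poisson_random_measure_def by (elim conjE)
      from this[rule_format, of ?U 0] show ?thesis using U by (simp add: em)
    qed
    also have "measure L.flow_measure ?U = - ln (miss_prob M S J)"
      using em L.Psi_nonneg[OF J] by (simp add: measure_def)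
    finally show "miss_prob M S J = miss_prob P ?H J" using pos[OF J] by simp
  qed
  with sb act finA prm rs show ?thesis
    by (intro exI[of _ L.flow_measure] exI[of _ ?T] exI[of _ L.origin_set] exI[of _ P] exI[of _ \<Phi>] conjI) simp_all
qed

end
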